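(* Let $\mathcal{H}$ be a normalized complete Pick space on a set $X$. Then the following are equivalent. (i) $X$ is a maximal domain for $\mathcal{H}$. (ii) Every weak-$*$ continuous character on $\mathrm{Mult}(\mathcal{H})$ is given by evaluation at a point in $X$. (iii) The characters of evaluation at points in $X$ form a Gleason part in the maximal ideal space of $\mathrm{Mult}(\mathcal{H})$.
   Context: $\mathcal{H}$ is a reproducing kernel Hilbert space of complex-valued functions on a set $X$ with reproducing kernel $k$, and it is assumed that $k$ does not vanish on the diagonal. The multiplier algebra is $\mathrm{Mult}(\mathcal{H}) = \{\varphi : X \to \mathbb{C} : \varphi f \in \mathcal{H} \text{ for all } f \in \mathcal{H}\}$; each $\varphi \in \mathrm{Mult}(\mathcal{H})$ gives a bounded multiplication operator $M_\varphi$ on $\mathcal{H}$, and $\|\varphi\|_{\mathrm{Mult}(\mathcal{H})} = \|M_\varphi\|$. The assignment $\varphi \mapsto M_\varphi$ identifies $\mathrm{Mult}(\mathcal{H})$ with a weak-$*$ closed subalgebra of $B(\mathcal{H})$, and $\mathrm{Mult}(\mathcal{H})$ carries the resulting weak-$*$ topology. $\mathcal{H}$ is normalized if there is a point $x_0 \in X$ such that $k(x,x_0) = 1$ for all $x \in X$. $\mathcal{H}$ is a complete Pick space if for every $r \in \mathbb{N}$ and every finite collection of points $z_1,\ldots,z_n \in X$ and matrices $W_1,\ldots,W_n \in M_r(\mathbb{C})$, positive semidefiniteness of the $nr \times nr$ block matrix $[k(z_i,z_j)(I_{\mathbb{C}^r} - W_i W_j^* )]_{i,j=1}^n$ implies that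 there exists $\Phi \in M_r(\mathrm{Mult}(\mathcal{H}))$ of norm at most $1$ (as a multiplication operator on $\mathcal{H} \otimes \mathbb{C}^r$) with $\Phi(z_i) = W_i$ for $i=1,\ldots,n$. A non-zero bounded linear functional $\rho$ on $\mathcal{H}$ is partially multiplicative if $\rho(fg) = \rho(f)\rho(g)$ whenever $f,g \in \mathcal{H}$ are such that $fg \in \mathcal{H}$. $X$ is a maximal domain for $\mathcal{H}$ if every partially multiplicative functional on $\mathcal{H}$ is given by evaluation at a point in $X$. A character on $\mathrm{Mult}(\mathcal{H})$ is a non-zero multiplicative linear functional; the maximal ideal space of $\mathrm{Mult}(\mathcal{H})$ is the set of its characters. For characters $\rho_1,\rho_2$, write $\rho_1 \sim \rho_2$ if $\|\rho_1 - \rho_2\| < 2$ (norm in the dual of the Banach algebra $\mathrm{Mult}(\mathcal{H})$). This is an equivalence relation, and its equivalence classes are called Gleason parts. *)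

theory Defs
  imports
    "HOL-Analysis.Abstract_Topology"
    "HOL-Analysis.Function_Topology"
    "HOL-Library.FuncSet"
    "Jordan_Normal_Form.Schur_Decomposition"
begin

text \<open>
  A complex-valued function on the set \<open>X\<close> is represented by a function on the
  ambient type that vanishes off \<open>X\<close>.  Pointwise sums, scalar multiples and products of such
  functions are again of this form, and two of them are equal iff they agree on \<open>X\<close>.
\<close>

definition functional_on :: "('a \<Rightarrow> complex) set \<Rightarrow> (('a \<Rightarrow> complex) \<Rightarrow> complex) \<Rightarrow> bool" where
  "functional_on V l \<longleftrightarrow>
     (\<forall>f\<in>V. \<forall>g\<in>V. l (\<lambda>x. f x + g x) = l f + l g) \<and>
     (\<forall>c. \<forall>f\<in>V. l (\<lambda>x. c * f x) = c * l f)"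

definition op_norm :: "'v set \<Rightarrow> ('v \<Rightarrow> real) \<Rightarrow> ('w \<Rightarrow> real) \<Rightarrow> ('v \<Rightarrow> 'w) \<Rightarrow> real" where
  "op_norm V p q T = (SUP v\<in>{v \<in> V. p v \<le> 1}. q (T v))"

text \<open>
  The inequality below is the order of \<^theory>\<open>HOL-Library.Complex_Order\<close>: the quadratic form
  is required to be real and nonnegative, which forces the matrix to be Hermitian.
\<close>

definition psd_mat :: "nat \<Rightarrow> complex mat \<Rightarrow> bool" where
  "psd_mat N A \<longleftrightarrow> A \<in> carrier_mat N N \<and> (\<forall>v\<in>carrier_vec N. 0 \<le> (A *\<^sub>v v) \<bullet>c v)"

text \<open>
  The block matrix \<open>[k (z i) (z j) (1 - W i (W j)\<^sup>*)]\<close>; row \<open>p\<close> is row \<open>p mod r\<close> of the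
  block row \<open>p div r\<close>, and likewise for columns.  Points and matrices are indexed from 0.
\<close>

definition pick_mat ::
    "('a \<Rightarrow> 'a \<Rightarrow> complex) \<Rightarrow> nat \<Rightarrow> nat \<Rightarrow> (nat \<Rightarrow> 'a) \<Rightarrow> (nat \<Rightarrow> complex mat) \<Rightarrow> complex mat" where
  "pick_mat k n r z W = mat (n * r) (n * r) (\<lambda>(p, q).
     k (z (p div r)) (z (q div r)) *
     (1\<^sub>m r - W (p div r) * mat_adjoint (W (q div r))) $$ (p mod r, q mod r))"

locale rkhs =
  fixes X :: "'a set"
    and H :: "('a \<Rightarrow> complex) set"
    and ip :: "('a \<Rightarrow> complex) \<Rightarrow> ('a \<Rightarrow> complex) \<Rightarrow> complex"
    and k :: "'a \<Rightarrow> 'a \<Rightarrow> complex"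
  assumes vanishes: "\<And>f x. f \<in> H \<Longrightarrow> x \<notin> X \<Longrightarrow> f x = 0"
    and zero_mem: "(\<lambda>x. 0) \<in> H"
    and add_mem: "\<And>f g. f \<in> H \<Longrightarrow> g \<in> H \<Longrightarrow> (\<lambda>x. f x + g x) \<in> H"
    and scale_mem: "\<And>c f. f \<in> H \<Longrightarrow> (\<lambda>x. c * f x) \<in> H"
    and ip_add: "\<And>f g h. f \<in> H \<Longrightarrow> g \<in> H \<Longrightarrow> h \<in> H \<Longrightarrow> ip (\<lambda>x. f x + g x) h = ip f h + ip g h"
    and ip_scale: "\<And>c f g. f \<in> H \<Longrightarrow> g \<in> H \<Longrightarrow> ip (\<lambda>x. c * f x) g = c * ip f g"
    and ip_cnj: "\<And>f g. f \<in> H \<Longrightarrow> g \<in> H \<Longrightarrow> ip g f = cnj (ip f g)"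
    and ip_nonneg: "\<And>f. f \<in> H \<Longrightarrow> 0 \<le> Re (ip f f)"
    and ip_definite: "\<And>f. f \<in> H \<Longrightarrow> ip f f = 0 \<Longrightarrow> f = (\<lambda>x. 0)"
    and complete: "\<And>s :: nat \<Rightarrow> 'a \<Rightarrow> complex.
          (\<And>n. s n \<in> H) \<Longrightarrow>
          (\<And>e. 0 < e \<Longrightarrow> \<exists>N. \<forall>m\<ge>N. \<forall>n\<ge>N.
              sqrt (Re (ip (\<lambda>x. s m x - s n x) (\<lambda>x. s m x - s n x))) < e) \<Longrightarrow>
          \<exists>f\<in>H. (\<lambda>n. sqrt (Re (ip (\<lambda>x. s n x - f x) (\<lambda>x. s n x - f x)))) \<longlonglongrightarrow> 0"
    and kernel_mem: "\<And>y. y \<in> X \<Longrightarrow> (\<lambda>x. k x y) \<in> H"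
    and reproducing: "\<And>f y. f \<in> H \<Longrightarrow> y \<in> X \<Longrightarrow> ip f (\<lambda>x. k x y) = f y"
    and kernel_diag: "\<And>x. x \<in> X \<Longrightarrow> k x x \<noteq> 0"
begin

definition hnorm :: "('a \<Rightarrow> complex) \<Rightarrow> real" where
  "hnorm f = sqrt (Re (ip f f))"

definition normalized :: bool where
  "normalized \<longleftrightarrow> (\<exists>x0\<in>X. \<forall>x\<in>X. k x x0 = 1)"

definition Mult :: "('a \<Rightarrow> complex) set" where
  "Mult = {\<phi>. (\<forall>x. x \<notin> X \<longrightarrow> \<phi> x = 0) \<and> (\<forall>f\<in>H. (\<lambda>x. \<phi> x * f x) \<in> H)}"

definition mult_op :: "('a \<Rightarrow> complex) \<Rightarrow> ('a \<Rightarrow> complex) \<Rightarrow> ('a \<Rightarrow> complex)" where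
  "mult_op \<phi> = (\<lambda>f\<in>H. \<lambda>x. \<phi> x * f x)"

definition mult_norm :: "('a \<Rightarrow> complex) \<Rightarrow> real" where
  "mult_norm \<phi> = op_norm H hnorm hnorm (mult_op \<phi>)"

text \<open>
  The elements of \<open>H \<otimes> \<complex>\<^sup>r\<close> are the \<open>r\<close>-tuples of elements of \<open>H\<close>, on which a matrix of
  multipliers acts by matrix-vector multiplication.
\<close>

definition tuple_norm :: "nat \<Rightarrow> (nat \<Rightarrow> 'a \<Rightarrow> complex) \<Rightarrow> real" where
  "tuple_norm r F = sqrt (\<Sum>i<r. (hnorm (F i))\<^sup>2)"

definition mat_mult_op ::
    "nat \<Rightarrow> ('a \<Rightarrow> complex) mat \<Rightarrow> (nat \<Rightarrow> 'a \<Rightarrow> complex) \<Rightarrow> (nat \<Rightarrow> 'a \<Rightarrow> complex)" where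
  "mat_mult_op r \<Phi> F = (\<lambda>i\<in>{..<r}. \<lambda>x. \<Sum>j<r. (\<Phi> $$ (i, j)) x * F j x)"

definition mat_mult_norm :: "nat \<Rightarrow> ('a \<Rightarrow> complex) mat \<Rightarrow> real" where
  "mat_mult_norm r \<Phi> =
     op_norm ({..<r} \<rightarrow>\<^sub>E H) (tuple_norm r) (tuple_norm r) (mat_mult_op r \<Phi>)"

definition complete_pick :: bool where
  "complete_pick \<longleftrightarrow>
     (\<forall>r>0. \<forall>n. \<forall>(z :: nat \<Rightarrow> 'a) (W :: nat \<Rightarrow> complex mat).
        (\<forall>i<n. z i \<in> X \<and> W i \<in> carrier_mat r r) \<longrightarrow>
        psd_mat (n * r) (pick_mat k n r z W) \<longrightarrow>
        (\<exists>\<Phi>\<in>carrier_mat r r. elements_mat \<Phi> \<subseteq> Mult \<and> mat_mult_norm r \<Phi> \<le> 1 \<and>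
           (\<forall>i<n. map_mat (\<lambda>\<phi>. \<phi> (z i)) \<Phi> = W i)))"

definition partially_multiplicative :: "(('a \<Rightarrow> complex) \<Rightarrow> complex) \<Rightarrow> bool" where
  "partially_multiplicative \<rho> \<longleftrightarrow>
     functional_on H \<rho> \<and> (\<exists>C. \<forall>f\<in>H. cmod (\<rho> f) \<le> C * hnorm f) \<and> (\<exists>f\<in>H. \<rho> f \<noteq> 0) \<and>
     (\<forall>f\<in>H. \<forall>g\<in>H. (\<lambda>x. f x * g x) \<in> H \<longrightarrow> \<rho> (\<lambda>x. f x * g x) = \<rho> f * \<rho> g)"

definition maximal_domain :: bool where
  "maximal_domain \<longleftrightarrow> (\<forall>\<rho>. partially_multiplicative \<rho> \<longrightarrow> (\<exists>x\<in>X. \<forall>f\<in>H. \<rho> f = f x))"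

definition bounded_ops :: "(('a \<Rightarrow> complex) \<Rightarrow> ('a \<Rightarrow> complex)) set" where
  "bounded_ops = {T \<in> H \<rightarrow>\<^sub>E H.
     (\<forall>f\<in>H. \<forall>g\<in>H. T (\<lambda>x. f x + g x) = (\<lambda>x. T f x + T g x)) \<and>
     (\<forall>c. \<forall>f\<in>H. T (\<lambda>x. c * f x) = (\<lambda>x. c * T f x)) \<and>
     (\<exists>C. \<forall>f\<in>H. hnorm (T f) \<le> C * hnorm f)}"

text \<open>
  The predual of \<open>B(H)\<close> is the space of trace class operators
  \<open>S = (\<Sum>n. \<langle>\<cdot>, g n\<rangle> f n)\<close> with square-summable sequences \<open>f\<close> and \<open>g\<close> in \<open>H\<close>, and \<open>S\<close> acts on
  \<open>B(H)\<close> by \<open>tr (T S) = (\<Sum>n. \<langle>T (f n), g n\<rangle>)\<close>.  The weak-* topology is the coarsest one making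
  all these functionals continuous.
\<close>

definition square_summable :: "(nat \<Rightarrow> 'a \<Rightarrow> complex) \<Rightarrow> bool" where
  "square_summable f \<longleftrightarrow> (\<forall>n. f n \<in> H) \<and> summable (\<lambda>n. (hnorm (f n))\<^sup>2)"

definition weak_star_ops :: "(('a \<Rightarrow> complex) \<Rightarrow> ('a \<Rightarrow> complex)) topology" where
  "weak_star_ops = topology_generated_by
     {{T \<in> bounded_ops. (\<Sum>n. ip (T (f n)) (g n)) \<in> U} | f g U.
        square_summable f \<and> square_summable g \<and> open U}"

definition weak_star_Mult :: "('a \<Rightarrow> complex) topology" where
  "weak_star_Mult = pullback_topology Mult mult_op weak_star_ops"

text \<open>
  Functionals on \<open>Mult\<close> are taken to be undefined off \<open>Mult\<close>, so that equality of characters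
  is equality of functions.
\<close>

definition characters :: "(('a \<Rightarrow> complex) \<Rightarrow> complex) set" where
  "characters = {\<rho> \<in> extensional Mult.
     functional_on Mult \<rho> \<and> (\<exists>\<phi>\<in>Mult. \<rho> \<phi> \<noteq> 0) \<and>
     (\<forall>\<phi>\<in>Mult. \<forall>\<psi>\<in>Mult. \<rho> (\<lambda>x. \<phi> x * \<psi> x) = \<rho> \<phi> * \<rho> \<psi>)}"

definition eval_char :: "'a \<Rightarrow> ('a \<Rightarrow> complex) \<Rightarrow> complex" where
  "eval_char x = (\<lambda>\<phi>\<in>Mult. \<phi> x)"

definition gleason_rel ::
    "((('a \<Rightarrow> complex) \<Rightarrow> complex) \<times> (('a \<Rightarrow> complex) \<Rightarrow> complex)) set" where
  "gleason_rel = {(\<rho>1, \<rho>2). \<rho>1 \<in> characters \<and> \<rho>2 \<in> characters \<and>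
     op_norm Mult mult_norm cmod (\<lambda>\<phi>. \<rho>1 \<phi> - \<rho>2 \<phi>) < 2}"

definition gleason_parts :: "(('a \<Rightarrow> complex) \<Rightarrow> complex) set set" where
  "gleason_parts = characters // gleason_rel"

end

end

theory Submission
  imports Defs "HOL-Analysis.Urysohn" "HOL-Analysis.Uniform_Limit"
begin

text \<open>
  Write \<open>ev x\<close> for evaluation at \<open>x\<close> and let \<open>x0\<close> be the base point.  All three conditions speak about one
  and the same set of characters: for a character \<open>\<rho>\<close> of \<open>Mult\<close> the following are equivalent.
  (a) \<open>\<rho>\<close> is weak-* continuous; (b) \<open>\<rho>\<close> has distance less than 2 from \<open>ev x0\<close>; (c) \<open>\<rho>\<close> is the
  restriction to \<open>Mult\<close> of a partially multiplicative functional on \<open>H\<close>.  Once this is known, each of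
  the three conditions says that every such character is a point evaluation.

  (a) implies (b) (\<open>weak_star_char_dist\<close>).  If the distance is 2, there are contractive multipliers
  \<open>\<phi> n\<close> with \<open>\<phi> n x0\<close> and \<open>\<rho> (\<phi> n)\<close> asymptotically antipodal on the unit circle.  A contractive
  multiplier with modulus almost 1 at one point is almost constant on every finite set
  (\<open>contraction_rigidity\<close>), so after a rotation \<open>\<phi> n \<rightarrow> 1\<close> pointwise and boundedly, hence weak-*.
  Then \<open>\<rho> (\<phi> n) \<rightarrow> 1\<close>, too, a contradiction.  The same argument works for every
  point of \<open>X\<close> in place of \<open>x0\<close>.

  (b) implies (c) (\<open>gleason_extension\<close>).  A Moebius transformation turns the bound on the distance into
  \<open>\<bar>\<rho> \<psi>\<bar> \<le> \<delta> < 1\<close> for all contractive multipliers \<open>\<psi>\<close> with \<open>\<psi> x0 = 0\<close> (\<open>char_dist_schwarz\<close>).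
  Every \<open>f\<close> in \<open>H\<close> is a quotient \<open>f = \<theta> / (1 - \<psi>)\<close> with such a \<open>\<psi>\<close> and a multiplier \<open>\<theta>\<close> of norm at
  most \<open>2 * hnorm f\<close> (\<open>smirnov_factorization\<close>).  Therefore \<open>f \<mapsto> \<rho> \<theta> / (1 - \<rho> \<psi>)\<close> is a well defined
  bounded extension of \<open>\<rho>\<close>, and it inherits multiplicativity.

  (c) implies (a): a bounded functional on \<open>H\<close> is \<open>\<langle>\<cdot>, g\<rangle>\<close> for some \<open>g\<close>, and so its restriction to \<open>Mult\<close> is
  the weak-* continuous functional \<open>\<phi> \<mapsto> \<langle>M\<^sub>\<phi> 1, g\<rangle>\<close>.  The factorization also shows that a partially
  multiplicative functional is determined by its values on \<open>Mult\<close>.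

  The Pick property is used twice: \<open>k\<close> has no zeros (\<open>kernel_nonzero\<close>), without which rigidity would
  say nothing, and \<open>1 - 1 / k\<close> is a positive semidefinite kernel by the theorem of McCullough and
  Quiggin (\<open>mccullough_quiggin\<close>), from which the factorization is derived.  The proof of that theorem
  is an induction on the number of points, for all the kernels
  \<open>1 - k(i,x) k(x,j) / (k(i,j) k(x,x))\<close>, of which the case \<open>x = x0\<close> is \<open>1 - 1 / k\<close>.  If \<open>z\<close> is one of
  the points, the kernel for \<open>x = z\<close> is positive semidefinite by induction, hence of the form
  \<open>W\<^sub>i W\<^sub>j\<^sup>*\<close> with rows \<open>W\<^sub>i\<close>.  These rows satisfy the positivity condition of the Pick problem, whose
  solution is a row contraction of multipliers; compressing it to the functions vanishing at \<open>x\<close>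
  gives positivity of the kernel for an arbitrary \<open>x\<close>.

  Given \<open>1 - 1 / k \<ge> 0\<close> and \<open>\<parallel>f\<parallel> < 1\<close>, the functions \<open>\<psi>\<close> and \<open>\<theta>\<close> are written down explicitly in terms of
  \<open>u z = \<langle>f, k\<^sub>z f\<rangle> + 1 - \<parallel>f\<parallel>\<^sup>2\<close>, namely \<open>\<psi> = 1 - 1 / u\<close> and \<open>\<theta> = f / u\<close>, and contractivity follows from
  one positivity statement (\<open>sarason_inequality\<close>).
\<close>

section \<open>Hilbert space preliminaries\<close>

definition lincomb :: "'i set \<Rightarrow> ('i \<Rightarrow> complex) \<Rightarrow> ('i \<Rightarrow> 'a \<Rightarrow> complex) \<Rightarrow> 'a \<Rightarrow> complex" where
  "lincomb S c v = (\<lambda>x. \<Sum>i\<in>S. c i * v i x)"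

text \<open>
  Both Cauchy-Schwarz inequalities below, for \<open>ip\<close> and for the entries of a positive semidefinite
  matrix, reduce to this one.  The case \<open>c = 0\<close> occurs for degenerate matrices.
\<close>

lemma quadratic_discriminant_complex:
  fixes b :: complex and a c :: real
  assumes nonneg: "\<And>t. 0 \<le> a + 2 * Re (t * b) + (cmod t)\<^sup>2 * c" and "0 \<le> c"
  shows "(cmod b)\<^sup>2 \<le> a * c"
proof (cases "c = 0")
  case True
  have "b = 0"
  proof (rule ccontr)
    assume "b \<noteq> 0"
    define s where "s = (a + 1) / (2 * (cmod b)\<^sup>2)"
    have "Re (complex_of_real (-s) * cnj b * b) = - s * (cmod b)\<^sup>2"
      unfolding cmod_power2 by (simp add: power2_eq_square algebra_simps)
    then have "0 \<le> a - 2 * s * (cmod b)\<^sup>2"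
      using nonneg[of "complex_of_real (-s) * cnj b"] True by simp
    then show False
      using \<open>b \<noteq> 0\<close> by (simp add: s_def)
  qed
  then show ?thesis using True by simp
next
  case False
  then have "c > 0" using assms by simp
  have "Re (- cnj b / complex_of_real c * b) = - (cmod b)\<^sup>2 / c"
    unfolding cmod_power2 by (simp add: power2_eq_square algebra_simps add_divide_distrib diff_divide_distrib)
  then have "0 \<le> a - 2 * (cmod b)\<^sup>2 / c + (cmod b)\<^sup>2 / c\<^sup>2 * c"
    using nonneg[of "- cnj b / complex_of_real c"] \<open>c > 0\<close>
    by (simp add: norm_divide power_divide)
  then have "0 \<le> a - (cmod b)\<^sup>2 / c"
    using \<open>c > 0\<close> by (simp add: field_simps power2_eq_square)
  then show ?thesis
    using \<open>c > 0\<close> by (simp add: field_simps)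
qed

context rkhs
begin

abbreviation kf :: "'a \<Rightarrow> 'a \<Rightarrow> complex" where "kf y \<equiv> (\<lambda>x. k x y)"

lemma neg_mem: "f \<in> H \<Longrightarrow> (\<lambda>x. - f x) \<in> H"
  using scale_mem[of f "-1"] by simp

lemma diff_mem: "f \<in> H \<Longrightarrow> g \<in> H \<Longrightarrow> (\<lambda>x. f x - g x) \<in> H"
  using add_mem[OF _ neg_mem, of f g] by simp

lemma lincomb_mem: "(\<And>i. i \<in> S \<Longrightarrow> v i \<in> H) \<Longrightarrow> lincomb S c v \<in> H"
proof (induction S rule: infinite_finite_induct)
  case (insert i S)
  then show ?case
    using add_mem[OF scale_mem, of "v i" "lincomb S c v" "c i"] by (simp add: lincomb_def)
qed (simp_all add: lincomb_def zero_mem)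

lemma ip_diff: "f \<in> H \<Longrightarrow> g \<in> H \<Longrightarrow> h \<in> H \<Longrightarrow> ip (\<lambda>x. f x - g x) h = ip f h - ip g h"
  using ip_add[of f "\<lambda>x. (-1) * g x" h] ip_scale[of g h "-1"] scale_mem[of g "-1"] by simp

lemma ip_zero: "f \<in> H \<Longrightarrow> ip (\<lambda>x. 0) f = 0"
  using ip_scale[of f f 0] by simp

lemma ip_add_right:
  assumes "f \<in> H" "g \<in> H" "h \<in> H" shows "ip h (\<lambda>x. f x + g x) = ip h f + ip h g"
  using ip_cnj[OF add_mem[OF assms(1,2)] assms(3)] ip_add[OF assms] ip_cnj[OF assms(1,3)] ip_cnj[OF assms(2,3)]
  by simp

lemma ip_diff_right:
  assumes "f \<in> H" "g \<in> H" "h \<in> H" shows "ip h (\<lambda>x. f x - g x) = ip h f - ip h g"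
  using ip_cnj[OF diff_mem[OF assms(1,2)] assms(3)] ip_diff[OF assms] ip_cnj[OF assms(1,3)] ip_cnj[OF assms(2,3)]
  by simp

lemma ip_scale_right:
  assumes "f \<in> H" "h \<in> H" shows "ip h (\<lambda>x. c * f x) = cnj c * ip h f"
  using ip_cnj[OF scale_mem[OF assms(1)] assms(2)] ip_scale[OF assms] ip_cnj[OF assms]
  by simp

lemma ip_lincomb:
  fixes v :: "'i \<Rightarrow> 'a \<Rightarrow> complex"
  shows "(\<And>i. i \<in> S \<Longrightarrow> v i \<in> H) \<Longrightarrow> g \<in> H \<Longrightarrow> ip (lincomb S c v) g = (\<Sum>i\<in>S. c i * ip (v i) g)"
proof (induction S rule: infinite_finite_induct)
  case (insert i S)
  have "ip (lincomb (insert i S) c v) g = ip (\<lambda>x. c i * v i x + lincomb S c v x) g"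
    using insert by (simp add: lincomb_def)
  also have "\<dots> = ip (\<lambda>x. c i * v i x) g + ip (lincomb S c v) g"
    using insert by (intro ip_add scale_mem lincomb_mem) auto
  finally show ?case
    using insert by (simp add: ip_scale)
qed (auto simp: lincomb_def ip_zero)

lemma ip_lincomb_right:
  fixes v :: "'i \<Rightarrow> 'a \<Rightarrow> complex"
  assumes "\<And>i. i \<in> S \<Longrightarrow> v i \<in> H" "g \<in> H"
  shows "ip g (lincomb S c v) = (\<Sum>i\<in>S. cnj (c i) * ip g (v i))"
proof -
  have "ip g (lincomb S c v) = (\<Sum>i\<in>S. cnj (c i) * cnj (ip (v i) g))"
    using ip_cnj[OF lincomb_mem[of S v c, OF assms(1)] assms(2)] ip_lincomb[of S v g c, OF assms] by simp
  also have "\<dots> = (\<Sum>i\<in>S. cnj (c i) * ip g (v i))"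
    using assms by (intro sum.cong refl) (metis ip_cnj)
  finally show ?thesis .
qed

lemma ip_lincomb_lincomb:
  fixes v :: "'i \<Rightarrow> 'a \<Rightarrow> complex" and w :: "'j \<Rightarrow> 'a \<Rightarrow> complex"
  assumes "\<And>i. i \<in> S \<Longrightarrow> v i \<in> H" "\<And>i. i \<in> T \<Longrightarrow> w i \<in> H"
  shows "ip (lincomb S a v) (lincomb T b w) = (\<Sum>i\<in>T. \<Sum>j\<in>S. cnj (b i) * a j * ip (v j) (w i))"
  using assms by (simp add: ip_lincomb_right[OF _ lincomb_mem] ip_lincomb sum_distrib_left mult.assoc)

lemma ip_self: "f \<in> H \<Longrightarrow> ip f f = complex_of_real ((hnorm f)\<^sup>2)"
proof -
  assume f: "f \<in> H"
  have "ip f f \<in> \<real>"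
    using ip_cnj[OF f f] Reals_cnj_iff by metis
  then have "Im (ip f f) = 0"
    by (simp add: complex_is_Real_iff)
  then show ?thesis
    using ip_nonneg[OF f] by (simp add: hnorm_def complex_eq_iff)
qed

lemma hnorm_nonneg [simp]: "f \<in> H \<Longrightarrow> 0 \<le> hnorm f"
  by (simp add: hnorm_def ip_nonneg)

lemma hnorm_zero [simp]: "hnorm (\<lambda>x. 0) = 0"
  by (simp add: hnorm_def ip_zero zero_mem)

lemma hnorm_eq_0: "f \<in> H \<Longrightarrow> hnorm f = 0 \<Longrightarrow> f = (\<lambda>x. 0)"
  using ip_self[of f] by (auto intro: ip_definite)

lemma hnorm_scale: "f \<in> H \<Longrightarrow> hnorm (\<lambda>x. c * f x) = cmod c * hnorm f"
proof -
  assume f: "f \<in> H"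
  have "ip (\<lambda>x. c * f x) (\<lambda>x. c * f x) = complex_of_real ((cmod c * hnorm f)\<^sup>2)"
    using f complex_norm_square[of c]
    by (simp add: ip_scale ip_scale_right scale_mem ip_self power_mult_distrib mult.assoc)
  then have "(hnorm (\<lambda>x. c * f x))\<^sup>2 = (cmod c * hnorm f)\<^sup>2"
    using ip_self[OF scale_mem[OF f, of c]] by (metis of_real_eq_iff)
  then show ?thesis
    using f by (simp add: scale_mem)
qed

lemma hnorm_add_sq:
  assumes "f \<in> H" "g \<in> H"
  shows "(hnorm (\<lambda>x. f x + g x))\<^sup>2 = (hnorm f)\<^sup>2 + (hnorm g)\<^sup>2 + 2 * Re (ip f g)"
proof -
  have "complex_of_real ((hnorm (\<lambda>x. f x + g x))\<^sup>2) = ip (\<lambda>x. f x + g x) (\<lambda>x. f x + g x)"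
    by (rule ip_self[OF add_mem[OF assms], symmetric])
  also have "\<dots> = ip f f + ip f g + (ip g f + ip g g)"
    using assms by (simp only: ip_add add_mem ip_add_right)
  also have "\<dots> = complex_of_real ((hnorm f)\<^sup>2 + (hnorm g)\<^sup>2 + 2 * Re (ip f g))"
    unfolding ip_self[OF assms(1)] ip_self[OF assms(2)] ip_cnj[OF assms]
    by (simp add: complex_eq_iff)
  finally show ?thesis
    by (simp only: of_real_eq_iff)
qed

lemma hnorm_neg: "f \<in> H \<Longrightarrow> hnorm (\<lambda>x. - f x) = hnorm f"
  using hnorm_scale[of f "-1"] by simp

lemma hnorm_diff_sq:
  assumes "f \<in> H" "g \<in> H"
  shows "(hnorm (\<lambda>x. f x - g x))\<^sup>2 = (hnorm f)\<^sup>2 + (hnorm g)\<^sup>2 - 2 * Re (ip f g)"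
  using hnorm_add_sq[OF assms(1) neg_mem[OF assms(2)]] hnorm_neg[OF assms(2)]
    ip_scale_right[OF assms(2,1), of "-1"] by simp

lemma cauchy_schwarz:
  assumes "f \<in> H" "g \<in> H" shows "cmod (ip f g) \<le> hnorm f * hnorm g"
proof -
  have "0 \<le> (hnorm f)\<^sup>2 + 2 * Re (t * ip f g) + (cmod t)\<^sup>2 * (hnorm g)\<^sup>2" for t
  proof -
    have "(hnorm (\<lambda>x. f x + cnj t * g x))\<^sup>2 = (hnorm f)\<^sup>2 + (cmod t)\<^sup>2 * (hnorm g)\<^sup>2 + 2 * Re (t * ip f g)"
      using hnorm_add_sq[OF assms(1) scale_mem[OF assms(2)], of "cnj t"] assms
      by (simp add: hnorm_scale ip_scale_right power_mult_distrib)
    then show ?thesis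
      using zero_le_power2[of "hnorm (\<lambda>x. f x + cnj t * g x)"] by linarith
  qed
  then have "(cmod (ip f g))\<^sup>2 \<le> (hnorm f)\<^sup>2 * (hnorm g)\<^sup>2"
    by (intro quadratic_discriminant_complex) auto
  then show ?thesis
    using assms by (simp add: power_mult_distrib[symmetric] power2_le_iff_abs_le)
qed

lemma hnorm_triangle:
  assumes "f \<in> H" "g \<in> H" shows "hnorm (\<lambda>x. f x + g x) \<le> hnorm f + hnorm g"
proof -
  have "Re (ip f g) \<le> hnorm f * hnorm g"
    using cauchy_schwarz[OF assms] complex_Re_le_cmod order_trans by blast
  then have "(hnorm (\<lambda>x. f x + g x))\<^sup>2 \<le> (hnorm f + hnorm g)\<^sup>2"
    using hnorm_add_sq[OF assms] by (simp add: power2_sum)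
  then show ?thesis
    using assms by (auto intro: power2_le_imp_le)
qed

lemma hnorm_diff_triangle:
  assumes "f \<in> H" "g \<in> H" shows "hnorm f \<le> hnorm g + hnorm (\<lambda>x. f x - g x)"
  using hnorm_triangle[OF assms(2) diff_mem[OF assms]] by simp

lemma hnorm_diff_commute:
  assumes "f \<in> H" "g \<in> H" shows "hnorm (\<lambda>x. f x - g x) = hnorm (\<lambda>x. g x - f x)"
  using hnorm_neg[OF diff_mem[OF assms]] by simp

lemma hnorm_diff_le:
  assumes "f \<in> H" "g \<in> H" shows "hnorm (\<lambda>x. f x - g x) \<le> hnorm f + hnorm g"
  using hnorm_triangle[OF assms(1) neg_mem[OF assms(2)]] hnorm_neg[OF assms(2)] by simp

lemma eval_le: "f \<in> H \<Longrightarrow> x \<in> X \<Longrightarrow> cmod (f x) \<le> hnorm f * hnorm (kf x)"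
  using cauchy_schwarz[of f "kf x"] by (simp add: reproducing kernel_mem)

lemma kernel_eq_ip: "x \<in> X \<Longrightarrow> y \<in> X \<Longrightarrow> k x y = ip (kf y) (kf x)"
  by (simp add: reproducing kernel_mem)

lemma kernel_hermitian: "x \<in> X \<Longrightarrow> y \<in> X \<Longrightarrow> k y x = cnj (k x y)"
  using ip_cnj[of "kf y" "kf x"] by (simp add: reproducing kernel_mem)

lemma kernel_diag_norm: "x \<in> X \<Longrightarrow> k x x = complex_of_real ((hnorm (kf x))\<^sup>2)"
  using kernel_eq_ip[of x x] ip_self[OF kernel_mem] by simp

lemma hnorm_kernel_pos: "x \<in> X \<Longrightarrow> 0 < hnorm (kf x)"
  using kernel_diag[of x] kernel_diag_norm[of x] hnorm_nonneg[OF kernel_mem, of x]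
  by (cases "hnorm (kf x) = 0") auto

definition hlim :: "(nat \<Rightarrow> 'a \<Rightarrow> complex) \<Rightarrow> ('a \<Rightarrow> complex) \<Rightarrow> bool" where
  "hlim s f \<longleftrightarrow> (\<forall>n. s n \<in> H) \<and> f \<in> H \<and> (\<lambda>n. hnorm (\<lambda>x. s n x - f x)) \<longlonglongrightarrow> 0"

lemma hlim_norm:
  assumes "hlim s f" shows "(\<lambda>n. hnorm (s n)) \<longlonglongrightarrow> hnorm f"
proof (rule LIM_zero_cancel, rule Lim_null_comparison)
  have m: "s n \<in> H" "f \<in> H" for n using assms by (auto simp: hlim_def)
  have "norm (hnorm (s n) - hnorm f) \<le> hnorm (\<lambda>x. s n x - f x)" for n
    using hnorm_diff_triangle[OF m, of n] hnorm_diff_triangle[OF m(2,1), of n]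
      hnorm_diff_commute[OF m, of n] by simp
  then show "\<forall>\<^sub>F n in sequentially. norm (hnorm (s n) - hnorm f) \<le> hnorm (\<lambda>x. s n x - f x)"
    by simp
  show "(\<lambda>n. hnorm (\<lambda>x. s n x - f x)) \<longlonglongrightarrow> 0"
    using assms by (simp add: hlim_def)
qed

lemma hlim_ip:
  assumes "hlim s f" "hlim t g" shows "(\<lambda>n. ip (s n) (t n)) \<longlonglongrightarrow> ip f g"
proof (rule LIM_zero_cancel, rule Lim_null_comparison)
  have m: "s n \<in> H" "f \<in> H" "t n \<in> H" "g \<in> H" for n using assms by (auto simp: hlim_def)
  have "cmod (ip (s n) (t n) - ip f g) \<le>
     hnorm (\<lambda>x. s n x - f x) * hnorm (t n) + hnorm f * hnorm (\<lambda>x. t n x - g x)" for n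
  proof -
    have e: "ip (s n) (t n) - ip f g = ip (\<lambda>x. s n x - f x) (t n) + ip f (\<lambda>x. t n x - g x)"
      using m by (simp add: ip_diff ip_diff_right)
    show ?thesis
      unfolding e using m by (intro norm_triangle_mono cauchy_schwarz diff_mem)
  qed
  then show "\<forall>\<^sub>F n in sequentially. cmod (ip (s n) (t n) - ip f g) \<le>
     hnorm (\<lambda>x. s n x - f x) * hnorm (t n) + hnorm f * hnorm (\<lambda>x. t n x - g x)"
    by simp
  have d: "(\<lambda>n. hnorm (\<lambda>x. s n x - f x)) \<longlonglongrightarrow> 0" "(\<lambda>n. hnorm (\<lambda>x. t n x - g x)) \<longlonglongrightarrow> 0"
    using assms by (simp_all add: hlim_def)
  show "(\<lambda>n. hnorm (\<lambda>x. s n x - f x) * hnorm (t n) + hnorm f * hnorm (\<lambda>x. t n x - g x)) \<longlonglongrightarrow> 0"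
    using tendsto_add[OF tendsto_mult[OF d(1) hlim_norm[OF assms(2)]] tendsto_mult[OF tendsto_const[of "hnorm f"] d(2)]]
    by (simp only: mult_zero_left mult_zero_right add_0)
qed

lemma hlim_const: "f \<in> H \<Longrightarrow> hlim (\<lambda>_. f) f"
  by (simp add: hlim_def)

lemma hlim_pointwise: "hlim s f \<Longrightarrow> x \<in> X \<Longrightarrow> (\<lambda>n. s n x) \<longlonglongrightarrow> f x"
  using hlim_ip[OF _ hlim_const[OF kernel_mem], of s f x] by (auto simp: hlim_def reproducing)

end

section \<open>Positive semidefinite matrices\<close>

abbreviation qform :: "'i set \<Rightarrow> ('i \<Rightarrow> complex) \<Rightarrow> ('i \<Rightarrow> 'i \<Rightarrow> complex) \<Rightarrow> complex" where
  "qform S c A \<equiv> \<Sum>i\<in>S. \<Sum>j\<in>S. cnj (c i) * c j * A i j"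

text \<open>
  Matrices are indexed by arbitrary sets, typically by points of \<open>X\<close>; finite sums of kernels are then
  handled without enumerating the points.  Being Hermitian is part of the definition, and the
  quadratic form is real as a consequence.
\<close>

definition psd_on :: "'i set \<Rightarrow> ('i \<Rightarrow> 'i \<Rightarrow> complex) \<Rightarrow> bool" where
  "psd_on S A \<longleftrightarrow> (\<forall>i\<in>S. \<forall>j\<in>S. A j i = cnj (A i j)) \<and>
     (\<forall>c. 0 \<le> Re (qform S c A))"

lemma psd_on_hermitian: "psd_on S A \<Longrightarrow> i \<in> S \<Longrightarrow> j \<in> S \<Longrightarrow> A j i = cnj (A i j)"
  unfolding psd_on_def by blast

lemma psd_on_nonneg: "psd_on S A \<Longrightarrow> 0 \<le> Re (qform S c A)"
  unfolding psd_on_def by blast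

lemma psd_on_cong:
  assumes "\<And>i j. i \<in> S \<Longrightarrow> j \<in> S \<Longrightarrow> A i j = B i j" shows "psd_on S A = psd_on S B"
proof -
  have "qform S c A = qform S c B" for c
    using assms by (intro sum.cong) auto
  then show ?thesis
    using assms by (simp add: psd_on_def)
qed

lemma psd_on_subset:
  assumes "psd_on S A" "T \<subseteq> S" "finite S" shows "psd_on T A"
  unfolding psd_on_def
proof (intro conjI allI)
  show "\<forall>i\<in>T. \<forall>j\<in>T. A j i = cnj (A i j)"
    using assms by (auto simp: psd_on_def)
  fix c :: "'a \<Rightarrow> complex"
  define d where "d = (\<lambda>i. if i \<in> T then c i else 0)"
  have "qform S d A = (\<Sum>i\<in>T. \<Sum>j\<in>S. cnj (d i) * d j * A i j)"
    using assms by (intro sum.mono_neutral_right) (auto simp: d_def)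
  also have "\<dots> = qform T d A"
    using assms by (intro sum.cong refl sum.mono_neutral_right) (auto simp: d_def)
  also have "\<dots> = qform T c A"
    by (intro sum.cong) (auto simp: d_def)
  finally show "0 \<le> Re (qform T c A)"
    using psd_on_nonneg[OF assms(1), of d] by simp
qed

lemma psd_on_insert_form:
  fixes S :: "'i set"
  assumes "finite S" "s \<notin> S"
  shows "qform (insert s S) c A =
    cnj (c s) * c s * A s s + (\<Sum>j\<in>S. cnj (c s) * c j * A s j) + (\<Sum>i\<in>S. cnj (c i) * c s * A i s)
     + qform S c A"
  using assms by (simp add: sum.distrib algebra_simps)

lemma psd_on_pair:
  assumes "psd_on S A" "finite S" "i \<in> S" "j \<in> S"
  shows "(cmod (A i j))\<^sup>2 \<le> Re (A i i) * Re (A j j)"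
proof (cases "i = j")
  case True
  then have "Im (A i i) = 0"
    using psd_on_hermitian[OF assms(1,3,3)] by (simp add: complex_eq_iff)
  then show ?thesis
    using True unfolding cmod_power2 by (simp add: power2_eq_square)
next
  case False
  have psd: "psd_on {i, j} A"
    using assms by (auto intro: psd_on_subset)
  have diag: "0 \<le> Re (A x x)" if "x \<in> S" for x
    using psd_on_nonneg[OF psd_on_subset[OF assms(1), of "{x}"], of "\<lambda>_. 1"] that assms by simp
  have "0 \<le> Re (A i i) + 2 * Re (t * A i j) + (cmod t)\<^sup>2 * Re (A j j)" for t
  proof -
    have "Im (A j j) = 0"
      using psd_on_hermitian[OF assms(1,4,4)] by (simp add: complex_eq_iff)
    moreover have "A j i = cnj (A i j)"
      by (rule psd_on_hermitian[OF assms(1,3,4)])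
    ultimately show ?thesis
      using psd_on_nonneg[OF psd, of "\<lambda>x. if x = i then 1 else t"] False
      unfolding cmod_power2 by (simp add: power2_eq_square algebra_simps)
  qed
  then show ?thesis
    using diag[OF assms(4)] by (intro quadratic_discriminant_complex) auto
qed

text \<open>
  Minimizing the quadratic form over the coefficient at \<open>s\<close> leaves the form of the Schur complement.
  If \<open>A s s = 0\<close>, then the subtracted term is zero by the convention on division, and the coefficient
  at \<open>s\<close> is taken to be zero.
\<close>

lemma psd_on_schur_complement:
  assumes "psd_on (insert s S) A" "finite S" "s \<notin> S"
  shows "psd_on S (\<lambda>i j. A i j - A i s * A s j / A s s)"
  unfolding psd_on_def
proof (intro conjI allI ballI)
  have herm: "A j i = cnj (A i j)" if "i \<in> insert s S" "j \<in> insert s S" for i j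
    using psd_on_hermitian[OF assms(1) that] .
  show "A j i - A j s * A s i / A s s = cnj (A i j - A i s * A s j / A s s)" if "i \<in> S" "j \<in> S" for i j
    using herm[of i j] herm[of i s] herm[of s j] herm[of s s] that
    by simp
  fix c :: "'a \<Rightarrow> complex"
  define r where "r = (\<Sum>j\<in>S. c j * A s j)"
  define q where "q = qform S c A"
  have r': "(\<Sum>i\<in>S. cnj (c i) * A i s) = cnj r"
  proof -
    have "cnj (c i) * A i s = cnj (c i * A s i)" if "i \<in> S" for i
      using herm[of s i] that by simp
    then show ?thesis
      unfolding r_def cnj_sum by (intro sum.cong) auto
  qed
  have "qform S c (\<lambda>i j. A i j - A i s * A s j / A s s) =
      q - (\<Sum>i\<in>S. \<Sum>j\<in>S. (cnj (c i) * A i s) * (c j * A s j)) / A s s"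
    by (simp add: q_def sum_subtractf sum_divide_distrib algebra_simps)
  also have "\<dots> = q - cnj r * r / A s s"
    by (simp add: r' r_def[symmetric] sum_product[symmetric])
  finally have *: "qform S c (\<lambda>i j. A i j - A i s * A s j / A s s) = q - cnj r * r / A s s" .
  define d where "d = c(s := - r / A s s)"
  have "0 \<le> Re (qform (insert s S) d A)"
    by (rule psd_on_nonneg[OF assms(1)])
  also have "qform (insert s S) d A =
      cnj (d s) * d s * A s s + cnj (d s) * r + d s * cnj r + q"
  proof -
    have "d i = c i" if "i \<in> S" for i
      using that assms(3) by (auto simp: d_def)
    then have "(\<Sum>j\<in>S. cnj (d s) * d j * A s j) = cnj (d s) * r"
      "(\<Sum>i\<in>S. cnj (d i) * d s * A i s) = d s * cnj r"
      "qform S d A = q"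
      unfolding r'[symmetric] by (simp_all add: q_def r_def sum_distrib_left algebra_simps)
    then show ?thesis
      unfolding psd_on_insert_form[OF assms(2,3)] by simp
  qed
  also have "\<dots> = q - cnj r * r / A s s"
    using herm[of s s] by (cases "A s s = 0") (auto simp: d_def field_simps)
  finally show "0 \<le> Re (qform S c (\<lambda>i j. A i j - A i s * A s j / A s s))"
    using * by simp
qed

text \<open>
  Cholesky decomposition, by induction with Schur complements.  Using \<open>S\<close> itself as the index set of
  the sum is possible as the rank of \<open>A\<close> is at most \<open>card S\<close>.
\<close>

lemma psd_on_factorization:
  assumes "finite S" "psd_on S A"
  shows "\<exists>\<beta>. \<forall>i\<in>S. \<forall>j\<in>S. A i j = (\<Sum>l\<in>S. \<beta> l i * cnj (\<beta> l j))"
  using assms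
proof (induction S arbitrary: A)
  case (insert s S)
  obtain \<beta> where \<beta>: "\<And>i j. i \<in> S \<Longrightarrow> j \<in> S \<Longrightarrow>
      A i j - A i s * A s j / A s s = (\<Sum>l\<in>S. \<beta> l i * cnj (\<beta> l j))"
    using insert.IH[OF psd_on_schur_complement[OF insert.prems insert.hyps]] by blast
  have herm: "A j i = cnj (A i j)" if "i \<in> insert s S" "j \<in> insert s S" for i j
    using psd_on_hermitian[OF insert.prems that] .
  have pos: "Im (A s s) = 0" "0 \<le> Re (A s s)"
    using herm[of s s] psd_on_nonneg[OF psd_on_subset[OF insert.prems, of "{s}"], of "\<lambda>_. 1"] insert.hyps
    by (auto simp: complex_eq_iff)
  define \<gamma> where "\<gamma> = (\<lambda>l i. if l = s then A i s / complex_of_real (sqrt (Re (A s s))) else if i = s then 0 else \<beta> l i)"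
  have ss: "complex_of_real (sqrt (Re (A s s))) * complex_of_real (sqrt (Re (A s s))) = A s s"
    using pos by (simp add: complex_eq_iff)
  have zero: "A i s = 0" "A s i = 0" if "A s s = 0" "i \<in> insert s S" for i
  proof -
    show "A i s = 0"
      using psd_on_pair[OF insert.prems, of i s] that insert.hyps by simp
    then show "A s i = 0"
      using herm[of i s] that by simp
  qed
  have "A i j = (\<Sum>l\<in>insert s S. \<gamma> l i * cnj (\<gamma> l j))" if ij: "i \<in> insert s S" "j \<in> insert s S" for i j
  proof -
    have "(\<Sum>l\<in>insert s S. \<gamma> l i * cnj (\<gamma> l j)) = \<gamma> s i * cnj (\<gamma> s j) + (\<Sum>l\<in>S. \<gamma> l i * cnj (\<gamma> l j))"
      using insert.hyps by simp
    also have "\<gamma> s i * cnj (\<gamma> s j) = A i s * A s j / A s s"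
      using herm[of j s] ij ss by (simp add: \<gamma>_def)
    also have "(\<Sum>l\<in>S. \<gamma> l i * cnj (\<gamma> l j)) = (if i = s \<or> j = s then 0 else A i j - A i s * A s j / A s s)"
    proof -
      have "(\<Sum>l\<in>S. \<gamma> l i * cnj (\<gamma> l j)) = (\<Sum>l\<in>S. if i = s \<or> j = s then 0 else \<beta> l i * cnj (\<beta> l j))"
        using insert.hyps by (intro sum.cong) (auto simp: \<gamma>_def)
      then show ?thesis
        using \<beta>[of i j] ij by auto
    qed
    also have "A i s * A s j / A s s + (if i = s \<or> j = s then 0 else A i j - A i s * A s j / A s s) = A i j"
      using zero ij by (cases "A s s = 0") auto
    finally show ?thesis by simp
  qed
  then show ?case by blast
qed simp

context rkhs
begin

section \<open>Riesz representation and membership in the space\<close>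

text \<open>
  The kernel functions need not be linearly independent, so that a functional on their span is given
  by a relation rather than by a formula on coefficients.  The lemma therefore takes the graph \<open>P\<close> of a
  bounded conjugate-linear functional on a subspace that need not be closed.  The representing vector
  is the limit of a minimizing sequence of \<open>\<parallel>f\<parallel>\<^sup>2 - 2 Re a\<close> over \<open>P\<close>, which is Cauchy by the parallelogram
  law; this yields at the same time that it lies in the closure of the subspace.
\<close>

lemma riesz_graph:
  assumes sub: "\<And>f a. (f, a) \<in> P \<Longrightarrow> f \<in> H"
    and zero: "((\<lambda>x. 0), 0) \<in> P"
    and add: "\<And>f a g b. (f, a) \<in> P \<Longrightarrow> (g, b) \<in> P \<Longrightarrow> ((\<lambda>x. f x + g x), a + b) \<in> P"
    and scale: "\<And>c f a. (f, a) \<in> P \<Longrightarrow> ((\<lambda>x. c * f x), cnj c * a) \<in> P"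
    and bound: "\<And>f a. (f, a) \<in> P \<Longrightarrow> cmod a \<le> C * hnorm f"
  obtains g s a where "hlim s g" "\<And>n. (s n, a n) \<in> P" "\<And>f a. (f, a) \<in> P \<Longrightarrow> ip g f = a" "hnorm g \<le> \<bar>C\<bar>"
proof -
  define J where "J = (\<lambda>(f, a). (hnorm f)\<^sup>2 - 2 * Re a)"
  have below: "- C\<^sup>2 \<le> J p" if "p \<in> P" for p
  proof -
    obtain f a where p: "p = (f, a)" by force
    have "Re a \<le> C * hnorm f"
      using bound[of f a] that p complex_Re_le_cmod[of a] by simp
    moreover have "0 \<le> (hnorm f - C)\<^sup>2" by simp
    ultimately show ?thesis
      by (simp add: J_def p power2_diff algebra_simps)
  qed
  define m where "m = Inf (J ` P)"
  have bdd: "bdd_below (J ` P)"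
    using below by (intro bdd_belowI[of _ "- C\<^sup>2"]) auto
  have ge: "m \<le> J p" if "p \<in> P" for p
    unfolding m_def using that bdd by (intro cInf_lower) auto
  have "\<exists>p\<in>P. J p < m + inverse (real (Suc n))" for n
    using cInf_lessD[of "J ` P" "m + inverse (real (Suc n))"] zero m_def by auto
  then obtain p where p: "\<And>n. p n \<in> P" "\<And>n. J (p n) < m + inverse (real (Suc n))"
    by metis
  define s a where "s = (\<lambda>n. fst (p n))" and "a = (\<lambda>n. snd (p n))"
  have sa: "(s n, a n) \<in> P" for n using p by (simp add: s_def a_def)
  have sH: "s n \<in> H" for n using sub[OF sa] .
  have Jsa: "J (s n, a n) < m + inverse (real (Suc n))" for n
    using p by (simp add: s_def a_def)
  have para: "(hnorm (\<lambda>x. s i x - s j x))\<^sup>2 \<le> 2 * inverse (real (Suc i)) + 2 * inverse (real (Suc j))" for i j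
  proof -
    have "((\<lambda>x. (1/2) * (s i x + s j x)), cnj (1/2) * (a i + a j)) \<in> P"
      by (intro scale add sa)
    then have "m \<le> J ((\<lambda>x. (1/2) * (s i x + s j x)), cnj (1/2) * (a i + a j))"
      by (rule ge)
    also have "\<dots> = (hnorm (\<lambda>x. s i x + s j x))\<^sup>2 / 4 - Re (a i) - Re (a j)"
      unfolding J_def prod.case hnorm_scale[OF add_mem[OF sH sH]]
      by (simp add: power_divide norm_divide add_divide_distrib)
    finally have "m \<le> (hnorm (\<lambda>x. s i x + s j x))\<^sup>2 / 4 - Re (a i) - Re (a j)" .
    then show ?thesis
      using hnorm_add_sq[OF sH sH, of i j] hnorm_diff_sq[OF sH sH, of i j] Jsa[of i] Jsa[of j]
      unfolding J_def prod.case by linarith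
  qed
  have "\<exists>g\<in>H. (\<lambda>n. sqrt (Re (ip (\<lambda>x. s n x - g x) (\<lambda>x. s n x - g x)))) \<longlonglongrightarrow> 0"
  proof (rule complete[OF sH])
    fix e :: real assume "0 < e"
    obtain N where N: "inverse (real (Suc N)) < e\<^sup>2 / 4"
      using reals_Archimedean[of "e\<^sup>2 / 4"] \<open>0 < e\<close> by auto
    have "hnorm (\<lambda>x. s i x - s j x) < e" if "i \<ge> N" "j \<ge> N" for i j
    proof -
      have "inverse (real (Suc i)) \<le> inverse (real (Suc N))" "inverse (real (Suc j)) \<le> inverse (real (Suc N))"
        using that by (simp_all add: field_simps)
      then have "(hnorm (\<lambda>x. s i x - s j x))\<^sup>2 < e\<^sup>2"
        using para[of i j] N by linarith
      then show ?thesis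
        using \<open>0 < e\<close> by (auto intro: power2_less_imp_less)
    qed
    then show "\<exists>N. \<forall>i\<ge>N. \<forall>j\<ge>N. sqrt (Re (ip (\<lambda>x. s i x - s j x) (\<lambda>x. s i x - s j x))) < e"
      unfolding hnorm_def by blast
  qed
  then obtain g where g: "hlim s g"
    using sH by (auto simp: hlim_def hnorm_def)
  then have gH: "g \<in> H" by (simp add: hlim_def)
  have rep: "ip g f = b" if fb: "(f, b) \<in> P" for f b
  proof -
    have fH: "f \<in> H" using sub[OF fb] .
    \<comment> \<open>The step length of a descent in the direction \<open>f\<close>, short enough that half of the linear gain
      survives the quadratic term even if \<open>\<parallel>f\<parallel>\<close> is large.\<close>
    define t where "t = 1 / ((hnorm f)\<^sup>2 + 1)"
    have t: "0 < t" "t * (hnorm f)\<^sup>2 \<le> 1"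
    proof -
      have "0 < (hnorm f)\<^sup>2 + 1" by (rule add_nonneg_pos) simp_all
      then show "0 < t" "t * (hnorm f)\<^sup>2 \<le> 1" by (simp_all add: t_def divide_le_eq less_asym)
    qed
    have "t * (cmod (ip (s n) f - b))\<^sup>2 \<le> inverse (real (Suc n))" for n
    proof -
      define d where "d = ip (s n) f - b"
      define z where "z = complex_of_real (-t) * d"
      have "((\<lambda>x. s n x + z * f x), a n + cnj z * b) \<in> P"
        by (intro add scale sa fb)
      then have "m \<le> J ((\<lambda>x. s n x + z * f x), a n + cnj z * b)"
        by (rule ge)
      also have "\<dots> = J (s n, a n) + (cmod z)\<^sup>2 * (hnorm f)\<^sup>2 + 2 * Re (cnj z * d)"
        unfolding J_def prod.case hnorm_add_sq[OF sH scale_mem[OF fH]]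
        using fH sH[of n] by (simp add: hnorm_scale ip_scale_right power_mult_distrib d_def algebra_simps)
      also have "Re (cnj z * d) = - t * (cmod d)\<^sup>2"
        unfolding cmod_power2 by (simp add: z_def power2_eq_square algebra_simps)
      also have "(cmod z)\<^sup>2 = t\<^sup>2 * (cmod d)\<^sup>2"
        using t by (simp add: z_def norm_mult power_mult_distrib)
      finally have "2 * t * (cmod d)\<^sup>2 \<le> inverse (real (Suc n)) + t\<^sup>2 * (cmod d)\<^sup>2 * (hnorm f)\<^sup>2"
        using Jsa[of n] by simp
      moreover have "t\<^sup>2 * (cmod d)\<^sup>2 * (hnorm f)\<^sup>2 \<le> t * (cmod d)\<^sup>2"
        using mult_right_mono[OF t(2), of "t * (cmod d)\<^sup>2"] t(1) by (simp add: power2_eq_square algebra_simps)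
      ultimately show ?thesis
        by (simp add: d_def)
    qed
    moreover have "(\<lambda>n. t * (cmod (ip (s n) f - b))\<^sup>2) \<longlonglongrightarrow> t * (cmod (ip g f - b))\<^sup>2"
      by (intro tendsto_intros hlim_ip g hlim_const fH)
    ultimately have "t * (cmod (ip g f - b))\<^sup>2 \<le> 0"
      by (intro tendsto_le[OF _ LIMSEQ_inverse_real_of_nat]) auto
    then have "(cmod (ip g f - b))\<^sup>2 \<le> 0"
      using t(1) by (simp add: mult_le_0_iff)
    then show ?thesis by simp
  qed
  have "(\<lambda>n. cmod (ip g (s n))) \<longlonglongrightarrow> cmod (ip g g)"
    by (intro tendsto_intros hlim_ip g hlim_const gH)
  moreover have "(\<lambda>n. C * hnorm (s n)) \<longlonglongrightarrow> C * hnorm g"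
    by (intro tendsto_intros hlim_norm g)
  ultimately have "cmod (ip g g) \<le> C * hnorm g"
    by (rule LIMSEQ_le) (use rep[OF sa] bound[OF sa] in auto)
  then have "hnorm g * hnorm g \<le> C * hnorm g"
    using gH by (simp add: ip_self power2_eq_square norm_mult)
  then have "hnorm g \<le> \<bar>C\<bar>"
    using gH hnorm_nonneg[OF gH] by (cases "hnorm g = 0") (auto simp: mult_le_cancel_right)
  then show thesis
    using that g sa rep by blast
qed

end

lemma lincomb_extend:
  assumes "finite T" "S \<subseteq> T"
  shows "lincomb T (\<lambda>i. if i \<in> S then c i else 0) v = lincomb S c v"
proof
  fix x
  show "lincomb T (\<lambda>i. if i \<in> S then c i else 0) v x = lincomb S c v x"
    unfolding lincomb_def using assms by (intro sum.mono_neutral_cong_right) auto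
qed

lemma lincomb_add: "lincomb S (\<lambda>i. c i + d i) v = (\<lambda>x. lincomb S c v x + lincomb S d v x)"
  by (simp add: lincomb_def sum.distrib algebra_simps)

lemma lincomb_diff: "lincomb S (\<lambda>i. c i - d i) v = (\<lambda>x. lincomb S c v x - lincomb S d v x)"
  by (simp add: lincomb_def sum_subtractf algebra_simps)

lemma lincomb_scale: "lincomb S (\<lambda>i. a * c i) v = (\<lambda>x. a * lincomb S c v x)"
  by (simp add: lincomb_def sum_distrib_left algebra_simps)

context rkhs
begin

abbreviation kcomb :: "'a set \<Rightarrow> ('a \<Rightarrow> complex) \<Rightarrow> 'a \<Rightarrow> complex" where
  "kcomb S c \<equiv> lincomb S c kf"

definition kspan :: "('a \<Rightarrow> complex) set" where
  "kspan = {kcomb S c | S c. finite S \<and> S \<subseteq> X}"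

lemma kcomb_mem: "S \<subseteq> X \<Longrightarrow> kcomb S c \<in> H"
  by (intro lincomb_mem kernel_mem) auto

lemma kspan_subset: "f \<in> kspan \<Longrightarrow> f \<in> H"
  by (auto simp: kspan_def kcomb_mem)

lemma ip_kcomb:
  assumes "f \<in> H" "S \<subseteq> X" shows "ip f (kcomb S c) = (\<Sum>i\<in>S. cnj (c i) * f i)"
proof -
  have "ip f (kcomb S c) = (\<Sum>i\<in>S. cnj (c i) * ip f (kf i))"
    using assms by (intro ip_lincomb_right kernel_mem) auto
  also have "\<dots> = (\<Sum>i\<in>S. cnj (c i) * f i)"
    using assms by (intro sum.cong refl) (simp add: reproducing subset_iff)
  finally show ?thesis .
qed

lemma hnorm_kcomb_sq:
  assumes "S \<subseteq> X"
  shows "(hnorm (kcomb S c))\<^sup>2 = Re (qform S c k)"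
proof -
  have "complex_of_real ((hnorm (kcomb S c))\<^sup>2) = (\<Sum>i\<in>S. cnj (c i) * kcomb S c i)"
    using ip_self[OF kcomb_mem[OF assms]] ip_kcomb[OF kcomb_mem[OF assms] assms] by simp
  also have "\<dots> = qform S c k"
    by (simp add: lincomb_def sum_distrib_left mult.assoc)
  finally show ?thesis
    by (metis Re_complex_of_real)
qed

text \<open>
  The bound says that \<open>kcomb S c \<mapsto> \<Sum> cnj (c i) * w i\<close> is well defined and bounded on the span of the
  kernel functions.  The vector representing this functional has the values of \<open>w\<close>.
\<close>

lemma mem_of_kernel_bound:
  assumes vanish: "\<And>x. x \<notin> X \<Longrightarrow> w x = 0"
    and bound: "\<And>S c. finite S \<Longrightarrow> S \<subseteq> X \<Longrightarrow> cmod (\<Sum>i\<in>S. cnj (c i) * w i) \<le> C * hnorm (kcomb S c)"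
  obtains s where "w \<in> H" "hnorm w \<le> \<bar>C\<bar>" "hlim s w" "\<And>n. s n \<in> kspan"
proof -
  define P where "P = {(kcomb S c, \<Sum>i\<in>S. cnj (c i) * w i) | S c. finite S \<and> S \<subseteq> X}"
  have P: "(kcomb S c, \<Sum>i\<in>S. cnj (c i) * w i) \<in> P" if "finite S" "S \<subseteq> X" for S c
    using that by (auto simp: P_def)
  have add: "((\<lambda>x. f x + g x), a + b) \<in> P" if fg: "(f, a) \<in> P" "(g, b) \<in> P" for f a g b
  proof -
    obtain S c where S: "finite S" "S \<subseteq> X" "f = kcomb S c" "a = (\<Sum>i\<in>S. cnj (c i) * w i)"
      using fg(1) by (auto simp: P_def)
    obtain T d where T: "finite T" "T \<subseteq> X" "g = kcomb T d" "b = (\<Sum>i\<in>T. cnj (d i) * w i)"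
      using fg(2) by (auto simp: P_def)
    define c' d' where "c' = (\<lambda>i. if i \<in> S then c i else 0)" and "d' = (\<lambda>i. if i \<in> T then d i else 0)"
    have "f = kcomb (S \<union> T) c'" "g = kcomb (S \<union> T) d'"
      unfolding c'_def d'_def S(3) T(3) using S T by (intro lincomb_extend[symmetric]; auto)+
    moreover have "a = (\<Sum>i\<in>S \<union> T. cnj (c' i) * w i)"
      unfolding S(4) c'_def using S T by (intro sum.mono_neutral_cong_left) auto
    moreover have "b = (\<Sum>i\<in>S \<union> T. cnj (d' i) * w i)"
      unfolding T(4) d'_def using S T by (intro sum.mono_neutral_cong_left) auto
    ultimately show ?thesis
      using P[of "S \<union> T" "\<lambda>i. c' i + d' i"] S T
      by (simp add: lincomb_add sum.distrib algebra_simps)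
  qed
  have scale: "((\<lambda>x. t * f x), cnj t * a) \<in> P" if fa: "(f, a) \<in> P" for t f a
  proof -
    obtain S c where S: "finite S" "S \<subseteq> X" "f = kcomb S c" "a = (\<Sum>i\<in>S. cnj (c i) * w i)"
      using fa by (auto simp: P_def)
    show ?thesis
      using P[of S "\<lambda>i. t * c i"] S by (simp add: lincomb_scale sum_distrib_left mult.assoc)
  qed
  have zero: "((\<lambda>x. 0), 0) \<in> P"
    using P[of "{}"] by (simp add: lincomb_def)
  have sub: "f \<in> H" if "(f, a) \<in> P" for f a
    using that by (auto simp: P_def kcomb_mem)
  have bd: "cmod a \<le> C * hnorm f" if "(f, a) \<in> P" for f a
    using that bound by (auto simp: P_def)
  obtain g s a where g: "hlim s g" "\<And>n. (s n, a n) \<in> P" "\<And>f a. (f, a) \<in> P \<Longrightarrow> ip g f = a" "hnorm g \<le> \<bar>C\<bar>"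
    by (rule riesz_graph[of P C]; (erule sub | rule zero | erule (1) add | erule scale | erule bd | rule that; assumption))
  have gH: "g \<in> H" using g(1) by (simp add: hlim_def)
  have "g = w"
  proof
    fix x show "g x = w x"
    proof (cases "x \<in> X")
      case True
      have "ip g (kcomb {x} (\<lambda>_. 1)) = w x"
        using g(3)[OF P[of "{x}" "\<lambda>_. 1"]] True by simp
      then show ?thesis
        using True gH by (simp add: lincomb_def reproducing)
    qed (simp add: vanish vanishes gH)
  qed
  moreover have "s n \<in> kspan" for n
    using g(2)[of n] by (auto simp: P_def kspan_def)
  ultimately show thesis
    using that g gH by blast
qed

lemma kspan_dense:
  assumes "f \<in> H" obtains s where "hlim s f" "\<And>n. s n \<in> kspan"
proof -
  have "cmod (\<Sum>i\<in>S. cnj (c i) * f i) \<le> hnorm f * hnorm (kcomb S c)" if "finite S" "S \<subseteq> X" for S c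
    using cauchy_schwarz[OF assms kcomb_mem[OF that(2)]] ip_kcomb[OF assms that(2)] by simp
  then show thesis
    using mem_of_kernel_bound[of f "hnorm f"] vanishes[OF assms] that by metis
qed

lemma hnorm_le_of_kernel_bound:
  assumes "w \<in> H" "0 \<le> C"
    and "\<And>S c. finite S \<Longrightarrow> S \<subseteq> X \<Longrightarrow> cmod (\<Sum>i\<in>S. cnj (c i) * w i) \<le> C * hnorm (kcomb S c)"
  shows "hnorm w \<le> C"
proof -
  have "hnorm w \<le> \<bar>C\<bar>"
    by (rule mem_of_kernel_bound[of w C]) (use assms vanishes in auto)
  then show ?thesis using assms(2) by simp
qed

section \<open>Multipliers and their bounds\<close>

text \<open>
  Norm bounds on \<open>\<phi>\<close> are stated without the supremum \<open>mult_norm\<close>, which is meaningful only once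
  the set in question is known to be bounded.
\<close>

definition mbound :: "('a \<Rightarrow> complex) \<Rightarrow> real \<Rightarrow> bool" where
  "mbound \<phi> C \<longleftrightarrow> \<phi> \<in> Mult \<and> (\<forall>f\<in>H. hnorm (\<lambda>x. \<phi> x * f x) \<le> C * hnorm f)"

lemma Mult_vanishes: "\<phi> \<in> Mult \<Longrightarrow> x \<notin> X \<Longrightarrow> \<phi> x = 0"
  by (simp add: Mult_def)

lemma Mult_mem: "\<phi> \<in> Mult \<Longrightarrow> f \<in> H \<Longrightarrow> (\<lambda>x. \<phi> x * f x) \<in> H"
  by (simp add: Mult_def)

lemma mbound_Mult: "mbound \<phi> C \<Longrightarrow> \<phi> \<in> Mult" 
  by (simp add: mbound_def)

lemma mbound_le: "mbound \<phi> C \<Longrightarrow> f \<in> H \<Longrightarrow> hnorm (\<lambda>x. \<phi> x * f x) \<le> C * hnorm f"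
  by (simp add: mbound_def)

lemma mbound_mono: "mbound \<phi> C \<Longrightarrow> C \<le> D \<Longrightarrow> mbound \<phi> D"
  unfolding mbound_def using mult_right_mono[of C D] by (meson hnorm_nonneg order_trans)

text \<open>
  The adjoint of \<open>M\<^sub>\<phi>\<close> maps the kernel function at \<open>i\<close> to \<open>cnj (\<phi> i)\<close> times itself.  Thus a function is a
  multiplier of norm at most \<open>C\<close> as soon as this diagonal operator is bounded by \<open>C\<close> on finite
  combinations of kernel functions.
\<close>

lemma mboundI_dual:
  assumes "\<And>x. x \<notin> X \<Longrightarrow> \<phi> x = 0" "0 \<le> C"
    and dual: "\<And>S c. finite S \<Longrightarrow> S \<subseteq> X \<Longrightarrow>
        hnorm (kcomb S (\<lambda>i. c i * cnj (\<phi> i))) \<le> C * hnorm (kcomb S c)"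
  shows "mbound \<phi> C"
proof -
  have "(\<lambda>x. \<phi> x * f x) \<in> H \<and> hnorm (\<lambda>x. \<phi> x * f x) \<le> C * hnorm f" if f: "f \<in> H" for f
  proof -
    have b: "cmod (\<Sum>i\<in>S. cnj (c i) * (\<phi> i * f i)) \<le> C * hnorm f * hnorm (kcomb S c)"
      if S: "finite S" "S \<subseteq> X" for S c
    proof -
      have "(\<Sum>i\<in>S. cnj (c i) * (\<phi> i * f i)) = ip f (kcomb S (\<lambda>i. c i * cnj (\<phi> i)))"
        using ip_kcomb[OF f S(2)] by (simp add: mult.assoc)
      then have "cmod (\<Sum>i\<in>S. cnj (c i) * (\<phi> i * f i)) \<le> hnorm f * hnorm (kcomb S (\<lambda>i. c i * cnj (\<phi> i)))"
        using cauchy_schwarz[OF f kcomb_mem[OF S(2)]] by simp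
      also have "\<dots> \<le> hnorm f * (C * hnorm (kcomb S c))"
        using f by (intro mult_left_mono dual S) auto
      finally show ?thesis by (simp add: algebra_simps)
    qed
    have "\<bar>C * hnorm f\<bar> = C * hnorm f"
      using assms(2) f by simp
    then show ?thesis
      using mem_of_kernel_bound[OF _ b, of "(\<lambda>x. \<phi> x * f x) \<in> H \<and> hnorm (\<lambda>x. \<phi> x * f x) \<le> C * hnorm f"] assms(1)
      by simp
  qed
  then show ?thesis
    using assms(1) by (auto simp: mbound_def Mult_def)
qed

lemma mbound_dual:
  assumes "mbound \<phi> C" "finite S" "S \<subseteq> X"
  shows "hnorm (kcomb S (\<lambda>i. c i * cnj (\<phi> i))) \<le> C * hnorm (kcomb S c)"
proof -
  define h h' where "h = kcomb S c" and "h' = kcomb S (\<lambda>i. c i * cnj (\<phi> i))"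
  have m: "h \<in> H" "h' \<in> H" "(\<lambda>x. \<phi> x * h' x) \<in> H"
    using assms kcomb_mem by (auto simp: h_def h'_def mbound_def intro: Mult_mem)
  have "ip (\<lambda>x. \<phi> x * h' x) h = (\<Sum>i\<in>S. cnj (c i) * (\<phi> i * h' i))"
    unfolding h_def by (rule ip_kcomb[OF m(3) assms(3)])
  also have "\<dots> = (\<Sum>i\<in>S. cnj (c i * cnj (\<phi> i)) * h' i)"
    by (simp add: mult.assoc)
  also have "\<dots> = ip h' h'"
    using ip_kcomb[OF m(2) assms(3)] by (simp add: h'_def)
  finally have "(hnorm h')\<^sup>2 = cmod (ip (\<lambda>x. \<phi> x * h' x) h)"
    using m by (simp add: ip_self norm_power)
  also have "\<dots> \<le> hnorm (\<lambda>x. \<phi> x * h' x) * hnorm h"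
    by (rule cauchy_schwarz[OF m(3,1)])
  also have "\<dots> \<le> (C * hnorm h') * hnorm h"
    using m assms(1) by (intro mult_right_mono) (auto simp: mbound_def)
  finally have le: "hnorm h' * hnorm h' \<le> (C * hnorm h) * hnorm h'"
    by (simp add: power2_eq_square algebra_simps)
  have "hnorm h' \<le> C * hnorm h"
  proof (cases "hnorm h' = 0")
    case True
    have "0 \<le> hnorm (\<lambda>x. \<phi> x * h x)"
      by (rule hnorm_nonneg[OF Mult_mem[OF mbound_Mult[OF assms(1)] m(1)]])
    then have "0 \<le> C * hnorm h"
      using mbound_le[OF assms(1) m(1)] by linarith
    then show ?thesis using True by simp
  next
    case False
    then show ?thesis
      using le hnorm_nonneg[OF m(2)] by (simp add: mult_le_cancel_right)
  qed
  then show ?thesis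
    by (simp add: h_def h'_def)
qed

lemma mbound_pointwise:
  assumes "mbound \<phi> C" "x \<in> X" shows "cmod (\<phi> x) \<le> C"
proof -
  have "hnorm (kcomb {x} (\<lambda>i. 1 * cnj (\<phi> i))) \<le> C * hnorm (kcomb {x} (\<lambda>_. 1))"
    using assms by (intro mbound_dual) auto
  then have "cmod (\<phi> x) * hnorm (kf x) \<le> C * hnorm (kf x)"
    using assms by (simp add: lincomb_def hnorm_scale kernel_mem)
  then show ?thesis
    using hnorm_kernel_pos[OF assms(2)] by simp
qed

lemma Mult_add: "\<phi> \<in> Mult \<Longrightarrow> \<psi> \<in> Mult \<Longrightarrow> (\<lambda>x. \<phi> x + \<psi> x) \<in> Mult"
  using add_mem by (fastforce simp: Mult_def distrib_right)

lemma Mult_scale: "\<phi> \<in> Mult \<Longrightarrow> (\<lambda>x. c * \<phi> x) \<in> Mult"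
  using scale_mem by (fastforce simp: Mult_def mult.assoc)

lemma Mult_diff: "\<phi> \<in> Mult \<Longrightarrow> \<psi> \<in> Mult \<Longrightarrow> (\<lambda>x. \<phi> x - \<psi> x) \<in> Mult"
  using diff_mem by (fastforce simp: Mult_def left_diff_distrib)

lemma Mult_times: "\<phi> \<in> Mult \<Longrightarrow> \<psi> \<in> Mult \<Longrightarrow> (\<lambda>x. \<phi> x * \<psi> x) \<in> Mult"
  by (simp add: Mult_def mult.assoc)

definition unit :: "'a \<Rightarrow> complex" where
  "unit = (\<lambda>x. if x \<in> X then 1 else 0)"

lemma unit_times: "(\<And>x. x \<notin> X \<Longrightarrow> f x = 0) \<Longrightarrow> (\<lambda>x. unit x * f x) = f"
  by (auto simp: unit_def)

lemma mbound_unit: "mbound unit 1"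
proof -
  have "(\<lambda>x. unit x * f x) = f" if "f \<in> H" for f
    using vanishes[OF that] by (rule unit_times)
  then show ?thesis
    by (auto simp: mbound_def Mult_def unit_def)
qed

lemma unit_Mult: "unit \<in> Mult"
  using mbound_unit mbound_Mult by blast

lemma mbound_scale:
  assumes "mbound \<phi> C" shows "mbound (\<lambda>x. c * \<phi> x) (cmod c * C)"
  unfolding mbound_def
proof (intro conjI ballI)
  show "(\<lambda>x. c * \<phi> x) \<in> Mult" using assms by (simp add: mbound_def Mult_scale)
  fix f assume f: "f \<in> H"
  have "hnorm (\<lambda>x. c * (\<phi> x * f x)) \<le> cmod c * (C * hnorm f)"
    using assms f unfolding mbound_def by (simp add: hnorm_scale Mult_mem mult_left_mono)
  then show "hnorm (\<lambda>x. c * \<phi> x * f x) \<le> cmod c * C * hnorm f"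
    by (simp add: mult.assoc)
qed

lemma kcomb_tendsto:
  assumes "S \<subseteq> X" "\<And>i. i \<in> S \<Longrightarrow> (\<lambda>n. c n i) \<longlonglongrightarrow> d i"
  shows "(\<lambda>n. hnorm (kcomb S (c n))) \<longlonglongrightarrow> hnorm (kcomb S d)"
proof -
  have "(\<lambda>n. sqrt ((hnorm (kcomb S (c n)))\<^sup>2)) \<longlonglongrightarrow> sqrt ((hnorm (kcomb S d))\<^sup>2)"
    unfolding hnorm_kcomb_sq[OF assms(1)]
    by (intro tendsto_intros assms(2))
  then show ?thesis
    by (simp add: kcomb_mem assms(1))
qed

text \<open>
  The dual criterion involves finitely many points at a time, hence it is stable under pointwise
  limits.
\<close>

lemma mbound_limit:
  assumes "\<And>n. mbound (\<phi> n) C" "\<And>x. x \<in> X \<Longrightarrow> (\<lambda>n. \<phi> n x) \<longlonglongrightarrow> \<psi> x"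
    and "\<And>x. x \<notin> X \<Longrightarrow> \<psi> x = 0" "0 \<le> C"
  shows "mbound \<psi> C"
proof (rule mboundI_dual[OF assms(3,4)])
  fix S c assume S: "finite S" "S \<subseteq> X"
  have "(\<lambda>n. hnorm (kcomb S (\<lambda>i. c i * cnj (\<phi> n i)))) \<longlonglongrightarrow> hnorm (kcomb S (\<lambda>i. c i * cnj (\<psi> i)))"
    using S by (intro kcomb_tendsto tendsto_intros assms(2)) auto
  then show "hnorm (kcomb S (\<lambda>i. c i * cnj (\<psi> i))) \<le> C * hnorm (kcomb S c)"
    by (rule LIMSEQ_le_const2) (use mbound_dual[OF assms(1) S] in auto)
qed

text \<open>
  The dual operator of \<open>1 - \<phi>\<close> is bounded below by \<open>1 - q\<close> by the triangle inequality, and the dual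
  criterion turns this into a bound for the inverse.
\<close>

lemma mbound_inverse:
  assumes "mbound \<phi> q" "q < 1"
  shows "mbound (\<lambda>x. if x \<in> X then 1 / (1 - \<phi> x) else 0) (1 / (1 - q))"
    and "x \<in> X \<Longrightarrow> \<phi> x \<noteq> 1"
proof -
  show ne: "\<phi> x \<noteq> 1" if "x \<in> X" for x
    using mbound_pointwise[OF assms(1) that] assms(2) by auto
  show "mbound (\<lambda>x. if x \<in> X then 1 / (1 - \<phi> x) else 0) (1 / (1 - q))"
  proof (rule mboundI_dual)
    fix S and c :: "'a \<Rightarrow> complex" assume S: "finite S" "S \<subseteq> X"
    define d where "d = (\<lambda>i. c i * cnj (1 / (1 - \<phi> i)))"
    have "kcomb S c = kcomb S (\<lambda>i. d i - d i * cnj (\<phi> i))"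
    proof -
      have "c i = d i - d i * cnj (\<phi> i)" if "i \<in> S" for i
      proof -
        have "1 - cnj (\<phi> i) \<noteq> 0"
          using ne[of i] that S by (metis complex_cnj_cnj complex_cnj_one eq_iff_diff_eq_0 subsetD)
        then have "d i * (1 - cnj (\<phi> i)) = c i"
          by (simp add: d_def)
        then show ?thesis
          by (simp add: algebra_simps)
      qed
      then show ?thesis
        unfolding lincomb_def by (intro ext sum.cong) auto
    qed
    then have "kcomb S c = (\<lambda>x. kcomb S d x - kcomb S (\<lambda>i. d i * cnj (\<phi> i)) x)"
      by (simp add: lincomb_diff)
    then have "hnorm (kcomb S d) \<le> hnorm (kcomb S (\<lambda>i. d i * cnj (\<phi> i))) + hnorm (kcomb S c)"
      using hnorm_diff_triangle[OF kcomb_mem kcomb_mem, OF S(2) S(2)] by metis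
    then have "(1 - q) * hnorm (kcomb S d) \<le> hnorm (kcomb S c)"
      using mbound_dual[OF assms(1) S, of d] by (simp add: algebra_simps)
    then have "hnorm (kcomb S d) \<le> 1 / (1 - q) * hnorm (kcomb S c)"
      using assms(2) by (simp add: field_simps)
    moreover have "kcomb S (\<lambda>i. c i * cnj (if i \<in> X then 1 / (1 - \<phi> i) else 0)) = kcomb S d"
      unfolding lincomb_def d_def using S by (intro ext sum.cong) auto
    ultimately show "hnorm (kcomb S (\<lambda>i. c i * cnj (if i \<in> X then 1 / (1 - \<phi> i) else 0)))
        \<le> 1 / (1 - q) * hnorm (kcomb S c)"
      by simp
  qed (use assms in auto)
qed

text \<open>
  The closed graph theorem for \<open>M\<^sub>\<phi>\<close>.  The sets of all \<open>f\<close> with \<open>\<parallel>\<phi> f\<parallel> \<le> n\<close> are closed, because the norm bound can be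
  tested on finite combinations of kernel functions and these tests only involve values of \<open>f\<close>.
  They exhaust \<open>H\<close>, so one of them contains a ball by Baire's theorem.
\<close>

lemma Mult_bounded:
  assumes "\<phi> \<in> Mult" obtains C where "0 \<le> C" "mbound \<phi> C"
proof -
  define d where "d = (\<lambda>f g. if f \<in> H \<and> g \<in> H then hnorm (\<lambda>x. f x - g x) else 0)"
  interpret M: Metric_space H d
  proof
    fix f g h
    show "0 \<le> d f g" by (simp add: d_def diff_mem)
    show "d f g = d g f" by (cases "f \<in> H \<and> g \<in> H") (auto simp: d_def intro: hnorm_diff_commute)
    assume f: "f \<in> H" and g: "g \<in> H"
    show "d f g = 0 \<longleftrightarrow> f = g"
      using hnorm_eq_0[OF diff_mem[OF f g]] f g by (auto simp: d_def fun_eq_iff)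
    assume h: "h \<in> H"
    show "d f h \<le> d f g + d g h"
      using hnorm_triangle[OF diff_mem[OF f g] diff_mem[OF g h]] f g h by (simp add: d_def)
  qed
  have lim: "hlim s f" if "limitin M.mtopology s f sequentially" "range s \<subseteq> H" for s f
  proof -
    have f: "f \<in> H" "(\<lambda>n. d (s n) f) \<longlonglongrightarrow> 0"
      using that(1) by (auto simp: M.limitin_metric_dist_null)
    then show ?thesis
      using that(2) by (auto simp: hlim_def d_def image_subset_iff)
  qed
  have compl: "M.mcomplete"
    unfolding M.mcomplete_def
  proof (intro allI impI)
    fix s assume s: "M.MCauchy s"
    then have sH: "s n \<in> H" for n by (auto simp: M.MCauchy_def)
    have cauchy: "\<exists>N. \<forall>m\<ge>N. \<forall>n\<ge>N. sqrt (Re (ip (\<lambda>x. s m x - s n x) (\<lambda>x. s m x - s n x))) < e" if e: "e > 0" for e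
    proof -
      obtain N where "\<forall>n m. N \<le> n \<longrightarrow> N \<le> m \<longrightarrow> d (s n) (s m) < e"
        using s e by (auto simp: M.MCauchy_def)
      then show ?thesis
        using sH by (auto simp: d_def hnorm_def)
    qed
    obtain f where f: "f \<in> H" "(\<lambda>n. sqrt (Re (ip (\<lambda>x. s n x - f x) (\<lambda>x. s n x - f x)))) \<longlonglongrightarrow> 0"
      using complete[of s, OF sH cauchy] by blast
    have "(\<lambda>n. d (s n) f) \<longlonglongrightarrow> 0"
      using f sH by (simp add: d_def hnorm_def)
    then have "limitin M.mtopology s f sequentially"
      using sH f(1) by (simp add: M.limitin_metric_dist_null)
    then show "\<exists>f. limitin M.mtopology s f sequentially" by blast
  qed
  define E where "E = (\<lambda>n::nat. {f \<in> H. \<forall>S c. finite S \<longrightarrow> S \<subseteq> X \<longrightarrow>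
      cmod (\<Sum>i\<in>S. cnj (c i) * (\<phi> i * f i)) \<le> real n * hnorm (kcomb S c)})"
  have E_norm: "hnorm (\<lambda>x. \<phi> x * f x) \<le> real n" if "f \<in> E n" for f n
    using that assms by (intro hnorm_le_of_kernel_bound) (auto simp: E_def Mult_mem)
  have closed: "closedin M.mtopology (E n)" for n
    unfolding M.metric_closedin_iff_sequentially_closed
  proof (intro conjI allI impI)
    show "E n \<subseteq> H" by (auto simp: E_def)
    fix s f assume s: "range s \<subseteq> E n \<and> limitin M.mtopology s f sequentially"
    then have l: "hlim s f"
      by (intro lim) (auto simp: E_def)
    show "f \<in> E n"
      unfolding E_def
    proof (intro CollectI conjI allI impI)
      show "f \<in> H" using l by (simp add: hlim_def)
      fix S c assume S: "finite S" "S \<subseteq> X"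
      have le: "cmod (\<Sum>i\<in>S. cnj (c i) * (\<phi> i * s m i)) \<le> real n * hnorm (kcomb S c)" for m
      proof -
        have "s m \<in> E n" using s by auto
        then show ?thesis
          using S unfolding E_def by blast
      qed
      have "(\<lambda>m. cmod (\<Sum>i\<in>S. cnj (c i) * (\<phi> i * s m i))) \<longlonglongrightarrow> cmod (\<Sum>i\<in>S. cnj (c i) * (\<phi> i * f i))"
        using S by (intro tendsto_intros hlim_pointwise[OF l]) auto
      then show "cmod (\<Sum>i\<in>S. cnj (c i) * (\<phi> i * f i)) \<le> real n * hnorm (kcomb S c)"
        by (rule LIMSEQ_le_const2) (use le in blast)
    qed
  qed
  have "\<Union>(range E) = H"
  proof
    show "H \<subseteq> \<Union>(range E)"
    proof
      fix f assume f: "f \<in> H"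
      obtain n where n: "hnorm (\<lambda>x. \<phi> x * f x) \<le> real n"
        using real_arch_simple by blast
      have "cmod (\<Sum>i\<in>S. cnj (c i) * (\<phi> i * f i)) \<le> real n * hnorm (kcomb S c)"
        if S: "finite S" "S \<subseteq> X" for S c
      proof -
        have "cmod (\<Sum>i\<in>S. cnj (c i) * (\<phi> i * f i)) \<le> hnorm (\<lambda>x. \<phi> x * f x) * hnorm (kcomb S c)"
          using cauchy_schwarz[OF Mult_mem[OF assms f] kcomb_mem[OF S(2)], of c]
            ip_kcomb[OF Mult_mem[OF assms f] S(2)] by simp
        also have "\<dots> \<le> real n * hnorm (kcomb S c)"
          using n S by (intro mult_right_mono) (auto simp: kcomb_mem)
        finally show ?thesis .
      qed
      then show "f \<in> \<Union>(range E)"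
        using f by (auto simp: E_def)
    qed
  qed (auto simp: E_def)
  then have "M.mtopology interior_of \<Union>(range E) \<noteq> {}"
    using zero_mem interior_of_topspace[of M.mtopology] by auto
  then obtain n where "M.mtopology interior_of (E n) \<noteq> {}"
    using M.metric_Baire_category_alt[OF compl, of "range E"] closed by auto
  then obtain f0 where "f0 \<in> M.mtopology interior_of (E n)" by blast
  then obtain U where U: "openin M.mtopology U" "f0 \<in> U" "U \<subseteq> E n"
    by (auto simp: interior_of_def)
  then obtain r where r: "r > 0" "M.mball f0 r \<subseteq> E n"
    unfolding M.openin_mtopology by blast
  have f0: "f0 \<in> H" "f0 \<in> E n"
    using U M.openin_mtopology by (auto simp: E_def)
  have "hnorm (\<lambda>x. \<phi> x * f x) \<le> (4 * real n / r) * hnorm f" if f: "f \<in> H" for f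
  proof (cases "hnorm f = 0")
    case True
    then have "f = (\<lambda>x. 0)" using f hnorm_eq_0 by blast
    then show ?thesis by simp
  next
    case False
    then have pos: "hnorm f > 0" using f hnorm_nonneg[OF f] by linarith
    \<comment> \<open>Small enough for \<open>f0 + t f\<close> to stay in the ball of radius \<open>r\<close> around \<open>f0\<close>.\<close>
    define t where "t = r / (2 * hnorm f)"
    have t: "t > 0" using r pos by (simp add: t_def)
    define g where "g = (\<lambda>x. f0 x + complex_of_real t * f x)"
    have gH: "g \<in> H" unfolding g_def by (intro add_mem scale_mem f0 f)
    have "hnorm (\<lambda>x. complex_of_real t * f x) = r / 2"
      using t pos r(1) unfolding hnorm_scale[OF f] norm_of_real by (simp add: t_def)
    moreover have "(\<lambda>x. g x - f0 x) = (\<lambda>x. complex_of_real t * f x)"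
      by (simp add: g_def)
    ultimately have "d f0 g < r"
      using gH f0 r(1) hnorm_diff_commute[OF f0(1) gH] by (simp add: d_def)
    then have "g \<in> E n"
      using r(2) gH f0 by (auto simp: M.in_mball)
    have "complex_of_real t * (\<phi> x * f x) = \<phi> x * g x - \<phi> x * f0 x" for x
      by (simp add: g_def algebra_simps)
    then have "hnorm (\<lambda>x. complex_of_real t * (\<phi> x * f x)) = hnorm (\<lambda>x. \<phi> x * g x - \<phi> x * f0 x)"
      by simp
    also have "\<dots> \<le> hnorm (\<lambda>x. \<phi> x * g x) + hnorm (\<lambda>x. \<phi> x * f0 x)"
      by (intro hnorm_diff_le Mult_mem assms gH f0)
    also have "\<dots> \<le> real n + real n"
      by (intro add_mono E_norm \<open>g \<in> E n\<close> f0)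
    finally have "t * hnorm (\<lambda>x. \<phi> x * f x) \<le> 2 * real n"
      unfolding hnorm_scale[OF Mult_mem[OF assms f]] using t by simp
    then have "hnorm (\<lambda>x. \<phi> x * f x) \<le> 2 * real n / t"
      using t by (simp add: field_simps)
    then show ?thesis
      by (simp add: t_def field_simps)
  qed
  then show thesis
    using that[of "4 * real n / r"] assms r(1) by (auto simp: mbound_def)
qed

end

section \<open>Interpolation by rows of multipliers\<close>

lemma psd_on_reindex:
  assumes "psd_on (z ` S) A" "inj_on z S"
  shows "psd_on S (\<lambda>i j. A (z i) (z j))"
  unfolding psd_on_def
proof (intro conjI allI ballI)
  show "A (z j) (z i) = cnj (A (z i) (z j))" if "i \<in> S" "j \<in> S" for i j
    by (rule psd_on_hermitian[OF assms(1)]) (use that in auto)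
  fix c :: "'b \<Rightarrow> complex"
  define d where "d = (\<lambda>y. c (the_inv_into S z y))"
  have d: "d (z i) = c i" if "i \<in> S" for i
    using that assms(2) by (simp add: d_def the_inv_into_f_f)
  have "0 \<le> Re (qform (z ` S) d A)"
    by (rule psd_on_nonneg[OF assms(1)])
  also have "qform (z ` S) d A =
      (\<Sum>i\<in>S. \<Sum>j\<in>S. cnj (d (z i)) * d (z j) * A (z i) (z j))"
    by (simp add: sum.reindex[OF assms(2)])
  also have "\<dots> = qform S c (\<lambda>i j. A (z i) (z j))"
    by (intro sum.cong refl) (simp add: d)
  finally show "0 \<le> Re (qform S c (\<lambda>i j. A (z i) (z j)))" .
qed

lemma psd_on_nonneg_complex:
  assumes "psd_on S A"
  shows "0 \<le> (qform S c A)"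
proof -
  let ?q = "\<Sum>i\<in>S. \<Sum>j\<in>S. cnj (c i) * c j * A i j"
  have "cnj ?q = (\<Sum>i\<in>S. \<Sum>j\<in>S. cnj (c j) * c i * cnj (A i j))"
    by (simp add: mult.commute)
  also have "\<dots> = (\<Sum>i\<in>S. \<Sum>j\<in>S. cnj (c j) * c i * A j i)"
  proof (intro sum.cong refl)
    fix i j assume "i \<in> S" "j \<in> S"
    then have "A j i = cnj (A i j)" by (rule psd_on_hermitian[OF assms])
    then show "cnj (c j) * c i * cnj (A i j) = cnj (c j) * c i * A j i" by simp
  qed
  also have "\<dots> = ?q" by (rule sum.swap)
  finally have "?q \<in> \<real>" by (simp only: Reals_cnj_iff)
  then have "Im ?q = 0" by (simp only: complex_is_Real_iff)
  then show ?thesis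
    using psd_on_nonneg[OF assms, of c] by (simp add: less_eq_complex_def)
qed

lemma psd_on_scale:
  assumes "psd_on S A"
  shows "psd_on S (\<lambda>i j. d i * A i j * cnj (d j))"
  unfolding psd_on_def
proof (intro conjI allI ballI)
  fix i j assume "i \<in> S" "j \<in> S"
  then have "A j i = cnj (A i j)" by (rule psd_on_hermitian[OF assms])
  then show "d j * A j i * cnj (d i) = cnj (d i * A i j * cnj (d j))" by simp
next
  fix c
  have "qform S c (\<lambda>i j. d i * A i j * cnj (d j)) =
     (\<Sum>i\<in>S. \<Sum>j\<in>S. cnj (c i * cnj (d i)) * (c j * cnj (d j)) * A i j)"
    by (simp add: algebra_simps)
  then show "0 \<le> Re (qform S c (\<lambda>i j. d i * A i j * cnj (d j)))"
    using psd_on_nonneg[OF assms, of "\<lambda>i. c i * cnj (d i)"] by simp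
qed

lemma psd_on_ones: "psd_on S (\<lambda>i j. 1)"
  unfolding psd_on_def
proof (intro conjI allI ballI)
  fix c
  have "qform S c (\<lambda>i j. 1) = cnj (\<Sum>i\<in>S. c i) * (\<Sum>i\<in>S. c i)"
    by (simp add: sum_product)
  also have "\<dots> = complex_of_real ((cmod (\<Sum>i\<in>S. c i))\<^sup>2)"
    using complex_norm_square mult.commute by metis
  finally show "0 \<le> Re (qform S c (\<lambda>i j. 1))"
    by (simp only: Re_complex_of_real zero_le_power2)
qed simp

lemma psd_on_rank_one: "psd_on S (\<lambda>i j. d i * cnj (d j))"
  using psd_on_scale[OF psd_on_ones, of S d] by simp

lemma psd_on_insert_zero:
  assumes "psd_on S A" "finite S" "s \<notin> S"
    and "\<And>j. j \<in> insert s S \<Longrightarrow> A s j = 0" "\<And>j. j \<in> insert s S \<Longrightarrow> A j s = 0"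
  shows "psd_on (insert s S) A"
  unfolding psd_on_def
proof (intro conjI allI ballI)
  fix i j assume "i \<in> insert s S" "j \<in> insert s S"
  then show "A j i = cnj (A i j)"
    using psd_on_hermitian[OF assms(1), of i j] assms(4,5) by (cases "i = s \<or> j = s") auto
next
  fix c
  show "0 \<le> Re (qform (insert s S) c A)"
    unfolding psd_on_insert_form[OF assms(2,3)] using psd_on_nonneg[OF assms(1), of c] assms(4,5)
    by simp
qed

lemma sum_divmod:
  fixes f :: "nat \<Rightarrow> 'b::comm_monoid_add"
  assumes "0 < r"
  shows "(\<Sum>p<n * r. f p) = (\<Sum>i<n. \<Sum>a<r. f (i * r + a))"
  using sum.nat_group[of f r n]
  by (simp add: sum.atLeastLessThan_shift_0[of f] atLeast0LessThan comp_def)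

context rkhs
begin

lemma kernel_psd: assumes "S \<subseteq> X" shows "psd_on S k"
  unfolding psd_on_def
proof (intro conjI allI ballI)
  show "k j i = cnj (k i j)" if "i \<in> S" "j \<in> S" for i j
    using that assms by (intro kernel_hermitian) auto
  show "0 \<le> Re (qform S c k)" for c
    using hnorm_kcomb_sq[OF assms, of c] by (metis zero_le_power2)
qed

lemma tuple_norm_nonneg: "(\<And>i. i < r \<Longrightarrow> F i \<in> H) \<Longrightarrow> 0 \<le> tuple_norm r F"
  by (simp add: tuple_norm_def sum_nonneg)

lemma component_le_tuple_norm:
  assumes "i < r" shows "hnorm (F i) \<le> tuple_norm r F"
proof -
  have "(hnorm (F i))\<^sup>2 \<le> (\<Sum>i<r. (hnorm (F i))\<^sup>2)"
    using assms by (intro member_le_sum) auto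
  then have "sqrt ((hnorm (F i))\<^sup>2) \<le> tuple_norm r F"
    unfolding tuple_norm_def by (rule real_sqrt_le_mono)
  then show ?thesis by simp
qed

lemma row_sum_mem:
  assumes "\<And>l. l < r \<Longrightarrow> \<phi> l \<in> Mult" "\<And>l. l < r \<Longrightarrow> F l \<in> H"
  shows "(\<lambda>x. \<Sum>l<r. \<phi> l x * F l x) \<in> H"
  using lincomb_mem[of "{..<r}" "\<lambda>l x. \<phi> l x * F l x" "\<lambda>_. 1"] assms
  by (simp add: lincomb_def Mult_mem)

lemma hnorm_sum_le:
  assumes "\<And>i. i \<in> S \<Longrightarrow> v i \<in> H"
  shows "hnorm (\<lambda>x. \<Sum>i\<in>S. v i x) \<le> (\<Sum>i\<in>S. hnorm (v i))"
  using assms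
proof (induction S rule: infinite_finite_induct)
  case (insert i S)
  have "(\<lambda>x. \<Sum>i\<in>S. v i x) \<in> H"
    using lincomb_mem[of S v "\<lambda>_. 1"] insert by (simp add: lincomb_def)
  then show ?case
    using insert hnorm_triangle[of "v i" "\<lambda>x. \<Sum>i\<in>S. v i x"] by simp
qed auto

text \<open>
  This makes the supremum in \<open>mat_mult_norm\<close> a least upper bound; it depends on the automatic
  boundedness of multipliers.
\<close>

lemma mat_mult_bounded:
  assumes \<Phi>: "\<And>i j. i < r \<Longrightarrow> j < r \<Longrightarrow> \<Phi> $$ (i, j) \<in> Mult"
  shows "bdd_above ((\<lambda>F. tuple_norm r (mat_mult_op r \<Phi> F)) ` {F \<in> {..<r} \<rightarrow>\<^sub>E H. tuple_norm r F \<le> 1})"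
proof -
  have "\<exists>C. 0 \<le> C \<and> mbound (\<Phi> $$ (i, j)) C" if "i < r" "j < r" for i j
    using Mult_bounded[OF \<Phi>[OF that]] by blast
  then obtain C where C: "\<And>i j. i < r \<Longrightarrow> j < r \<Longrightarrow> 0 \<le> C i j \<and> mbound (\<Phi> $$ (i, j)) (C i j)"
    by metis
  have "tuple_norm r (mat_mult_op r \<Phi> F) \<le> sqrt (\<Sum>i<r. (\<Sum>j<r. C i j)\<^sup>2)"
    if F: "F \<in> {..<r} \<rightarrow>\<^sub>E H" "tuple_norm r F \<le> 1" for F
  proof -
    have FH: "F j \<in> H" if "j < r" for j using F that by auto
    have "hnorm (mat_mult_op r \<Phi> F i) \<le> (\<Sum>j<r. C i j)" if i: "i < r" for i
    proof -
      have "mat_mult_op r \<Phi> F i = (\<lambda>x. \<Sum>j<r. (\<Phi> $$ (i, j)) x * F j x)"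
        using i by (simp add: mat_mult_op_def)
      then have "hnorm (mat_mult_op r \<Phi> F i) \<le> (\<Sum>j<r. hnorm (\<lambda>x. (\<Phi> $$ (i, j)) x * F j x))"
        using i \<Phi> FH hnorm_sum_le[of "{..<r}" "\<lambda>j x. (\<Phi> $$ (i, j)) x * F j x"] by (simp add: Mult_mem)
      also have "\<dots> \<le> (\<Sum>j<r. C i j)"
      proof (rule sum_mono)
        fix j assume "j \<in> {..<r}"
        then have j: "j < r" by simp
        have "hnorm (\<lambda>x. (\<Phi> $$ (i, j)) x * F j x) \<le> C i j * hnorm (F j)"
          using C[OF i j] FH[OF j] by (auto intro: mbound_le)
        also have "\<dots> \<le> C i j * 1"
          using C[OF i j] component_le_tuple_norm[OF j, of F] F(2) by (intro mult_left_mono) auto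
        finally show "hnorm (\<lambda>x. (\<Phi> $$ (i, j)) x * F j x) \<le> C i j" by simp
      qed
      finally show ?thesis .
    qed
    moreover have "0 \<le> hnorm (mat_mult_op r \<Phi> F i)" if "i < r" for i
      using that \<Phi> FH by (simp add: mat_mult_op_def row_sum_mem)
    ultimately show ?thesis
      unfolding tuple_norm_def by (intro real_sqrt_le_mono sum_mono power_mono) auto
  qed
  then show ?thesis
    by (intro bdd_aboveI2) auto
qed

lemma mat_mult_first_row_contraction:
  assumes \<Phi>: "\<And>i j. i < r \<Longrightarrow> j < r \<Longrightarrow> \<Phi> $$ (i, j) \<in> Mult" and "mat_mult_norm r \<Phi> \<le> 1" "0 < r"
    and F: "\<And>l. l < r \<Longrightarrow> F l \<in> H"
  shows "(hnorm (\<lambda>x. \<Sum>l<r. (\<Phi> $$ (0, l)) x * F l x))\<^sup>2 \<le> (\<Sum>l<r. (hnorm (F l))\<^sup>2)"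
proof -
  define w where "w = (\<lambda>x. \<Sum>l<r. (\<Phi> $$ (0, l)) x * F l x)"
  have wH: "w \<in> H"
    unfolding w_def using \<Phi> F \<open>0 < r\<close> by (intro row_sum_mem) auto
  define t where "t = tuple_norm r F"
  have t0: "0 \<le> t" unfolding t_def by (intro tuple_norm_nonneg F)
  have "hnorm w \<le> s" if s: "t < s" for s
  proof -
    have s0: "0 < s" using s t0 by simp
    define G where "G = (\<lambda>l\<in>{..<r}. \<lambda>x. complex_of_real (1 / s) * F l x)"
    have G: "G \<in> {..<r} \<rightarrow>\<^sub>E H"
      unfolding G_def restrict_PiE_iff using F scale_mem by blast
    have "(\<Sum>l<r. (hnorm (G l))\<^sup>2) = (\<Sum>l<r. (1 / s)\<^sup>2 * (hnorm (F l))\<^sup>2)"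
    proof (intro sum.cong refl)
      fix l assume "l \<in> {..<r}"
      then show "(hnorm (G l))\<^sup>2 = (1 / s)\<^sup>2 * (hnorm (F l))\<^sup>2"
        unfolding G_def using F s0 hnorm_scale[OF F, of l "complex_of_real (1 / s)"]
        by (simp add: power_mult_distrib power_divide norm_divide)
    qed
    then have "tuple_norm r G = (1 / s) * t"
      unfolding tuple_norm_def t_def sum_distrib_left[symmetric] using s0
      by (simp add: real_sqrt_mult)
    then have "tuple_norm r G \<le> 1"
      using s s0 by simp
    then have "tuple_norm r (mat_mult_op r \<Phi> G) \<le> mat_mult_norm r \<Phi>"
      unfolding mat_mult_norm_def op_norm_def using G mat_mult_bounded[of r \<Phi>] \<Phi>
      by (intro cSUP_upper) auto
    then have "hnorm (mat_mult_op r \<Phi> G 0) \<le> 1"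
      using component_le_tuple_norm[of 0 r "mat_mult_op r \<Phi> G"] assms(2,3) by linarith
    moreover have "mat_mult_op r \<Phi> G 0 = (\<lambda>x. complex_of_real (1 / s) * w x)"
      using \<open>0 < r\<close> by (auto simp: mat_mult_op_def G_def w_def sum_distrib_left intro!: ext sum.cong)
    ultimately have "(1 / s) * hnorm w \<le> 1"
      using hnorm_scale[OF wH, of "complex_of_real (1 / s)"] s0 by (simp add: norm_divide)
    then show ?thesis
      using s0 by (simp add: field_simps)
  qed
  \<comment> \<open>\<open>F\<close> was scaled by \<open>1 / s\<close> for \<open>s > t\<close>, since \<open>t\<close> itself may be zero.\<close>
  then have "hnorm w \<le> t"
    by (rule dense_ge)
  then have "(hnorm w)\<^sup>2 \<le> t\<^sup>2"
    using wH by (intro power_mono) auto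
  then show ?thesis
    by (simp add: w_def t_def tuple_norm_def sum_nonneg)
qed

lemma mat_row_times_adjoint:
  assumes "a < r" "b < r" "W = Matrix.mat r r (\<lambda>(a, b). if a = 0 then u b else 0)"
    "V = Matrix.mat r r (\<lambda>(a, b). if a = 0 then v b else (0 :: complex))"
  shows "(1\<^sub>m r - W * mat_adjoint V) $$ (a, b) =
    (if a = b then if a = 0 then 1 - (\<Sum>l<r. u l * cnj (v l)) else 1 else 0)"
  using assms by (auto simp: mat_adjoint_def mat_of_rows_def scalar_prod_def conjugate_complex_def lessThan_atLeast0)

text \<open>
  Rows of length \<open>r\<close> are turned into square matrices by adding zero rows.  The Pick matrix then splits
  into \<open>r\<close> blocks, one for the row problem and \<open>r - 1\<close> copies of the Gram matrix of the kernel.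
\<close>

lemma pick_mat_row_psd:
  assumes "0 < r" and psd: "psd_on {..<n} (\<lambda>i j. k (z i) (z j) * (1 - (\<Sum>l<r. \<beta> l (z i) * cnj (\<beta> l (z j)))))"
    and kpsd: "psd_on {..<n} (\<lambda>i j. k (z i) (z j))"
  shows "psd_mat (n * r) (pick_mat k n r z (\<lambda>i. Matrix.mat r r (\<lambda>(a, b). if a = 0 then \<beta> b (z i) else 0)))"
  unfolding psd_mat_def
proof (intro conjI ballI)
  define A where "A = pick_mat k n r z (\<lambda>i. Matrix.mat r r (\<lambda>(a, b). if a = 0 then \<beta> b (z i) else 0))"
  show A: "A \<in> carrier_mat (n * r) (n * r)"
    by (simp add: A_def pick_mat_def)
  fix v :: "complex Matrix.vec" assume v: "v \<in> carrier_vec (n * r)"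
  define B where "B = (\<lambda>(a :: nat) i j. k (z i) (z j) * (if a = 0 then 1 - (\<Sum>l<r. \<beta> l (z i) * cnj (\<beta> l (z j))) else 1))"
  define c where "c = (\<lambda>a i. vec_index v (i * r + a))"
  have less: "i * r + a < n * r" if "i < n" "a < r" for i a
  proof -
    have "i * r + a < (i + 1) * r" using that by simp
    also have "\<dots> \<le> n * r" using that by (intro mult_right_mono) auto
    finally show ?thesis .
  qed
  have entry: "A $$ (i * r + a, j * r + b) = (if a = b then B a i j else 0)"
    if "i < n" "j < n" "a < r" "b < r" for i j a b
    unfolding A_def pick_mat_def using that less \<open>0 < r\<close>
    by (simp add: mat_row_times_adjoint B_def)
  have "(A *\<^sub>v v) \<bullet>c v = (\<Sum>p<n * r. \<Sum>q<n * r. cnj (vec_index v p) * vec_index v q * A $$ (p, q))"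
    using v A by (simp add: scalar_prod_def conjugate_complex_def lessThan_atLeast0 sum_distrib_left
        sum_distrib_right algebra_simps)
  also have "\<dots> = (\<Sum>i<n. \<Sum>a<r. \<Sum>j<n. \<Sum>b<r. cnj (c a i) * c b j * A $$ (i * r + a, j * r + b))"
    unfolding sum_divmod[OF \<open>0 < r\<close>] c_def ..
  also have "\<dots> = (\<Sum>i<n. \<Sum>a<r. \<Sum>j<n. \<Sum>b<r. if a = b then cnj (c a i) * c b j * B a i j else 0)"
    by (intro sum.cong refl) (simp add: entry)
  also have "\<dots> = (\<Sum>i<n. \<Sum>a<r. \<Sum>j<n. cnj (c a i) * c a j * B a i j)"
    by (simp add: sum.delta)
  also have "\<dots> = (\<Sum>a<r. \<Sum>i<n. \<Sum>j<n. cnj (c a i) * c a j * B a i j)"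
    by (rule sum.swap)
  also have "0 \<le> \<dots>"
  proof (rule sum_nonneg)
    fix a assume "a \<in> {..<r}"
    have "psd_on {..<n} (B a)"
      using psd kpsd by (cases "a = 0") (simp_all add: B_def)
    then show "0 \<le> (\<Sum>i<n. \<Sum>j<n. cnj (c a i) * c a j * B a i j)"
      by (rule psd_on_nonneg_complex)
  qed
  finally show "0 \<le> (A *\<^sub>v v) \<bullet>c v" .
qed

text \<open>
  The form in which the complete Pick property is applied: interpolation of row-valued data on a
  finite set of points by a contractive row of multipliers.
\<close>

lemma pick_row:
  fixes r :: nat
  assumes complete_pick "finite T" "T \<subseteq> X" "0 < r"
    and psd: "psd_on T (\<lambda>i j. k i j * (1 - (\<Sum>l<r. \<beta> l i * cnj (\<beta> l j))))"
  obtains \<phi> where "\<And>l. l < r \<Longrightarrow> \<phi> l \<in> Mult" "\<And>l i. l < r \<Longrightarrow> i \<in> T \<Longrightarrow> \<phi> l i = \<beta> l i"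
    "\<And>F. (\<And>l. l < r \<Longrightarrow> F l \<in> H) \<Longrightarrow>
       (hnorm (\<lambda>x. \<Sum>l<r. \<phi> l x * F l x))\<^sup>2 \<le> (\<Sum>l<r. (hnorm (F l))\<^sup>2)"
proof -
  obtain z where z: "bij_betw z {..<card T} T"
    using ex_bij_betw_nat_finite[OF assms(2)] by (auto simp: lessThan_atLeast0)
  define n where "n = card T"
  have zT: "z ` {..<n} = T" "inj_on z {..<n}"
    using z by (auto simp: bij_betw_def n_def)
  define W where "W = (\<lambda>i. Matrix.mat r r (\<lambda>(a, b). if a = 0 then \<beta> b (z i) else 0))"
  have 1: "psd_on {..<n} (\<lambda>i j. k (z i) (z j) * (1 - (\<Sum>l<r. \<beta> l (z i) * cnj (\<beta> l (z j)))))"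
    using psd_on_reindex[OF _ zT(2)] psd unfolding zT(1) by blast
  have 2: "psd_on {..<n} (\<lambda>i j. k (z i) (z j))"
    using psd_on_reindex[OF _ zT(2)] kernel_psd[OF assms(3)] unfolding zT(1) by blast
  have "psd_mat (n * r) (pick_mat k n r z W)"
    unfolding W_def by (rule pick_mat_row_psd[OF \<open>0 < r\<close> 1 2])
  moreover have "\<forall>i<n. z i \<in> X \<and> W i \<in> carrier_mat r r"
    using zT(1) assms(3) by (auto simp: W_def)
  ultimately obtain \<Phi> where \<Phi>: "\<Phi> \<in> carrier_mat r r" "elements_mat \<Phi> \<subseteq> Mult"
    "mat_mult_norm r \<Phi> \<le> 1" "\<And>i. i < n \<Longrightarrow> map_mat (\<lambda>\<phi>. \<phi> (z i)) \<Phi> = W i"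
    using assms(1) \<open>0 < r\<close> unfolding complete_pick_def by metis
  have M: "\<Phi> $$ (i, j) \<in> Mult" if "i < r" "j < r" for i j
    using \<Phi>(1,2) that by (intro subsetD[OF \<Phi>(2)] elements_matI) auto
  have "(\<Phi> $$ (0, l)) y = \<beta> l y" if "l < r" "y \<in> T" for l y
  proof -
    have "y \<in> z ` {..<n}" using that zT(1) by simp
    then obtain i where i: "i < n" "y = z i" by auto
    have "map_mat (\<lambda>\<phi>. \<phi> (z i)) \<Phi> $$ (0, l) = W i $$ (0, l)"
      using \<Phi>(4)[OF i(1)] by simp
    then show ?thesis
      using \<Phi>(1) that \<open>0 < r\<close> i by (simp add: W_def)
  qed
  then show thesis
    using that[of "\<lambda>l. \<Phi> $$ (0, l)"] M \<open>0 < r\<close> mat_mult_first_row_contraction[OF M \<Phi>(3) \<open>0 < r\<close>]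
    by blast
qed

end

context rkhs
begin

section \<open>The theorem of McCullough and Quiggin\<close>

text \<open>
  A factorization of the coefficient matrix turns the quadratic form of its Schur product with a Gram
  matrix into a sum of squared norms.
\<close>

lemma factored_gram:
  fixes v :: "'i \<Rightarrow> 'a \<Rightarrow> complex"
  assumes A: "\<And>i j. i \<in> S \<Longrightarrow> j \<in> S \<Longrightarrow> A i j = (\<Sum>l\<in>L. \<beta> l i * cnj (\<beta> l j))"
    and v: "\<And>i. i \<in> S \<Longrightarrow> v i \<in> H"
  shows "complex_of_real (\<Sum>l\<in>L. (hnorm (lincomb S (\<lambda>j. c j * cnj (\<beta> l j)) v))\<^sup>2) =
    (qform S c (\<lambda>i j. A i j * ip (v j) (v i)))"
proof -
  define T where "T = (\<lambda>l i j. cnj (c i) * c j * ip (v j) (v i) * (\<beta> l i * cnj (\<beta> l j)))"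
  have "complex_of_real ((hnorm (lincomb S (\<lambda>j. c j * cnj (\<beta> l j)) v))\<^sup>2) = (\<Sum>i\<in>S. \<Sum>j\<in>S. T l i j)" for l
  proof -
    let ?V = "lincomb S (\<lambda>j. c j * cnj (\<beta> l j)) v"
    have "?V \<in> H" by (intro lincomb_mem v)
    then have "complex_of_real ((hnorm ?V)\<^sup>2) = ip ?V ?V" by (rule ip_self[symmetric])
    also have "\<dots> = (\<Sum>i\<in>S. \<Sum>j\<in>S. cnj (c i * cnj (\<beta> l i)) * (c j * cnj (\<beta> l j)) * ip (v j) (v i))"
      by (intro ip_lincomb_lincomb v)
    also have "\<dots> = (\<Sum>i\<in>S. \<Sum>j\<in>S. T l i j)"
      by (simp add: T_def algebra_simps)
    finally show ?thesis .
  qed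
  then have "complex_of_real (\<Sum>l\<in>L. (hnorm (lincomb S (\<lambda>j. c j * cnj (\<beta> l j)) v))\<^sup>2) = (\<Sum>l\<in>L. \<Sum>i\<in>S. \<Sum>j\<in>S. T l i j)"
    unfolding of_real_sum by (simp only:)
  also have "\<dots> = (\<Sum>i\<in>S. \<Sum>l\<in>L. \<Sum>j\<in>S. T l i j)"
    by (rule sum.swap)
  also have "\<dots> = (\<Sum>i\<in>S. \<Sum>j\<in>S. \<Sum>l\<in>L. T l i j)"
    by (intro sum.cong refl sum.swap)
  also have "\<dots> = qform S c (\<lambda>i j. A i j * ip (v j) (v i))"
    by (intro sum.cong refl) (simp add: A T_def flip: sum_distrib_left)
  finally show ?thesis .
qed

lemma schur_product:
  fixes v :: "'i \<Rightarrow> 'a \<Rightarrow> complex"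
  assumes "psd_on S A" "finite S" "\<And>i. i \<in> S \<Longrightarrow> v i \<in> H"
  shows "psd_on S (\<lambda>i j. A i j * ip (v j) (v i))"
  unfolding psd_on_def
proof (intro conjI allI ballI)
  fix i j assume ij: "i \<in> S" "j \<in> S"
  have "A j i = cnj (A i j)"
    by (rule psd_on_hermitian[OF assms(1) ij])
  moreover have "ip (v i) (v j) = cnj (ip (v j) (v i))"
    by (rule ip_cnj[OF assms(3)[OF ij(2)] assms(3)[OF ij(1)]])
  ultimately show "A j i * ip (v i) (v j) = cnj (A i j * ip (v j) (v i))" by simp
next
  fix c
  obtain \<beta> where \<beta>: "\<And>i j. i \<in> S \<Longrightarrow> j \<in> S \<Longrightarrow> A i j = (\<Sum>l\<in>S. \<beta> l i * cnj (\<beta> l j))"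
    using psd_on_factorization[OF assms(2,1)] by blast
  have "complex_of_real (\<Sum>l\<in>S. (hnorm (lincomb S (\<lambda>j. c j * cnj (\<beta> l j)) v))\<^sup>2) =
      (qform S c (\<lambda>i j. A i j * ip (v j) (v i)))"
    by (intro factored_gram \<beta> assms(3))
  note e = this[symmetric]
  show "0 \<le> Re (qform S c (\<lambda>i j. A i j * ip (v j) (v i)))"
    unfolding e Re_complex_of_real by (intro sum_nonneg) simp
qed

text \<open>
  The row maps the tuples of functions vanishing at \<open>x\<close> to functions vanishing at \<open>x\<close>, and it is still
  contractive on this subspace, whose reproducing kernel is \<open>k i j - k i x * k x j / k x x\<close>.
  For a combination \<open>h\<close> of these kernel functions, \<open>F\<close> is the image of \<open>h\<close> under the adjoint of the
  row, and the claim is \<open>\<parallel>F\<parallel> \<le> \<parallel>h\<parallel>\<close>.  It follows from \<open>\<parallel>F\<parallel>\<^sup>2 = \<langle>w, h\<rangle> \<le> \<parallel>F\<parallel> \<parallel>h\<parallel>\<close>, where \<open>w\<close> is the image of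
  \<open>F\<close> under the row.
\<close>

lemma row_contraction_psd:
  fixes r :: nat
  assumes \<phi>: "\<And>l. l < r \<Longrightarrow> \<phi> l \<in> Mult"
    and contr: "\<And>F. (\<And>l. l < r \<Longrightarrow> F l \<in> H) \<Longrightarrow>
       (hnorm (\<lambda>x. \<Sum>l<r. \<phi> l x * F l x))\<^sup>2 \<le> (\<Sum>l<r. (hnorm (F l))\<^sup>2)"
    and "x \<in> X" "finite S" "S \<subseteq> X"
  shows "psd_on S (\<lambda>i j. (k i j - k i x * k x j / k x x) * (1 - (\<Sum>l<r. \<phi> l i * cnj (\<phi> l j))))"
proof -
  define q where "q = (\<lambda>i y. k y i - (k x i / k x x) * k y x)"
  have qH: "q i \<in> H" if "i \<in> S" for i
    unfolding q_def using that assms(3,5) by (intro diff_mem scale_mem kernel_mem) auto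
  have qx: "q i x = 0" for i
    using kernel_diag[OF assms(3)] by (simp add: q_def)
  have rep: "ip f (q i) = f i" if "f \<in> H" "f x = 0" "i \<in> S" for f i
  proof -
    have i: "i \<in> X" using that assms(5) by auto
    have "ip f (q i) = ip f (kf i) - cnj (k x i / k x x) * ip f (kf x)"
      unfolding q_def using i assms(3) that(1)
      by (simp only: ip_diff_right ip_scale_right scale_mem kernel_mem)
    then show ?thesis
      using i assms(3) that by (simp add: reproducing)
  qed
  have qq: "k i j - k i x * k x j / k x x = ip (q j) (q i)" if "i \<in> S" "j \<in> S" for i j
    using rep[OF qH qx] that by (simp add: q_def)
  have "psd_on S (\<lambda>i j. ip (q j) (q i) * (1 - (\<Sum>l<r. \<phi> l i * cnj (\<phi> l j))))"
    unfolding psd_on_def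
  proof (intro conjI allI ballI)
    fix i j assume "i \<in> S" "j \<in> S"
    then have "ip (q i) (q j) = cnj (ip (q j) (q i))"
      by (intro ip_cnj qH)
    then show "ip (q i) (q j) * (1 - (\<Sum>l<r. \<phi> l j * cnj (\<phi> l i))) =
        cnj (ip (q j) (q i) * (1 - (\<Sum>l<r. \<phi> l i * cnj (\<phi> l j))))"
      by (simp add: mult.commute)
  next
    fix c
    define h where "h = lincomb S c q"
    define F where "F = (\<lambda>l. lincomb S (\<lambda>i. c i * cnj (\<phi> l i)) q)"
    define w where "w = (\<lambda>y. \<Sum>l<r. \<phi> l y * F l y)"
    define N where "N = (\<Sum>l<r. (hnorm (F l))\<^sup>2)"
    have hH: "h \<in> H" and FH: "F l \<in> H" for l
      unfolding h_def F_def by (intro lincomb_mem qH; assumption)+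
    have wH: "w \<in> H"
      unfolding w_def by (intro row_sum_mem \<phi> FH)
    have Fx: "F l x = 0" for l
      by (simp add: F_def lincomb_def qx)
    then have wx: "w x = 0" by (simp add: w_def)
    have FF: "complex_of_real ((hnorm (F l))\<^sup>2) = (\<Sum>i\<in>S. cnj (c i) * \<phi> l i * F l i)" for l
    proof -
      have "complex_of_real ((hnorm (F l))\<^sup>2) = ip (F l) (lincomb S (\<lambda>i. c i * cnj (\<phi> l i)) q)"
        using ip_self[OF FH] by (simp add: F_def)
      also have "\<dots> = (\<Sum>i\<in>S. cnj (c i * cnj (\<phi> l i)) * ip (F l) (q i))"
        by (intro ip_lincomb_right qH FH)
      also have "\<dots> = (\<Sum>i\<in>S. cnj (c i) * \<phi> l i * F l i)"
        by (intro sum.cong refl) (simp add: rep FH Fx)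
      finally show ?thesis .
    qed
    have "complex_of_real N = (\<Sum>l<r. \<Sum>i\<in>S. cnj (c i) * \<phi> l i * F l i)"
      unfolding N_def of_real_sum by (simp only: FF)
    also have "\<dots> = (\<Sum>i\<in>S. cnj (c i) * w i)"
      by (subst sum.swap) (simp add: w_def sum_distrib_left mult.assoc)
    also have "\<dots> = (\<Sum>i\<in>S. cnj (c i) * ip w (q i))"
      by (intro sum.cong refl) (simp add: rep wH wx)
    also have "\<dots> = ip w h"
      unfolding h_def by (intro ip_lincomb_right[symmetric] qH wH)
    finally have Nwh: "complex_of_real N = ip w h" .
    have N0: "0 \<le> N" by (simp add: N_def sum_nonneg)
    have "N = cmod (ip w h)"
      using N0 by (simp flip: Nwh)
    then have "N \<le> hnorm w * hnorm h"
      using cauchy_schwarz[OF wH hH] by simp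
    then have "N\<^sup>2 \<le> (hnorm w)\<^sup>2 * (hnorm h)\<^sup>2"
      using N0 power_mono[of N "hnorm w * hnorm h" 2] by (simp add: power_mult_distrib)
    also have "\<dots> \<le> N * (hnorm h)\<^sup>2"
      unfolding w_def N_def by (intro mult_right_mono contr FH) simp
    finally have NN: "N * N \<le> N * (hnorm h)\<^sup>2" by (simp add: power2_eq_square)
    have le: "N \<le> (hnorm h)\<^sup>2"
    proof (cases "N = 0")
      case False
      then show ?thesis using NN N0 by (simp add: mult_le_cancel_left)
    qed simp
    have "complex_of_real ((hnorm h)\<^sup>2) = qform S c (\<lambda>i j. ip (q j) (q i))"
      unfolding ip_self[OF hH, symmetric] unfolding h_def by (intro ip_lincomb_lincomb qH)
    moreover have "complex_of_real N = qform S c (\<lambda>i j. (\<Sum>l<r. \<phi> l i * cnj (\<phi> l j)) * ip (q j) (q i))"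
      unfolding N_def F_def by (intro factored_gram refl qH)
    ultimately have "qform S c (\<lambda>i j. ip (q j) (q i) * (1 - (\<Sum>l<r. \<phi> l i * cnj (\<phi> l j))))
        = complex_of_real ((hnorm h)\<^sup>2 - N)"
      by (simp add: right_diff_distrib sum_subtractf mult_ac)
    then show "0 \<le> Re (qform S c (\<lambda>i j. ip (q j) (q i) * (1 - (\<Sum>l<r. \<phi> l i * cnj (\<phi> l j)))))"
      using le by simp
  qed
  moreover have "psd_on S (\<lambda>i j. (k i j - k i x * k x j / k x x) * (1 - (\<Sum>l<r. \<phi> l i * cnj (\<phi> l j))))
    = psd_on S (\<lambda>i j. ip (q j) (q i) * (1 - (\<Sum>l<r. \<phi> l i * cnj (\<phi> l j))))"
    by (rule psd_on_cong) (simp add: qq)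
  ultimately show ?thesis by simp
qed

text \<open>
  If \<open>\<bar>\<phi> x\<bar> = 1\<close>, then the kernel function at \<open>x\<close> is an eigenvector of \<open>M\<^sub>\<phi>\<close>, because it is one of the
  adjoint of this contraction.  In general, \<open>M\<^sub>\<phi> - \<phi> x\<close> maps the kernel function at \<open>x\<close> to a vector of
  norm at most \<open>\<parallel>k\<^sub>x\<parallel> * sqrt (1 - \<bar>\<phi> x\<bar>\<^sup>2)\<close>, and evaluating this vector at \<open>y\<close> gives the estimate.
\<close>

lemma contraction_rigidity:
  assumes \<phi>: "mbound \<phi> 1" and "x \<in> X" "y \<in> X"
  shows "(cmod (\<phi> y - \<phi> x) * cmod (k y x))\<^sup>2 \<le> (hnorm (kf x) * hnorm (kf y))\<^sup>2 * (1 - (cmod (\<phi> x))\<^sup>2)"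
proof -
  define f where "f = (\<lambda>z. \<phi> z * k z x)"
  define g where "g = (\<lambda>z. \<phi> x * k z x)"
  have kx: "kf x \<in> H" by (rule kernel_mem[OF assms(2)])
  have m: "f \<in> H" "g \<in> H"
    unfolding f_def g_def using kx \<phi> by (auto intro: Mult_mem mbound_Mult scale_mem)
  have "ip f g = cnj (\<phi> x) * (\<phi> x * k x x)"
    unfolding g_def ip_scale_right[OF kx m(1)] using m(1) assms(2) by (simp add: reproducing f_def)
  then have fg: "Re (ip f g) = (cmod (\<phi> x))\<^sup>2 * (hnorm (kf x))\<^sup>2"
    unfolding kernel_diag_norm[OF assms(2)] cmod_power2 by (simp add: power2_eq_square algebra_simps)
  have "hnorm f \<le> hnorm (kf x)"
    using mbound_le[OF \<phi> kx] by (simp add: f_def)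
  then have f: "(hnorm f)\<^sup>2 \<le> (hnorm (kf x))\<^sup>2"
    using m by (intro power_mono) auto
  have g: "(hnorm g)\<^sup>2 = (cmod (\<phi> x))\<^sup>2 * (hnorm (kf x))\<^sup>2"
    unfolding g_def hnorm_scale[OF kx] by (simp add: power_mult_distrib)
  have le: "(hnorm (\<lambda>z. f z - g z))\<^sup>2 \<le> (hnorm (kf x))\<^sup>2 * (1 - (cmod (\<phi> x))\<^sup>2)"
    unfolding hnorm_diff_sq[OF m] fg g using f by (simp add: algebra_simps)
  have "cmod (f y - g y) \<le> hnorm (\<lambda>z. f z - g z) * hnorm (kf y)"
    using eval_le[OF diff_mem[OF m] assms(3)] .
  moreover have "cmod (f y - g y) = cmod (\<phi> y - \<phi> x) * cmod (k y x)"
    by (simp add: f_def g_def norm_mult flip: left_diff_distrib)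
  ultimately have "(cmod (\<phi> y - \<phi> x) * cmod (k y x))\<^sup>2 \<le> (hnorm (\<lambda>z. f z - g z) * hnorm (kf y))\<^sup>2"
    by (intro power_mono) auto
  also have "\<dots> \<le> ((hnorm (kf x))\<^sup>2 * (1 - (cmod (\<phi> x))\<^sup>2)) * (hnorm (kf y))\<^sup>2"
    unfolding power_mult_distrib by (intro mult_right_mono le) simp
  finally show ?thesis by (simp add: power_mult_distrib algebra_simps)
qed

end

locale normalized_pick_space = rkhs +
  fixes x0 :: 'a
  assumes base_mem: "x0 \<in> X" and base_kernel: "x \<in> X \<Longrightarrow> k x x0 = 1"
    and pick: complete_pick
begin

lemma base_kernel_left: "x \<in> X \<Longrightarrow> k x0 x = 1"
  using kernel_hermitian[OF _ base_mem, of x] base_kernel[of x] by simp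

text \<open>
  If \<open>k x y = 0\<close>, then the values \<open>1\<close> at \<open>x\<close> and \<open>-1\<close> at \<open>y\<close> satisfy the condition of the Pick problem.
  The interpolating contraction would have to be rigid at both points, and would take both values at
  the base point.
\<close>

lemma kernel_nonzero:
  assumes "x \<in> X" "y \<in> X" shows "k x y \<noteq> 0"
proof
  assume 0: "k x y = 0"
  then have "x \<noteq> y" using kernel_diag[OF assms(1)] by auto
  define \<beta> where "\<beta> = (\<lambda>(l::nat) i. if i = x then 1 else - (1::complex))"
  have kyx: "k y x = 0" using kernel_hermitian[OF assms] 0 by simp
  have "psd_on {x, y} (\<lambda>i j. k i j * (1 - (\<Sum>l<1. \<beta> l i * cnj (\<beta> l j))))
     = psd_on {x, y} (\<lambda>i j. 0 * cnj 0)"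
    by (rule psd_on_cong) (use 0 kyx \<open>x \<noteq> y\<close> in \<open>auto simp: \<beta>_def\<close>)
  then have "psd_on {x, y} (\<lambda>i j. k i j * (1 - (\<Sum>l<1. \<beta> l i * cnj (\<beta> l j))))"
    using psd_on_rank_one[of "{x, y}" "\<lambda>_. 0"] by simp
  then obtain \<phi> where \<phi>: "\<And>l. l < 1 \<Longrightarrow> \<phi> l \<in> Mult" "\<And>l i. l < (1::nat) \<Longrightarrow> i \<in> {x, y} \<Longrightarrow> \<phi> l i = \<beta> l i"
    "\<And>F. (\<And>l. l < 1 \<Longrightarrow> F l \<in> H) \<Longrightarrow>
       (hnorm (\<lambda>x. \<Sum>l<1. \<phi> l x * F l x))\<^sup>2 \<le> (\<Sum>l<1. (hnorm (F l))\<^sup>2)"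
    using pick_row[OF pick, of "{x, y}" 1 \<beta>] assms by auto
  have "hnorm (\<lambda>x. \<phi> 0 x * f x) \<le> hnorm f" if "f \<in> H" for f
    using \<phi>(3)[of "\<lambda>_. f"] that by (auto intro: power2_le_imp_le)
  then have mb: "mbound (\<phi> 0) 1"
    using \<phi>(1) by (simp add: mbound_def)
  have "\<phi> 0 x0 = \<phi> 0 z" if "z \<in> X" "cmod (\<phi> 0 z) = 1" for z
    using contraction_rigidity[OF mb that(1) base_mem] base_kernel_left[OF that(1)] that by simp
  then have "\<phi> 0 x = \<phi> 0 y"
    using \<phi>(2) assms by (metis \<beta>_def insertCI less_one norm_minus_cancel norm_one)
  then show False
    using \<phi>(2)[of 0] \<open>x \<noteq> y\<close> by (simp add: \<beta>_def)
qed

text \<open>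
  Induction on the number of points, for all \<open>x\<close> simultaneously.  In the step from \<open>S\<close> to
  \<open>insert z S\<close>, the induction hypothesis is applied with \<open>z\<close> in place of \<open>x\<close>; the matrix \<open>A\<close> that it gives
  vanishes in the row and column of \<open>z\<close>, and so it is positive semidefinite on \<open>insert z S\<close>, too.  The factorization of \<open>A\<close> gives rows \<open>\<beta>\<close> for which the matrix of the Pick
  problem is \<open>k i z * k z j / k z z\<close>, of rank one.  The solution is a row contraction, and
  its compression to the functions vanishing at \<open>x\<close> yields the claim up to rescaling rows and columns.
\<close>

lemma complement_psd:
  assumes "finite S" "S \<subseteq> X" "x \<in> X"
  shows "psd_on S (\<lambda>i j. 1 - k i x * k x j / (k i j * k x x))"
  using assms
proof (induction S arbitrary: x)
  case empty
  then show ?case by (simp add: psd_on_def)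
next
  case (insert z S)
  define T where "T = insert z S"
  have T: "finite T" "T \<subseteq> X" and zX: "z \<in> X" and zT: "z \<in> T" using insert by (auto simp: T_def)
  have nz: "k i j \<noteq> 0" if "i \<in> T" "j \<in> T" for i j
    using that T by (intro kernel_nonzero) auto
  define A where "A = (\<lambda>i j. 1 - k i z * k z j / (k i j * k z z))"
  have "psd_on S A"
    unfolding A_def using insert by auto
  then have "psd_on T A"
    unfolding T_def by (rule psd_on_insert_zero)
      (use insert.hyps nz zT in \<open>auto simp: A_def T_def\<close>)
  then obtain \<gamma> where \<gamma>: "\<And>i j. i \<in> T \<Longrightarrow> j \<in> T \<Longrightarrow> A i j = (\<Sum>l\<in>T. \<gamma> l i * cnj (\<gamma> l j))"
    using psd_on_factorization[OF T(1)] by blast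
  obtain e where e: "bij_betw e {..<card T} T"
    using ex_bij_betw_nat_finite[OF T(1)] by (auto simp: lessThan_atLeast0)
  define r where "r = card T"
  define \<beta> where "\<beta> = (\<lambda>l. \<gamma> (e l))"
  have \<beta>: "(\<Sum>l<r. \<beta> l i * cnj (\<beta> l j)) = A i j" if "i \<in> T" "j \<in> T" for i j
    unfolding \<gamma>[OF that] \<beta>_def r_def
    by (rule sum.reindex_bij_betw[OF e, of "\<lambda>l. \<gamma> l i * cnj (\<gamma> l j)"])
  have "0 < r" using T zT by (auto simp: r_def card_gt_0_iff)
  \<comment> \<open>\<open>k z z\<close> is the square of the norm of the kernel function, so \<open>d\<close> is the rank one factor of
    \<open>k i z * k z j / k z z\<close>.\<close>
  define d where "d = (\<lambda>i. k i z / complex_of_real (hnorm (kf z)))"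
  have dd: "k i j * (1 - A i j) = d i * cnj (d j)" if "i \<in> T" "j \<in> T" for i j
  proof -
    have "cnj (k j z) = k z j" using kernel_hermitian[of j z] that T zX by auto
    then show ?thesis
      using nz[OF that] unfolding A_def d_def kernel_diag_norm[OF zX]
      by (simp add: power2_eq_square)
  qed
  have "psd_on T (\<lambda>i j. k i j * (1 - (\<Sum>l<r. \<beta> l i * cnj (\<beta> l j)))) = psd_on T (\<lambda>i j. d i * cnj (d j))"
    by (rule psd_on_cong) (simp add: \<beta> dd)
  then have "psd_on T (\<lambda>i j. k i j * (1 - (\<Sum>l<r. \<beta> l i * cnj (\<beta> l j))))"
    using psd_on_rank_one by blast
  then obtain \<phi> where \<phi>: "\<And>l. l < r \<Longrightarrow> \<phi> l \<in> Mult" "\<And>l i. l < r \<Longrightarrow> i \<in> T \<Longrightarrow> \<phi> l i = \<beta> l i"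
    "\<And>F. (\<And>l. l < r \<Longrightarrow> F l \<in> H) \<Longrightarrow>
       (hnorm (\<lambda>x. \<Sum>l<r. \<phi> l x * F l x))\<^sup>2 \<le> (\<Sum>l<r. (hnorm (F l))\<^sup>2)"
    using pick_row[OF pick T \<open>0 < r\<close>, of \<beta>] by blast
  have \<phi>A: "(\<Sum>l<r. \<phi> l i * cnj (\<phi> l j)) = A i j" if "i \<in> T" "j \<in> T" for i j
    using \<beta>[OF that] that by (simp add: \<phi>(2))
  have x: "x \<in> X" using insert by simp
  have "psd_on T (\<lambda>i j. (k i j - k i x * k x j / k x x) * (1 - (\<Sum>l<r. \<phi> l i * cnj (\<phi> l j))))"
    by (rule row_contraction_psd[OF \<phi>(1,3) x T]) auto
  then have "psd_on T (\<lambda>i j. (1 / d i) * ((k i j - k i x * k x j / k x x) * (1 - (\<Sum>l<r. \<phi> l i * cnj (\<phi> l j)))) * cnj (1 / d j))"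
    by (rule psd_on_scale)
  also have "psd_on T (\<lambda>i j. (1 / d i) * ((k i j - k i x * k x j / k x x) * (1 - (\<Sum>l<r. \<phi> l i * cnj (\<phi> l j)))) * cnj (1 / d j))
     = psd_on T (\<lambda>i j. 1 - k i x * k x j / (k i j * k x x))"
  proof (rule psd_on_cong)
    fix i j assume ij: "i \<in> T" "j \<in> T"
    have dnz: "d i \<noteq> 0" "cnj (d j) \<noteq> 0"
      using nz[OF ij(1) zT] nz[OF ij(2) zT] hnorm_kernel_pos[OF zX] by (auto simp: d_def)
    have "1 - A i j = d i * cnj (d j) / k i j"
      using dd[OF ij] nz[OF ij] by (simp add: field_simps)
    then show "(1 / d i) * ((k i j - k i x * k x j / k x x) * (1 - (\<Sum>l<r. \<phi> l i * cnj (\<phi> l j)))) * cnj (1 / d j)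
       = 1 - k i x * k x j / (k i j * k x x)"
    proof -
      have "(1 / d i) * ((k i j - k i x * k x j / k x x) * (d i * cnj (d j) / k i j)) * (1 / cnj (d j))
         = (k i j - k i x * k x j / k x x) / k i j"
        using dnz by simp
      also have "\<dots> = 1 - k i x * k x j / (k i j * k x x)"
        using nz[OF ij] by (simp add: diff_divide_distrib mult.commute)
      finally show ?thesis
        unfolding \<phi>A[OF ij] \<open>1 - A i j = d i * cnj (d j) / k i j\<close> by simp
    qed
  qed
  finally show ?case unfolding T_def .
qed

lemma mccullough_quiggin:
  assumes "finite S" "S \<subseteq> X" shows "psd_on S (\<lambda>i j. 1 - 1 / k i j)"
proof -
  have "psd_on S (\<lambda>i j. 1 - k i x0 * k x0 j / (k i j * k x0 x0)) = psd_on S (\<lambda>i j. 1 - 1 / k i j)"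
    using assms base_mem by (intro psd_on_cong) (auto simp: base_kernel base_kernel_left subset_iff)
  then show ?thesis
    using complement_psd[OF assms base_mem] by simp
qed

end

context rkhs
begin

section \<open>Functions as quotients of multipliers\<close>

lemma hlim_mult:
  assumes "mbound \<phi> C" "hlim s f"
  shows "hlim (\<lambda>n x. \<phi> x * s n x) (\<lambda>x. \<phi> x * f x)"
proof -
  have m: "s n \<in> H" "f \<in> H" for n using assms(2) by (auto simp: hlim_def)
  have lim: "(\<lambda>n. C * hnorm (\<lambda>x. s n x - f x)) \<longlonglongrightarrow> C * 0"
    using assms(2) by (intro tendsto_mult tendsto_const) (simp add: hlim_def)
  have "hnorm (\<lambda>x. \<phi> x * s n x - \<phi> x * f x) \<le> C * hnorm (\<lambda>x. s n x - f x)" for n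
    using mbound_le[OF assms(1) diff_mem[OF m]] by (simp add: right_diff_distrib)
  moreover have "0 \<le> hnorm (\<lambda>x. \<phi> x * s n x - \<phi> x * f x)" for n
    using m assms(1) by (intro hnorm_nonneg diff_mem Mult_mem) (auto intro: mbound_Mult)
  ultimately have "\<forall>\<^sub>F n in sequentially. norm (hnorm (\<lambda>x. \<phi> x * s n x - \<phi> x * f x)) \<le> C * hnorm (\<lambda>x. s n x - f x)"
    by simp
  then have "(\<lambda>n. hnorm (\<lambda>x. \<phi> x * s n x - \<phi> x * f x)) \<longlonglongrightarrow> 0"
    by (rule Lim_null_comparison) (use lim in simp)
  then show ?thesis
    using m assms(1) by (auto simp: hlim_def intro: Mult_mem mbound_Mult)
qed

end

context normalized_pick_space
begin

text \<open>
  The kernel \<open>1 - 1 / k\<close>, with the second argument fixed.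
\<close>

definition defect :: "'a \<Rightarrow> 'a \<Rightarrow> complex" where
  "defect z = (\<lambda>x. if x \<in> X then 1 - 1 / k x z else 0)"

text \<open>
  The functions \<open>defect z\<close> form a row contraction from the tensor product of \<open>H\<close> with the Hilbert space
  of the kernel \<open>1 - 1 / k\<close>.  This is proved through the membership criterion: factoring \<open>1 - 1 / k\<close> on
  the finitely many points involved writes the pairing of the row with a combination of kernel
  functions as \<open>\<Sum> \<langle>V l, K l\<rangle>\<close>, where \<open>\<Sum> \<parallel>V l\<parallel>\<^sup>2 = R\<close> and, since \<open>k * (1 - 1 / k) = k - 1\<close>, the norms
  of the \<open>K l\<close> are controlled by the norm of that combination.
\<close>

lemma defect_row:
  assumes S: "finite S" "S \<subseteq> X" and v: "\<And>z. z \<in> S \<Longrightarrow> v z \<in> H"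
  defines "R \<equiv> Re (\<Sum>i\<in>S. \<Sum>j\<in>S. (1 - 1 / k i j) * ip (v j) (v i))"
  shows "(\<lambda>x. \<Sum>z\<in>S. defect z x * v z x) \<in> H"
    and "(hnorm (\<lambda>x. \<Sum>z\<in>S. defect z x * v z x))\<^sup>2 \<le> R"
proof -
  define w where "w = (\<lambda>x. \<Sum>z\<in>S. defect z x * v z x)"
  have R0: "0 \<le> R"
  proof -
    have "psd_on S (\<lambda>i j. (1 - 1 / k i j) * ip (v j) (v i))"
      by (intro schur_product mccullough_quiggin S v)
    from psd_on_nonneg[OF this, of "\<lambda>_. 1"] show ?thesis
      by (simp add: R_def)
  qed
  have bound: "cmod (\<Sum>i\<in>T. cnj (c i) * w i) \<le> sqrt R * hnorm (kcomb T c)"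
    if T: "finite T" "T \<subseteq> X" for T c
  proof -
    define U where "U = S \<union> T"
    have U: "finite U" "U \<subseteq> X" using S T by (auto simp: U_def)
    obtain \<gamma> where \<gamma>: "\<And>i j. i \<in> U \<Longrightarrow> j \<in> U \<Longrightarrow> 1 - 1 / k i j = (\<Sum>l\<in>U. \<gamma> l i * cnj (\<gamma> l j))"
      using psd_on_factorization[OF U(1) mccullough_quiggin[OF U]] by blast
    define V where "V = (\<lambda>l. lincomb S (\<lambda>j. 1 * cnj (\<gamma> l j)) v)"
    define K where "K = (\<lambda>l. kcomb T (\<lambda>i. c i * cnj (\<gamma> l i)))"
    have VH: "V l \<in> H" and KH: "K l \<in> H" for l
      unfolding V_def K_def using v T by (auto intro: lincomb_mem kcomb_mem)
    have VK: "(\<Sum>l\<in>U. ip (V l) (K l)) = (\<Sum>i\<in>T. cnj (c i) * w i)"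
    proof -
      have "ip (V l) (K l) = (\<Sum>i\<in>T. \<Sum>j\<in>S. cnj (c i) * v j i * (\<gamma> l i * cnj (\<gamma> l j)))" for l
        unfolding K_def ip_kcomb[OF VH T(2)] unfolding V_def lincomb_def
        by (simp add: sum_distrib_left algebra_simps)
      then have "(\<Sum>l\<in>U. ip (V l) (K l)) = (\<Sum>l\<in>U. \<Sum>i\<in>T. \<Sum>j\<in>S. cnj (c i) * v j i * (\<gamma> l i * cnj (\<gamma> l j)))"
        by (simp only:)
      also have "\<dots> = (\<Sum>i\<in>T. \<Sum>l\<in>U. \<Sum>j\<in>S. cnj (c i) * v j i * (\<gamma> l i * cnj (\<gamma> l j)))"
        by (rule sum.swap)
      also have "\<dots> = (\<Sum>i\<in>T. \<Sum>j\<in>S. \<Sum>l\<in>U. cnj (c i) * v j i * (\<gamma> l i * cnj (\<gamma> l j)))"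
        by (intro sum.cong refl sum.swap)
      also have "\<dots> = (\<Sum>i\<in>T. cnj (c i) * w i)"
      proof (intro sum.cong refl)
        fix i assume i: "i \<in> T"
        have "(\<Sum>j\<in>S. \<Sum>l\<in>U. cnj (c i) * v j i * (\<gamma> l i * cnj (\<gamma> l j))) =
           (\<Sum>j\<in>S. cnj (c i) * v j i * (1 - 1 / k i j))"
          using i by (intro sum.cong refl) (simp add: \<gamma> U_def flip: sum_distrib_left)
        then show "(\<Sum>j\<in>S. \<Sum>l\<in>U. cnj (c i) * v j i * (\<gamma> l i * cnj (\<gamma> l j))) = cnj (c i) * w i"
          using i T by (auto simp: w_def defect_def sum_distrib_left algebra_simps)
      qed
      finally show ?thesis .
    qed
    have "complex_of_real (\<Sum>l\<in>U. (hnorm (V l))\<^sup>2) =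
        (\<Sum>i\<in>S. \<Sum>j\<in>S. cnj 1 * 1 * ((1 - 1 / k i j) * ip (v j) (v i)))"
      unfolding V_def by (intro factored_gram v \<gamma>) (auto simp: U_def)
    then have VR: "(\<Sum>l\<in>U. (hnorm (V l))\<^sup>2) = R"
      unfolding R_def by (metis (no_types, lifting) Re_complex_of_real complex_cnj_one mult_1 sum.cong)
    have KR: "(\<Sum>l\<in>U. (hnorm (K l))\<^sup>2) \<le> (hnorm (kcomb T c))\<^sup>2"
    proof -
      have "complex_of_real (\<Sum>l\<in>U. (hnorm (K l))\<^sup>2) =
          (qform T c (\<lambda>i j. (1 - 1 / k i j) * ip (kf j) (kf i)))"
        unfolding K_def using T by (intro factored_gram kernel_mem \<gamma>) (auto simp: U_def)
      also have "\<dots> = (\<Sum>i\<in>T. \<Sum>j\<in>T. cnj (c i) * c j * k i j - cnj (c i) * c j * 1)"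
      proof (intro sum.cong refl)
        fix i j assume "i \<in> T" "j \<in> T"
        then have X: "i \<in> X" "j \<in> X" using T by auto
        show "cnj (c i) * c j * ((1 - 1 / k i j) * ip (kf j) (kf i)) = cnj (c i) * c j * k i j - cnj (c i) * c j * 1"
          unfolding kernel_eq_ip[OF X, symmetric] using kernel_nonzero[OF X] by (simp add: algebra_simps)
      qed
      finally have "(\<Sum>l\<in>U. (hnorm (K l))\<^sup>2) = Re (\<Sum>i\<in>T. \<Sum>j\<in>T. cnj (c i) * c j * k i j - cnj (c i) * c j * 1)"
        by (metis Re_complex_of_real)
      also have "\<dots> = (hnorm (kcomb T c))\<^sup>2 - Re (qform T c (\<lambda>i j. 1))"
        unfolding hnorm_kcomb_sq[OF T(2)] sum_subtractf by simp
      finally show ?thesis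
        using psd_on_nonneg[OF psd_on_ones, of c T] by linarith
    qed
    have "cmod (\<Sum>i\<in>T. cnj (c i) * w i) \<le> (\<Sum>l\<in>U. cmod (ip (V l) (K l)))"
      unfolding VK[symmetric] by (rule norm_sum)
    also have "\<dots> \<le> (\<Sum>l\<in>U. \<bar>hnorm (V l)\<bar> * \<bar>hnorm (K l)\<bar>)"
      using VH KH by (intro sum_mono) (simp add: cauchy_schwarz)
    also have "\<dots> \<le> L2_set (\<lambda>l. hnorm (V l)) U * L2_set (\<lambda>l. hnorm (K l)) U"
      by (rule L2_set_mult_ineq)
    also have "\<dots> \<le> sqrt R * sqrt ((hnorm (kcomb T c))\<^sup>2)"
      unfolding L2_set_def VR using KR R0 by (intro mult_left_mono real_sqrt_le_mono) auto
    finally show ?thesis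
      using T by (simp add: kcomb_mem)
  qed
  have van: "w x = 0" if "x \<notin> X" for x
    using that by (simp add: w_def defect_def)
  have "w \<in> H \<and> hnorm w \<le> \<bar>sqrt R\<bar>"
    by (rule mem_of_kernel_bound[OF van bound]) auto
  then show "(\<lambda>x. \<Sum>z\<in>S. defect z x * v z x) \<in> H"
    "(hnorm (\<lambda>x. \<Sum>z\<in>S. defect z x * v z x))\<^sup>2 \<le> R"
    using R0 power_mono[of "hnorm w" "sqrt R" 2] by (auto simp: w_def)
qed

text \<open>
  By \<open>defect_row\<close> for a single point, \<open>defect z\<close> is a multiplier of norm less than 1, and the kernel
  function is the inverse of \<open>1 - defect z\<close>.
\<close>

lemma kernel_Mult:
  assumes z: "z \<in> X" shows "kf z \<in> Mult"
proof -
  define q where "q = sqrt (1 - 1 / (hnorm (kf z))\<^sup>2)"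
  have "(\<lambda>x. defect z x * f x) \<in> H \<and> hnorm (\<lambda>x. defect z x * f x) \<le> q * hnorm f" if f: "f \<in> H" for f
  proof -
    have *: "(\<lambda>x. defect z x * f x) \<in> H"
      "(hnorm (\<lambda>x. defect z x * f x))\<^sup>2 \<le> Re ((1 - 1 / k z z) * ip f f)"
      using defect_row[of "{z}" "\<lambda>_. f"] z f by auto
    have "(1 - 1 / k z z) * ip f f = complex_of_real ((1 - 1 / (hnorm (kf z))\<^sup>2) * (hnorm f)\<^sup>2)"
      unfolding kernel_diag_norm[OF z] ip_self[OF f] by simp
    then have "Re ((1 - 1 / k z z) * ip f f) = (1 - 1 / (hnorm (kf z))\<^sup>2) * (hnorm f)\<^sup>2"
      by (simp only: Re_complex_of_real)
    then have "sqrt ((hnorm (\<lambda>x. defect z x * f x))\<^sup>2) \<le> sqrt ((1 - 1 / (hnorm (kf z))\<^sup>2) * (hnorm f)\<^sup>2)"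
      using *(2) by (intro real_sqrt_le_mono) simp
    then show ?thesis
      using *(1) f by (simp add: q_def real_sqrt_mult)
  qed
  then have mb: "mbound (defect z) q"
    by (auto simp: mbound_def Mult_def defect_def)
  have "q < 1"
    using hnorm_kernel_pos[OF z] by (simp add: q_def)
  have "(\<lambda>x. if x \<in> X then 1 / (1 - defect z x) else 0) = kf z"
    using kernel_nonzero[OF _ z] vanishes[OF kernel_mem[OF z]] by (auto simp: defect_def fun_eq_iff)
  then show ?thesis
    using mbound_Mult[OF mbound_inverse(1)[OF mb \<open>q < 1\<close>]] by simp
qed

lemma kspan_Mult: assumes "f \<in> kspan" shows "f \<in> Mult"
proof -
  obtain S c where S: "finite S" "S \<subseteq> X" "f = kcomb S c" using assms by (auto simp: kspan_def)
  have "kcomb S c \<in> Mult"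
    using S(1,2)
  proof (induction S)
    case empty
    have "(\<lambda>x. 0) \<in> Mult" using Mult_scale[OF unit_Mult, of 0] by simp
    then show ?case by (simp add: lincomb_def)
  next
    case (insert z S)
    have "kcomb (insert z S) c = (\<lambda>x. c z * k x z + kcomb S c x)"
      using insert by (simp add: lincomb_def)
    then show ?case
      using insert by (simp add: Mult_add Mult_scale kernel_Mult)
  qed
  then show ?thesis using S by simp
qed

lemma kernel_times_mem: "f \<in> H \<Longrightarrow> z \<in> X \<Longrightarrow> (\<lambda>x. k x z * f x) \<in> H"
  by (intro Mult_mem kernel_Mult)

text \<open>
  As \<open>defect j * v j = v j - f\<close>, this is the contractivity of the row \<open>defect_row\<close> on the vectors \<open>v j\<close>.
\<close>

lemma sarason_psd:
  assumes f: "f \<in> H" and S: "finite S" "S \<subseteq> X"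
  defines "v \<equiv> \<lambda>z x. k x z * f x"
  shows "psd_on S (\<lambda>i j. (1 - 1 / k i j) * ip (v j) (v i) - ip (\<lambda>x. v j x - f x) (\<lambda>x. v i x - f x))"
  unfolding psd_on_def
proof (intro conjI allI ballI)
  have vH: "v i \<in> H" if "i \<in> S" for i
    unfolding v_def using that f S by (intro kernel_times_mem) auto
  have wH: "(\<lambda>x. v i x - f x) \<in> H" if "i \<in> S" for i
    by (intro diff_mem vH that f)
  fix i j assume ij: "i \<in> S" "j \<in> S"
  have "k j i = cnj (k i j)" using ij S by (intro kernel_hermitian) auto
  moreover have "ip (v i) (v j) = cnj (ip (v j) (v i))"
    by (intro ip_cnj vH ij)
  moreover have "ip (\<lambda>x. v i x - f x) (\<lambda>x. v j x - f x) = cnj (ip (\<lambda>x. v j x - f x) (\<lambda>x. v i x - f x))"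
    by (intro ip_cnj wH ij)
  ultimately show "(1 - 1 / k j i) * ip (v i) (v j) - ip (\<lambda>x. v i x - f x) (\<lambda>x. v j x - f x) =
      cnj ((1 - 1 / k i j) * ip (v j) (v i) - ip (\<lambda>x. v j x - f x) (\<lambda>x. v i x - f x))"
    by simp
next
  fix a
  have vH: "v i \<in> H" if "i \<in> S" for i
    unfolding v_def using that f S by (intro kernel_times_mem) auto
  have wH: "(\<lambda>x. v i x - f x) \<in> H" if "i \<in> S" for i
    by (intro diff_mem vH that f)
  define W where "W = lincomb S a (\<lambda>j x. v j x - f x)"
  have WH: "W \<in> H" unfolding W_def by (intro lincomb_mem wH)
  have dv: "defect j x * (a j * v j x) = a j * (v j x - f x)" if "j \<in> S" for j x
  proof (cases "x \<in> X")
    case True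
    then have "k x j \<noteq> 0" using that S by (intro kernel_nonzero) auto
    then show ?thesis using True by (simp add: defect_def v_def algebra_simps)
  next
    case False
    then show ?thesis using vanishes[OF f False] by (simp add: defect_def v_def)
  qed
  have "(\<lambda>x. \<Sum>j\<in>S. defect j x * (a j * v j x)) = W"
    unfolding W_def lincomb_def by (intro ext sum.cong refl dv)
  then have le': "(hnorm W)\<^sup>2 \<le> Re (\<Sum>i\<in>S. \<Sum>j\<in>S. (1 - 1 / k i j) * ip (\<lambda>x. a j * v j x) (\<lambda>x. a i * v i x))"
    using defect_row(2)[OF S, of "\<lambda>j x. a j * v j x"] vH by (simp add: scale_mem)
  have "(\<Sum>i\<in>S. \<Sum>j\<in>S. (1 - 1 / k i j) * ip (\<lambda>x. a j * v j x) (\<lambda>x. a i * v i x)) =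
     (qform S a (\<lambda>i j. (1 - 1 / k i j) * ip (v j) (v i)))"
    by (intro sum.cong refl) (simp add: ip_scale ip_scale_right scale_mem vH)
  then have le: "(hnorm W)\<^sup>2 \<le> Re (qform S a (\<lambda>i j. (1 - 1 / k i j) * ip (v j) (v i)))"
    using le' by (simp only:)
  have "complex_of_real ((hnorm W)\<^sup>2) = qform S a (\<lambda>i j. ip (\<lambda>x. v j x - f x) (\<lambda>x. v i x - f x))"
    unfolding ip_self[OF WH, symmetric] unfolding W_def by (intro ip_lincomb_lincomb wH)
  then have "(hnorm W)\<^sup>2 = Re (qform S a (\<lambda>i j. ip (\<lambda>x. v j x - f x) (\<lambda>x. v i x - f x)))"
    by (metis Re_complex_of_real)
  then show "0 \<le> Re (\<Sum>i\<in>S. \<Sum>j\<in>S. cnj (a i) * a j *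
      ((1 - 1 / k i j) * ip (v j) (v i) - ip (\<lambda>x. v j x - f x) (\<lambda>x. v i x - f x)))"
    using le by (simp only: right_diff_distrib sum_subtractf minus_complex.simps)
qed

text \<open>
  Multiplying the matrix of \<open>sarason_psd\<close> entrywise by \<open>k\<close> cancels the denominators and leaves
  \<open>k i j * (\<langle>v j, f\<rangle> + \<langle>f, v i\<rangle> - \<langle>f, f\<rangle>) - \<langle>v j, v i\<rangle>\<close>, which is positive semidefinite by Schur's theorem.
  With \<open>V i = 2 * \<langle>f, k\<^sub>i f\<rangle> - \<parallel>f\<parallel>\<^sup>2\<close> and \<open>h = kcomb S c\<close>, the inequality reads \<open>\<parallel>f h\<parallel>\<^sup>2 \<le> Re \<langle>V h, h\<rangle>\<close>.
\<close>

lemma sarason_inequality: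
  assumes f: "f \<in> H" and S: "finite S" "S \<subseteq> X"
  shows "(hnorm (\<lambda>x. f x * kcomb S c x))\<^sup>2 + (hnorm f)\<^sup>2 * (hnorm (kcomb S c))\<^sup>2
     \<le> 2 * Re (\<Sum>i\<in>S. cnj (c i) * ip f (\<lambda>x. k x i * f x) * kcomb S c i)"
proof -
  define v where "v = (\<lambda>z x. k x z * f x)"
  define h where "h = kcomb S c"
  define Z where "Z = (\<Sum>i\<in>S. cnj (c i) * ip f (v i) * h i)"
  have vH: "v i \<in> H" if "i \<in> S" for i
    unfolding v_def using that f S by (intro kernel_times_mem) auto
  define A where "A = (\<lambda>i j. (1 - 1 / k i j) * ip (v j) (v i) - ip (\<lambda>x. v j x - f x) (\<lambda>x. v i x - f x))"
  have "psd_on S A"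
    unfolding A_def v_def by (rule sarason_psd[OF f S])
  then have "psd_on S (\<lambda>i j. A i j * ip (kf j) (kf i))"
    using S by (intro schur_product kernel_mem) auto
  then have pos: "0 \<le> Re (qform S c (\<lambda>i j. A i j * ip (kf j) (kf i)))"
    by (rule psd_on_nonneg)
  have Ak: "A i j * ip (kf j) (kf i) = k i j * ip (v j) f + k i j * ip f (v i) - k i j * ip f f - ip (v j) (v i)"
    if ij: "i \<in> S" "j \<in> S" for i j
  proof -
    have X: "i \<in> X" "j \<in> X" using ij S by auto
    have d: "ip (\<lambda>x. v j x - f x) (\<lambda>x. v i x - f x) = ip (v j) (v i) - ip (v j) f - (ip f (v i) - ip f f)"
      using vH ij f by (simp add: ip_diff ip_diff_right diff_mem)
    have "((1 - 1 / z) * V - (V - a - (b - e))) * z = z * a + z * b - z * e - V" if "z \<noteq> 0" for z V a b e :: complex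
      using that by (simp add: field_simps)
    then show ?thesis
      unfolding A_def d kernel_eq_ip[OF X, symmetric] using kernel_nonzero[OF X] by blast
  qed
  have t1: "qform S c (\<lambda>i j. k i j * ip f (v i)) = Z"
    by (simp add: Z_def h_def lincomb_def sum_distrib_left algebra_simps)
  have t2: "qform S c (\<lambda>i j. k i j * ip (v j) f) = cnj Z"
  proof -
    have "cnj Z = (\<Sum>i\<in>S. \<Sum>j\<in>S. cnj (cnj (c i) * c j * (k i j * ip f (v i))))"
      unfolding t1[symmetric] by simp
    also have "\<dots> = (\<Sum>i\<in>S. \<Sum>j\<in>S. cnj (c j) * c i * (k j i * ip (v i) f))"
    proof (intro sum.cong refl)
      fix i j assume ij: "i \<in> S" "j \<in> S"
      have "k j i = cnj (k i j)" using ij S by (intro kernel_hermitian) auto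
      moreover have "ip (v i) f = cnj (ip f (v i))" using ij by (intro ip_cnj vH f)
      ultimately show "cnj (cnj (c i) * c j * (k i j * ip f (v i))) = cnj (c j) * c i * (k j i * ip (v i) f)"
        by simp
    qed
    also have "\<dots> = qform S c (\<lambda>i j. k i j * ip (v j) f)"
      by (rule sum.swap)
    finally show ?thesis by simp
  qed
  have "(\<lambda>x. f x * h x) = lincomb S c v"
    by (simp add: h_def lincomb_def v_def sum_distrib_left algebra_simps)
  then have "complex_of_real ((hnorm (\<lambda>x. f x * h x))\<^sup>2) = ip (lincomb S c v) (lincomb S c v)"
    using ip_self[OF lincomb_mem[of S v c, OF vH]] by simp
  also have "\<dots> = qform S c (\<lambda>i j. ip (v j) (v i))"
    by (intro ip_lincomb_lincomb vH)
  finally have t3: "qform S c (\<lambda>i j. ip (v j) (v i)) = complex_of_real ((hnorm (\<lambda>x. f x * h x))\<^sup>2)" ..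
  have t4: "Re (qform S c (\<lambda>i j. k i j * ip f f)) = (hnorm f)\<^sup>2 * (hnorm h)\<^sup>2"
    unfolding ip_self[OF f] h_def hnorm_kcomb_sq[OF S(2)]
    by (simp add: sum_distrib_left algebra_simps)
  have "qform S c (\<lambda>i j. A i j * ip (kf j) (kf i)) =
      (qform S c (\<lambda>i j. k i j * ip (v j) f)) + qform S c (\<lambda>i j. k i j * ip f (v i))
      - qform S c (\<lambda>i j. k i j * ip f f) - qform S c (\<lambda>i j. ip (v j) (v i))"
    unfolding sum.distrib[symmetric] sum_subtractf[symmetric]
    by (intro sum.cong refl) (simp add: Ak right_diff_distrib distrib_left)
  then have "Re (qform S c (\<lambda>i j. A i j * ip (kf j) (kf i))) =
     2 * Re Z - (hnorm f)\<^sup>2 * (hnorm h)\<^sup>2 - (hnorm (\<lambda>x. f x * h x))\<^sup>2"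
    unfolding t1 t2 t3 by (simp only: minus_complex.simps plus_complex.simps t4 complex_cnj Re_complex_of_real cnj.simps)
  then show ?thesis
    using pos unfolding Z_def v_def h_def by simp
qed

end

context normalized_pick_space
begin

text \<open>
  This is \<open>(V + 1) / 2\<close> up to the summand \<open>(1 - \<parallel>f\<parallel>\<^sup>2) / 2\<close>, where \<open>V\<close> is the Sarason function
  \<open>V z = 2 * \<langle>f, k\<^sub>z f\<rangle> - \<parallel>f\<parallel>\<^sup>2\<close> of \<open>f\<close>.  The constant is chosen so that the value at the base point is 1
  for every \<open>f\<close>, without normalizing \<open>f\<close>.
\<close>

definition sarason :: "('a \<Rightarrow> complex) \<Rightarrow> 'a \<Rightarrow> complex" where
  "sarason f = (\<lambda>z. if z \<in> X then ip f (\<lambda>x. k x z * f x) + complex_of_real (1 - (hnorm f)\<^sup>2) else 0)"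

text \<open>
  Writing \<open>u = sarason f\<close>, this is \<open>\<parallel>f h\<parallel>\<^sup>2 + \<parallel>h\<parallel>\<^sup>2 \<le> 2 Re \<langle>u h, h\<rangle>\<close>.  It implies that \<open>Re u\<close> is bounded
  below, that \<open>\<parallel>(u - 1) h\<parallel> \<le> \<parallel>u h\<parallel>\<close> and that \<open>\<parallel>f h\<parallel> \<le> \<parallel>u h\<parallel>\<close>, so \<open>1 - 1 / u\<close> and \<open>f / u\<close> should be
  contractive multipliers.
\<close>

lemma sarason_kcomb:
  assumes f: "f \<in> H" "hnorm f \<le> 1" and S: "finite S" "S \<subseteq> X"
  shows "(hnorm (\<lambda>x. f x * kcomb S c x))\<^sup>2 + (hnorm (kcomb S c))\<^sup>2
     \<le> 2 * Re (\<Sum>i\<in>S. cnj (c i) * (sarason f i * kcomb S c i))"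
proof -
  define h where "h = kcomb S c"
  have hH: "h \<in> H" unfolding h_def by (rule kcomb_mem[OF S(2)])
  \<comment> \<open>The additional constant in \<open>sarason f\<close> raises the right-hand side by \<open>2 t \<parallel>h\<parallel>\<^sup>2\<close>, while replacing
    \<open>\<parallel>f\<parallel>\<^sup>2 \<parallel>h\<parallel>\<^sup>2\<close> by \<open>\<parallel>h\<parallel>\<^sup>2\<close> costs only \<open>t \<parallel>h\<parallel>\<^sup>2\<close> on the left.\<close>
  define t where "t = 1 - (hnorm f)\<^sup>2"
  have t: "0 \<le> t" using f hnorm_nonneg[OF f(1)] by (simp add: t_def power_le_one)
  have hh: "(\<Sum>i\<in>S. cnj (c i) * h i) = complex_of_real ((hnorm h)\<^sup>2)"
    using ip_kcomb[OF hH S(2), of c] ip_self[OF hH] by (simp add: h_def)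
  have "(\<Sum>i\<in>S. cnj (c i) * (sarason f i * h i)) =
      (\<Sum>i\<in>S. cnj (c i) * ip f (\<lambda>x. k x i * f x) * h i) + complex_of_real t * (\<Sum>i\<in>S. cnj (c i) * h i)"
    unfolding sum_distrib_left sum.distrib[symmetric]
    using S by (intro sum.cong refl) (auto simp: sarason_def t_def algebra_simps subset_iff)
  then have "2 * Re (\<Sum>i\<in>S. cnj (c i) * (sarason f i * h i)) =
      2 * Re (\<Sum>i\<in>S. cnj (c i) * ip f (\<lambda>x. k x i * f x) * h i) + 2 * (t * (hnorm h)\<^sup>2)"
    unfolding hh by simp
  moreover have "(hnorm (\<lambda>x. f x * h x))\<^sup>2 + (hnorm f)\<^sup>2 * (hnorm h)\<^sup>2
     \<le> 2 * Re (\<Sum>i\<in>S. cnj (c i) * ip f (\<lambda>x. k x i * f x) * h i)"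
    unfolding h_def by (rule sarason_inequality[OF f(1) S])
  moreover have "0 \<le> t * (hnorm h)\<^sup>2" using t by simp
  moreover have "(hnorm f)\<^sup>2 * (hnorm h)\<^sup>2 = (hnorm h)\<^sup>2 - t * (hnorm h)\<^sup>2"
    by (simp add: t_def algebra_simps)
  ultimately show ?thesis
    unfolding h_def by linarith
qed

lemma sarason_Re_pos:
  assumes f: "f \<in> H" "hnorm f \<le> 1" and x: "x \<in> X"
  shows "1 / 2 \<le> Re (sarason f x)"
proof -
  have kx: "kcomb {x} (\<lambda>_. 1) = kf x" by (simp add: lincomb_def)
  have "(hnorm (\<lambda>z. f z * k z x))\<^sup>2 + (hnorm (kf x))\<^sup>2 \<le> 2 * Re (sarason f x * k x x)"
    using sarason_kcomb[OF f, of "{x}" "\<lambda>_. 1"] x unfolding kx by simp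
  then have "(hnorm (kf x))\<^sup>2 \<le> 2 * Re (sarason f x * k x x)"
    using zero_le_power2[of "hnorm (\<lambda>z. f z * k z x)"] by linarith
  then have "(hnorm (kf x))\<^sup>2 \<le> 2 * Re (sarason f x) * (hnorm (kf x))\<^sup>2"
    unfolding kernel_diag_norm[OF x] by simp
  moreover have "0 < (hnorm (kf x))\<^sup>2"
    using hnorm_kernel_pos[OF x] by simp
  ultimately have "1 \<le> 2 * Re (sarason f x)"
    by (simp add: mult_le_cancel_right1)
  then show ?thesis by simp
qed

lemma sarason_nonzero:
  assumes "f \<in> H" "hnorm f \<le> 1" "x \<in> X" shows "sarason f x \<noteq> 0"
  using sarason_Re_pos[OF assms] by auto

text \<open>
  The Cayley transform \<open>(w - 1) / (w + 1)\<close> of \<open>w = 2 * sarason f - 1\<close>.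
\<close>

definition cayley :: "('a \<Rightarrow> complex) \<Rightarrow> 'a \<Rightarrow> complex" where
  "cayley f = (\<lambda>x. if x \<in> X then 1 - 1 / sarason f x else 0)"

text \<open>
  On the dual side: writing the coefficients as \<open>c = d * cnj u\<close> with \<open>u = sarason f\<close>, the claim becomes
  \<open>\<parallel>kcomb S c - kcomb S d\<parallel> \<le> \<parallel>kcomb S c\<parallel>\<close>, which is \<open>sarason_kcomb\<close> for \<open>d\<close>.
\<close>

lemma cayley_contractive:
  assumes f: "f \<in> H" "hnorm f \<le> 1"
  shows "mbound (cayley f) 1"
proof (rule mboundI_dual)
  fix S and c :: "'a \<Rightarrow> complex" assume S: "finite S" "S \<subseteq> X"
  define d where "d = (\<lambda>i. c i / cnj (sarason f i))"
  have m: "kcomb S c \<in> H" "kcomb S d \<in> H"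
    using S by (auto intro: kcomb_mem)
  have "kcomb S (\<lambda>i. c i * cnj (cayley f i)) = kcomb S (\<lambda>i. c i - d i)"
    unfolding lincomb_def using S
    by (intro ext sum.cong) (auto simp: cayley_def d_def right_diff_distrib)
  then have e: "kcomb S (\<lambda>i. c i * cnj (cayley f i)) = (\<lambda>x. kcomb S c x - kcomb S d x)"
    by (simp add: lincomb_diff)
  have "ip (kcomb S d) (kcomb S c) = (\<Sum>i\<in>S. cnj (c i) * kcomb S d i)"
    by (rule ip_kcomb[OF m(2) S(2)])
  also have "\<dots> = (\<Sum>i\<in>S. cnj (d i) * (sarason f i * kcomb S d i))"
    using S sarason_nonzero[OF f] by (intro sum.cong refl) (auto simp: d_def)
  finally have i: "ip (kcomb S d) (kcomb S c) = (\<Sum>i\<in>S. cnj (d i) * (sarason f i * kcomb S d i))" .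
  have "(hnorm (kcomb S d))\<^sup>2 \<le> 2 * Re (ip (kcomb S d) (kcomb S c))"
    unfolding i using sarason_kcomb[OF f S, of d] zero_le_power2[of "hnorm (\<lambda>x. f x * kcomb S d x)"] by linarith
  then have "(hnorm (\<lambda>x. kcomb S d x - kcomb S c x))\<^sup>2 \<le> (hnorm (kcomb S c))\<^sup>2"
    unfolding hnorm_diff_sq[OF m(2,1)] by simp
  then have "hnorm (\<lambda>x. kcomb S d x - kcomb S c x) \<le> hnorm (kcomb S c)"
    using m by (auto intro: power2_le_imp_le)
  then show "hnorm (kcomb S (\<lambda>i. c i * cnj (cayley f i))) \<le> 1 * hnorm (kcomb S c)"
    unfolding e hnorm_diff_commute[OF m] by simp
qed (auto simp: cayley_def)

lemma cayley_base:
  assumes "f \<in> H" shows "cayley f x0 = 0"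
proof -
  have "(\<lambda>x. k x x0 * f x) = f"
    using base_kernel vanishes[OF assms] by (auto simp: fun_eq_iff)
  then have "sarason f x0 = 1"
    using base_mem by (simp add: sarason_def ip_self[OF assms])
  then show ?thesis by (simp add: cayley_def)
qed

text \<open>
  If \<open>f\<close> is a finite combination of kernel functions, then both \<open>f\<close> and \<open>sarason f\<close> are multipliers, and
  \<open>sarason_kcomb\<close> extends by density to all of \<open>H\<close>.  Applied to \<open>p = q / sarason f\<close> it gives
  \<open>\<parallel>(f / sarason f) q\<parallel> \<le> \<parallel>q\<parallel>\<close>.
\<close>

lemma cayley_numerator_kspan:
  assumes f: "f \<in> kspan" "hnorm f \<le> 1"
  shows "mbound (\<lambda>x. (unit x - cayley f x) * f x) 1"
proof -
  obtain S c where S: "finite S" "S \<subseteq> X" "f = kcomb S c" using f(1) by (auto simp: kspan_def)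
  have fH: "f \<in> H" and fM: "f \<in> Mult" using f(1) by (auto intro: kspan_subset kspan_Mult)
  have uM: "sarason f \<in> Mult"
  proof -
    have "ip f (\<lambda>x. k x z * f x) = kcomb S (\<lambda>l. c l * cnj (f l)) z" if z: "z \<in> X" for z
    proof -
      have kfH: "(\<lambda>x. k x z * f x) \<in> H" by (rule kernel_times_mem[OF fH z])
      have "ip (\<lambda>x. k x z * f x) f = (\<Sum>l\<in>S. cnj (c l) * (k l z * f l))"
        using ip_kcomb[OF kfH S(2)] S(3) by simp
      then have "ip f (\<lambda>x. k x z * f x) = (\<Sum>l\<in>S. c l * (cnj (k l z) * cnj (f l)))"
        using ip_cnj[OF kfH fH] by simp
      also have "\<dots> = kcomb S (\<lambda>l. c l * cnj (f l)) z"
        unfolding lincomb_def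
      proof (intro sum.cong refl)
        fix l assume "l \<in> S"
        then have "k z l = cnj (k l z)" using S z by (intro kernel_hermitian) auto
        then show "c l * (cnj (k l z) * cnj (f l)) = c l * cnj (f l) * k z l" by simp
      qed
      finally show ?thesis .
    qed
    moreover have "kcomb S (\<lambda>l. c l * cnj (f l)) z = 0" if "z \<notin> X" for z
      using vanishes[OF kcomb_mem[OF S(2)] that] .
    ultimately have "sarason f = (\<lambda>z. kcomb S (\<lambda>l. c l * cnj (f l)) z + complex_of_real (1 - (hnorm f)\<^sup>2) * unit z)"
      by (auto simp: sarason_def unit_def fun_eq_iff)
    moreover have "kcomb S (\<lambda>l. c l * cnj (f l)) \<in> Mult"
      using S by (intro kspan_Mult) (auto simp: kspan_def)
    ultimately show ?thesis
      by (simp add: Mult_add Mult_scale unit_Mult)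
  qed
  obtain C where C: "mbound f C" using Mult_bounded[OF fM] by blast
  obtain D where D: "mbound (sarason f) D" using Mult_bounded[OF uM] by blast
  have ineq: "(hnorm (\<lambda>x. f x * p x))\<^sup>2 + (hnorm p)\<^sup>2 \<le> 2 * Re (ip (\<lambda>x. sarason f x * p x) p)" if p: "p \<in> H" for p
  proof -
    obtain s where s: "hlim s p" "\<And>n. s n \<in> kspan" using kspan_dense[OF p] by blast
    have le: "(hnorm (\<lambda>x. f x * s n x))\<^sup>2 + (hnorm (s n))\<^sup>2 \<le> 2 * Re (ip (\<lambda>x. sarason f x * s n x) (s n))" for n
    proof -
      obtain T d where T: "finite T" "T \<subseteq> X" "s n = kcomb T d" using s(2)[of n] by (auto simp: kspan_def)
      have "ip (\<lambda>x. sarason f x * s n x) (kcomb T d) = (\<Sum>i\<in>T. cnj (d i) * (sarason f i * s n i))"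
        using T(2) kspan_subset[OF s(2)] by (intro ip_kcomb Mult_mem uM)
      then show ?thesis
        using sarason_kcomb[OF fH f(2) T(1,2), of d] T(3) by simp
    qed
    have "(\<lambda>n. (hnorm (\<lambda>x. f x * s n x))\<^sup>2 + (hnorm (s n))\<^sup>2) \<longlonglongrightarrow> (hnorm (\<lambda>x. f x * p x))\<^sup>2 + (hnorm p)\<^sup>2"
      by (intro tendsto_add tendsto_power hlim_norm hlim_mult[OF C] s(1))
    moreover have "(\<lambda>n. 2 * Re (ip (\<lambda>x. sarason f x * s n x) (s n))) \<longlonglongrightarrow> 2 * Re (ip (\<lambda>x. sarason f x * p x) p)"
      by (intro tendsto_mult tendsto_const tendsto_Re hlim_ip hlim_mult[OF D] s(1))
    ultimately show ?thesis
      by (rule LIMSEQ_le) (use le in blast)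
  qed
  have cM: "cayley f \<in> Mult" using cayley_contractive[OF fH f(2)] by (rule mbound_Mult)
  have tM: "(\<lambda>x. (unit x - cayley f x) * f x) \<in> Mult"
    by (intro Mult_times Mult_diff unit_Mult cM fM)
  have "hnorm (\<lambda>x. (unit x - cayley f x) * f x * q x) \<le> 1 * hnorm q" if q: "q \<in> H" for q
  proof -
    define p where "p = (\<lambda>x. (unit x - cayley f x) * q x)"
    have pH: "p \<in> H" unfolding p_def by (intro Mult_mem Mult_diff unit_Mult cM q)
    have up: "(\<lambda>x. sarason f x * p x) = q"
      using sarason_nonzero[OF fH f(2)] vanishes[OF q]
      by (auto simp: p_def fun_eq_iff unit_def cayley_def)
    have "(hnorm (\<lambda>x. f x * p x))\<^sup>2 + (hnorm p)\<^sup>2 \<le> 2 * Re (ip q p)"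
      using ineq[OF pH] unfolding up .
    moreover have "0 \<le> (hnorm (\<lambda>x. q x - p x))\<^sup>2" by simp
    ultimately have "(hnorm (\<lambda>x. f x * p x))\<^sup>2 \<le> (hnorm q)\<^sup>2"
      unfolding hnorm_diff_sq[OF q pH] by linarith
    then have "hnorm (\<lambda>x. f x * p x) \<le> hnorm q"
      using q by (auto intro: power2_le_imp_le)
    then show ?thesis
      by (simp add: p_def algebra_simps)
  qed
  then show ?thesis
    using tM by (simp add: mbound_def)
qed

lemma sarason_tendsto:
  assumes "hlim s f" "x \<in> X" shows "(\<lambda>n. sarason (s n) x) \<longlonglongrightarrow> sarason f x"
proof -
  obtain C where C: "mbound (kf x) C" using Mult_bounded[OF kernel_Mult[OF assms(2)]] by blast
  have "(\<lambda>n. ip (s n) (\<lambda>z. k z x * s n z) + complex_of_real (1 - (hnorm (s n))\<^sup>2)) \<longlonglongrightarrow>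
      ip f (\<lambda>z. k z x * f z) + complex_of_real (1 - (hnorm f)\<^sup>2)"
    by (intro tendsto_add tendsto_of_real tendsto_diff tendsto_const tendsto_power hlim_norm hlim_ip hlim_mult[OF C] assms)
  then show ?thesis
    using assms(2) by (simp add: sarason_def)
qed

text \<open>
  Approximating \<open>f\<close> by finite combinations of kernel functions, everything converges pointwise.  The
  strict bound keeps the approximants in the unit ball.
\<close>

lemma cayley_numerator:
  assumes f: "f \<in> H" "hnorm f < 1"
  shows "mbound (\<lambda>x. (unit x - cayley f x) * f x) 1"
proof -
  obtain s where s: "hlim s f" "\<And>n. s n \<in> kspan" using kspan_dense[OF f(1)] by blast
  have "\<forall>\<^sub>F n in sequentially. hnorm (s n) < 1"
    using order_tendstoD(2)[OF hlim_norm[OF s(1)] f(2)] .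
  then obtain N where N: "\<And>n. n \<ge> N \<Longrightarrow> hnorm (s n) < 1"
    by (auto simp: eventually_sequentially)
  define t where "t = (\<lambda>n. s (n + N))"
  have t: "t n \<in> kspan" "hnorm (t n) \<le> 1" for n
    using s(2) N[of "n + N"] by (auto simp: t_def)
  have "(\<lambda>n. hnorm (\<lambda>x. s n x - f x)) \<longlonglongrightarrow> 0"
    using s(1) by (simp add: hlim_def)
  then have tl: "hlim t f"
    using s(1) LIMSEQ_ignore_initial_segment[of "\<lambda>n. hnorm (\<lambda>x. s n x - f x)" 0 N]
    by (auto simp: hlim_def t_def)
  show ?thesis
  proof (rule mbound_limit)
    show "mbound (\<lambda>x. (unit x - cayley (t n) x) * t n x) 1" for n
      by (rule cayley_numerator_kspan[OF t])
    fix x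
    show "(\<lambda>n. (unit x - cayley (t n) x) * t n x) \<longlonglongrightarrow> (unit x - cayley f x) * f x" if x: "x \<in> X"
    proof -
      have "sarason f x \<noteq> 0" using f x by (intro sarason_nonzero) auto
      then have "(\<lambda>n. 1 - 1 / sarason (t n) x) \<longlonglongrightarrow> 1 - 1 / sarason f x"
        by (intro tendsto_diff tendsto_const tendsto_divide sarason_tendsto tl x)
      then have "(\<lambda>n. cayley (t n) x) \<longlonglongrightarrow> cayley f x"
        using x by (simp add: cayley_def)
      then show ?thesis
        by (intro tendsto_mult tendsto_diff tendsto_const hlim_pointwise[OF tl x])
    qed
    show "(unit x - cayley f x) * f x = 0" if "x \<notin> X"
      using vanishes[OF f(1) that] by simp
  qed simp
qed

text \<open>
  The factor 2 comes from rescaling \<open>f\<close> to norm \<open>1 / 2\<close>.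
\<close>

lemma smirnov_factorization:
  assumes f: "f \<in> H"
  obtains \<psi> \<theta> where "mbound \<psi> 1" "\<psi> x0 = 0" "\<And>x. x \<in> X \<Longrightarrow> \<psi> x \<noteq> 1"
    "mbound \<theta> (2 * hnorm f)" "(\<lambda>x. (unit x - \<psi> x) * f x) = \<theta>"
proof -
  define t where "t = 2 * hnorm f"
  define g where "g = (\<lambda>x. complex_of_real (1 / t) * f x)"
  have t0: "0 \<le> t" using f by (simp add: t_def)
  have gH: "g \<in> H" unfolding g_def by (intro scale_mem f)
  have g1: "hnorm g < 1"
    unfolding g_def hnorm_scale[OF f] using t0 by (cases "hnorm f = 0") (simp_all add: t_def norm_divide)
  have fg: "f x = complex_of_real t * g x" for x
    using hnorm_eq_0[OF f] by (cases "t = 0") (auto simp: g_def t_def)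
  have "mbound (\<lambda>x. complex_of_real t * ((unit x - cayley g x) * g x)) (cmod (complex_of_real t) * 1)"
    by (intro mbound_scale cayley_numerator gH g1)
  then have "mbound (\<lambda>x. (unit x - cayley g x) * f x) (2 * hnorm f)"
    using t0 by (simp add: fg t_def algebra_simps)
  moreover have "cayley g x \<noteq> 1" if "x \<in> X" for x
    using sarason_nonzero[OF gH _ that] g1 that by (simp add: cayley_def)
  ultimately show thesis
    using that[of "cayley g"] cayley_contractive[OF gH] g1 cayley_base[OF gH] by simp
qed

end

context rkhs
begin

section \<open>The weak-* topology on the multiplier algebra\<close>

lemma mult_op_le:
  assumes "mbound \<phi> C" "0 \<le> C" "f \<in> {v \<in> H. hnorm v \<le> 1}"
  shows "hnorm (mult_op \<phi> f) \<le> C"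
proof -
  have f: "f \<in> H" "hnorm f \<le> 1" using assms(3) by auto
  have "hnorm (\<lambda>x. \<phi> x * f x) \<le> C * hnorm f" by (rule mbound_le[OF assms(1) f(1)])
  also have "\<dots> \<le> C" using f assms(2) mult_left_mono[of "hnorm f" 1 C] by simp
  finally show ?thesis using f by (simp add: mult_op_def)
qed

lemma mult_norm_le:
  assumes "mbound \<phi> C" "0 \<le> C" shows "mult_norm \<phi> \<le> C"
  unfolding mult_norm_def op_norm_def
proof (rule cSUP_least)
  show "{v \<in> H. hnorm v \<le> 1} \<noteq> {}" using zero_mem by (auto intro!: exI[of _ "\<lambda>x. 0"])
qed (rule mult_op_le[OF assms])

lemma mbound_mult_norm:
  assumes "\<phi> \<in> Mult" shows "mbound \<phi> (mult_norm \<phi>)"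
proof -
  obtain C where C: "0 \<le> C" "mbound \<phi> C" using Mult_bounded[OF assms] by blast
  have bdd: "bdd_above ((\<lambda>f. hnorm (mult_op \<phi> f)) ` {v \<in> H. hnorm v \<le> 1})"
    by (rule bdd_aboveI2[OF mult_op_le[OF C(2,1)]])
  have "hnorm (\<lambda>x. \<phi> x * f x) \<le> mult_norm \<phi> * hnorm f" if f: "f \<in> H" for f
  proof (cases "hnorm f = 0")
    case True
    then have "f = (\<lambda>x. 0)" using hnorm_eq_0[OF f] by simp
    then show ?thesis by simp
  next
    case False
    then have pos: "0 < hnorm f" using hnorm_nonneg[OF f] by linarith
    define c where "c = complex_of_real (1 / hnorm f)"
    have cn: "cmod c = 1 / hnorm f" using pos by (simp add: c_def norm_divide)
    have "hnorm (mult_op \<phi> (\<lambda>x. c * f x)) \<le> mult_norm \<phi>"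
      unfolding mult_norm_def op_norm_def using f pos
      by (intro cSUP_upper[OF _ bdd]) (simp add: scale_mem hnorm_scale cn)
    moreover have "mult_op \<phi> (\<lambda>x. c * f x) = (\<lambda>x. c * (\<phi> x * f x))"
      using f by (simp add: mult_op_def scale_mem algebra_simps)
    ultimately have "(1 / hnorm f) * hnorm (\<lambda>x. \<phi> x * f x) \<le> mult_norm \<phi>"
      using hnorm_scale[OF Mult_mem[OF assms f], of c] cn by simp
    then show ?thesis using pos by (simp add: field_simps)
  qed
  then show ?thesis using assms by (simp add: mbound_def)
qed

lemma mult_norm_le_1_iff: "\<phi> \<in> Mult \<and> mult_norm \<phi> \<le> 1 \<longleftrightarrow> mbound \<phi> 1"
  using mult_norm_le[of \<phi> 1] mbound_mult_norm[of \<phi>] mbound_Mult[of \<phi> 1] mbound_mono[of \<phi> "mult_norm \<phi>" 1]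
  by auto

text \<open>
  Pointwise convergence is convergence against kernel functions.  These span a dense subspace, and the
  norm bound carries the convergence over to its closure.
\<close>

lemma weak_convergence:
  assumes w: "\<And>n. w n \<in> H" "\<And>n. hnorm (w n) \<le> B" and v: "v \<in> H"
    and lim: "\<And>x. x \<in> X \<Longrightarrow> (\<lambda>n. w n x) \<longlonglongrightarrow> v x" and g: "g \<in> H"
  shows "(\<lambda>n. ip (w n) g) \<longlonglongrightarrow> ip v g"
proof (rule LIMSEQ_I)
  fix e :: real assume e: "0 < e"
  have B0: "0 \<le> B" using order_trans[OF hnorm_nonneg[OF w(1)] w(2)] .
  obtain s where s: "hlim s g" "\<And>n. s n \<in> kspan" using kspan_dense[OF g] by blast
  define d where "d = e / (2 * (B + hnorm v + 1))"
  have pos: "0 < B + hnorm v + 1" using B0 hnorm_nonneg[OF v] by linarith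
  have "0 < d" using e pos by (simp add: d_def)
  have "(\<lambda>n. hnorm (\<lambda>x. s n x - g x)) \<longlonglongrightarrow> 0" using s(1) by (simp add: hlim_def)
  then have "\<forall>\<^sub>F n in sequentially. hnorm (\<lambda>x. s n x - g x) < d"
    using \<open>0 < d\<close> by (rule order_tendstoD(2))
  then obtain m where m: "hnorm (\<lambda>x. s m x - g x) < d"
    by (auto simp: eventually_sequentially)
  define h where "h = s m"
  have hH: "h \<in> H" using s(2) kspan_subset by (simp add: h_def)
  obtain S c where S: "finite S" "S \<subseteq> X" "h = kcomb S c" using s(2)[of m] by (auto simp: kspan_def h_def)
  have "(\<lambda>n. \<Sum>i\<in>S. cnj (c i) * w n i) \<longlonglongrightarrow> (\<Sum>i\<in>S. cnj (c i) * v i)"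
    using S by (intro tendsto_intros lim) auto
  then have "(\<lambda>n. ip (w n) h) \<longlonglongrightarrow> ip v h"
    unfolding S(3) ip_kcomb[OF w(1) S(2)] ip_kcomb[OF v S(2)] .
  then obtain N where N: "\<And>n. n \<ge> N \<Longrightarrow> cmod (ip (w n) h - ip v h) < e / 2"
    using LIMSEQ_D[of _ _ "e / 2"] e by (metis half_gt_zero)
  have "cmod (ip (w n) g - ip v g) < e" if n: "n \<ge> N" for n
  proof -
    define r where "r = (\<lambda>x. h x - g x)"
    have rH: "r \<in> H" and rd: "hnorm r < d" unfolding r_def using hH g m by (auto simp: h_def intro: diff_mem)
    have "ip (w n) r = ip (w n) h - ip (w n) g" "ip v r = ip v h - ip v g"
      unfolding r_def using w v g hH by (simp_all add: ip_diff_right)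
    then have "ip (w n) g - ip v g = (ip (w n) h - ip v h) - ip (w n) r + ip v r" by simp
    then have "cmod (ip (w n) g - ip v g) \<le> cmod (ip (w n) h - ip v h) + cmod (ip (w n) r) + cmod (ip v r)"
      using norm_triangle_ineq[of "(ip (w n) h - ip v h) - ip (w n) r" "ip v r"]
        norm_triangle_ineq4[of "ip (w n) h - ip v h" "ip (w n) r"] by simp
    moreover have "cmod (ip (w n) r) \<le> B * d"
    proof -
      have "cmod (ip (w n) r) \<le> hnorm (w n) * hnorm r" by (rule cauchy_schwarz[OF w(1) rH])
      also have "\<dots> \<le> B * d" using w rd B0 rH by (intro mult_mono) auto
      finally show ?thesis .
    qed
    moreover have "cmod (ip v r) \<le> hnorm v * d"
    proof -
      have "cmod (ip v r) \<le> hnorm v * hnorm r" by (rule cauchy_schwarz[OF v rH])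
      also have "\<dots> \<le> hnorm v * d" using rd v by (intro mult_left_mono) auto
      finally show ?thesis .
    qed
    moreover have "B * d + hnorm v * d < e / 2"
    proof -
      have "d * (B + hnorm v + 1) = e / 2" using pos by (simp add: d_def field_simps)
      then show ?thesis using \<open>0 < d\<close> by (simp add: algebra_simps)
    qed
    ultimately show ?thesis using N[OF n] by linarith
  qed
  then show "\<exists>no. \<forall>n\<ge>no. cmod (ip (w n) g - ip v g) < e" by blast
qed

lemma mult_op_bounded: assumes "\<phi> \<in> Mult" shows "mult_op \<phi> \<in> bounded_ops"
proof -
  obtain C where C: "mbound \<phi> C" using Mult_bounded[OF assms] by blast
  have "\<exists>C. \<forall>f\<in>H. hnorm (mult_op \<phi> f) \<le> C * hnorm f"
    using mbound_le[OF C] by (intro exI[of _ C]) (simp add: mult_op_def)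
  moreover have "mult_op \<phi> \<in> H \<rightarrow>\<^sub>E H"
    using Mult_mem[OF assms] by (auto simp: mult_op_def)
  ultimately show ?thesis
    unfolding bounded_ops_def by (auto simp: mult_op_def add_mem scale_mem algebra_simps)
qed

lemma openin_weak_star_basic:
  assumes "square_summable f" "square_summable g" "open U"
  shows "openin weak_star_ops {T \<in> bounded_ops. (\<Sum>n. ip (T (f n)) (g n)) \<in> U}"
  unfolding weak_star_ops_def using assms by (intro topology_generated_by_Basis) blast

lemma square_summable_single: "f \<in> H \<Longrightarrow> square_summable (\<lambda>n. if n = (0::nat) then f else (\<lambda>x. 0))"
proof -
  assume f: "f \<in> H"
  have "(hnorm (if n = (0::nat) then f else (\<lambda>x. 0)))\<^sup>2 = 0" if "n \<notin> {0}" for n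
    using that by simp
  then have "summable (\<lambda>n. (hnorm (if n = (0::nat) then f else (\<lambda>x. 0)))\<^sup>2)"
    by (intro summable_finite[of "{0}"]) simp_all
  then show ?thesis
    using f zero_mem by (simp add: square_summable_def)
qed

lemma ip_zero_right: "f \<in> H \<Longrightarrow> ip f (\<lambda>x. 0) = 0"
  using ip_scale_right[of f f 0] by simp

text \<open>
  By definition, the space of the pullback topology consists of those multipliers that act as bounded
  operators; these are all multipliers.
\<close>

lemma topspace_weak_star_Mult: "topspace weak_star_Mult = Mult"
proof -
  have "mult_op \<phi> \<in> topspace weak_star_ops" if "\<phi> \<in> Mult" for \<phi>
    using openin_subset[OF openin_weak_star_basic[OF square_summable_single[OF zero_mem] square_summable_single[OF zero_mem] open_UNIV]]
      mult_op_bounded[OF that] by auto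
  then show ?thesis
    by (auto simp: weak_star_Mult_def topspace_pullback_topology)
qed

abbreviation weak_star_continuous :: "(('a \<Rightarrow> complex) \<Rightarrow> complex) \<Rightarrow> bool" where
  "weak_star_continuous \<equiv> continuous_map weak_star_Mult euclidean"

text \<open>
  Pairing with an operator of rank one: the square-summable sequences are \<open>h, 0, 0, ...\<close> and
  \<open>g, 0, 0, ...\<close>.
\<close>

lemma vector_functional_weak_star_continuous:
  assumes "h \<in> H" "g \<in> H" "\<And>\<phi>. \<phi> \<in> Mult \<Longrightarrow> \<rho> \<phi> = ip (\<lambda>x. \<phi> x * h x) g"
  shows "weak_star_continuous \<rho>"
  unfolding continuous_map_def
proof (intro conjI allI impI)
  show "\<rho> \<in> topspace weak_star_Mult \<rightarrow> topspace euclidean" by simp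
  fix U :: "complex set" assume "openin euclidean U"
  then have U: "open U" by (simp only: open_openin)
  define f' g' where "f' = (\<lambda>n::nat. if n = 0 then h else (\<lambda>x. 0))" and "g' = (\<lambda>n::nat. if n = 0 then g else (\<lambda>x. 0))"
  have o: "openin weak_star_ops {T \<in> bounded_ops. (\<Sum>n. ip (T (f' n)) (g' n)) \<in> U}"
    unfolding f'_def g'_def by (intro openin_weak_star_basic square_summable_single assms U)
  have "(\<Sum>n. ip (mult_op \<phi> (f' n)) (g' n)) = \<rho> \<phi>" if \<phi>: "\<phi> \<in> Mult" for \<phi>
  proof -
    have H: "mult_op \<phi> (f' n) \<in> H" for n
      using assms(1) zero_mem Mult_mem[OF \<phi>] by (auto simp: mult_op_def f'_def)
    have "(\<Sum>n. ip (mult_op \<phi> (f' n)) (g' n)) = (\<Sum>n\<in>{0}. ip (mult_op \<phi> (f' n)) (g' n))"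
      by (rule suminf_finite) (use H in \<open>auto simp: g'_def ip_zero_right\<close>)
    also have "\<dots> = \<rho> \<phi>"
      using assms \<phi> by (simp add: mult_op_def f'_def g'_def)
    finally show ?thesis .
  qed
  then have "{\<phi> \<in> topspace weak_star_Mult. \<rho> \<phi> \<in> U} = mult_op -` {T \<in> bounded_ops. (\<Sum>n. ip (T (f' n)) (g' n)) \<in> U} \<inter> Mult"
    using mult_op_bounded by (auto simp: topspace_weak_star_Mult)
  then show "openin weak_star_Mult {\<phi> \<in> topspace weak_star_Mult. \<rho> \<phi> \<in> U}"
    unfolding weak_star_Mult_def openin_pullback_topology using o by blast
qed

text \<open>
  On a bounded set of multipliers, pointwise convergence gives convergence of each \<open>\<langle>\<phi> n f, g\<rangle>\<close>, and by
  dominated convergence that of the series defining the weak-* topology.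
\<close>

lemma weak_star_bounded_pointwise:
  assumes \<phi>: "\<And>n. mbound (\<phi> n) C" and \<psi>: "\<psi> \<in> Mult"
    and lim: "\<And>x. x \<in> X \<Longrightarrow> (\<lambda>n. \<phi> n x) \<longlonglongrightarrow> \<psi> x" and "0 \<le> C"
    and cont: "weak_star_continuous \<rho>"
  shows "(\<lambda>n. \<rho> (\<phi> n)) \<longlonglongrightarrow> \<rho> \<psi>"
proof (rule topological_tendstoI)
  fix U assume U: "open U" "\<rho> \<psi> \<in> U"
  define \<B> where "\<B> = {{T \<in> bounded_ops. (\<Sum>n. ip (T (f n)) (g n)) \<in> U} | f g U.
        square_summable f \<and> square_summable g \<and> open U}"
  have ops: "weak_star_ops = topology_generated_by \<B>"
    by (simp only: weak_star_ops_def \<B>_def)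
  have ev: "mult_op \<psi> \<in> V \<Longrightarrow> \<forall>\<^sub>F n in sequentially. mult_op (\<phi> n) \<in> V"
    if "generate_topology_on \<B> V" for V
    using that
  proof (induction rule: generate_topology_on.induct)
    case (Basis V)
    then obtain f g W where V: "V = {T \<in> bounded_ops. (\<Sum>n. ip (T (f n)) (g n)) \<in> W}"
      "square_summable f" "square_summable g" "open W" unfolding \<B>_def by blast
    have fH: "f m \<in> H" and gH: "g m \<in> H" for m using V by (auto simp: square_summable_def)
    define M where "M = (\<lambda>m. C * ((hnorm (f m))\<^sup>2 + (hnorm (g m))\<^sup>2))"
    have sM: "summable M"
      unfolding M_def using V by (intro summable_mult summable_add) (auto simp: square_summable_def)
    have tl: "(\<lambda>n. ip (\<lambda>x. \<phi> n x * f m x) (g m)) \<longlonglongrightarrow> ip (\<lambda>x. \<psi> x * f m x) (g m)" for m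
    proof (rule weak_convergence[where B = "C * hnorm (f m)"])
      show "(\<lambda>x. \<phi> n x * f m x) \<in> H" for n using \<phi> fH by (auto intro: Mult_mem mbound_Mult)
      show "hnorm (\<lambda>x. \<phi> n x * f m x) \<le> C * hnorm (f m)" for n using \<phi> fH by (rule mbound_le)
      show "(\<lambda>x. \<psi> x * f m x) \<in> H" using \<psi> fH by (rule Mult_mem)
      show "(\<lambda>n. \<phi> n x * f m x) \<longlonglongrightarrow> \<psi> x * f m x" if "x \<in> X" for x
        by (intro tendsto_mult tendsto_const lim that)
    qed (rule gH)
    have bd: "cmod (ip (\<lambda>x. \<phi> n x * f m x) (g m)) \<le> M m" for n m
    proof -
      have "cmod (ip (\<lambda>x. \<phi> n x * f m x) (g m)) \<le> hnorm (\<lambda>x. \<phi> n x * f m x) * hnorm (g m)"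
        using \<phi> fH gH by (intro cauchy_schwarz) (auto intro: Mult_mem mbound_Mult)
      also have "\<dots> \<le> C * hnorm (f m) * hnorm (g m)"
        using \<phi> fH gH by (intro mult_right_mono mbound_le) auto
      also have "\<dots> = C * (hnorm (f m) * hnorm (g m))" by simp
      also have "\<dots> \<le> M m"
      proof -
        have "2 * (hnorm (f m) * hnorm (g m)) \<le> (hnorm (f m))\<^sup>2 + (hnorm (g m))\<^sup>2"
          using zero_le_power2[of "hnorm (f m) - hnorm (g m)"] by (simp add: power2_diff)
        moreover have "0 \<le> hnorm (f m) * hnorm (g m)" using fH gH by simp
        ultimately have "hnorm (f m) * hnorm (g m) \<le> (hnorm (f m))\<^sup>2 + (hnorm (g m))\<^sup>2" by linarith
        then show ?thesis
          unfolding M_def by (rule mult_left_mono[OF _ \<open>0 \<le> C\<close>])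
      qed
      finally show ?thesis .
    qed
    have "(\<lambda>n. \<Sum>m. ip (\<lambda>x. \<phi> n x * f m x) (g m)) \<longlonglongrightarrow> (\<Sum>m. ip (\<lambda>x. \<psi> x * f m x) (g m))"
      using tannerys_theorem[of "\<lambda>m n. ip (\<lambda>x. \<phi> n x * f m x) (g m)" "\<lambda>m. ip (\<lambda>x. \<psi> x * f m x) (g m)" sequentially M]
        tl bd sM by (simp add: always_eventually)
    moreover have "(\<Sum>m. ip (\<lambda>x. \<psi> x * f m x) (g m)) \<in> W"
      using Basis(2) fH unfolding V(1) by (simp add: mult_op_def)
    ultimately have "\<forall>\<^sub>F n in sequentially. (\<Sum>m. ip (\<lambda>x. \<phi> n x * f m x) (g m)) \<in> W"
      using V(4) by (auto dest: topological_tendstoD)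
    show ?case
    proof -
      have "mult_op (\<phi> n) (f m) = (\<lambda>x. \<phi> n x * f m x)" for n m
        by (simp add: mult_op_def fH)
      then show ?thesis
        using \<open>\<forall>\<^sub>F n in sequentially. (\<Sum>m. ip (\<lambda>x. \<phi> n x * f m x) (g m)) \<in> W\<close>
          mult_op_bounded[OF mbound_Mult[OF \<phi>]] by (simp add: V(1))
    qed
  next
    case (UN K)
    then obtain k where k: "k \<in> K" "mult_op \<psi> \<in> k" by blast
    then have "\<forall>\<^sub>F n in sequentially. mult_op (\<phi> n) \<in> k" using UN by blast
    then show ?case by (rule eventually_mono) (use k in blast)
  next
    case (Int a b)
    then have "\<forall>\<^sub>F n in sequentially. mult_op (\<phi> n) \<in> a" "\<forall>\<^sub>F n in sequentially. mult_op (\<phi> n) \<in> b" by auto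
    then show ?case by (simp add: eventually_conj)
  next
    case Empty
    then show ?case by simp
  qed
  have "openin weak_star_Mult {\<phi> \<in> topspace weak_star_Mult. \<rho> \<phi> \<in> U}"
    by (rule openin_continuous_map_preimage[OF cont]) (use U(1) in simp)
  then have "openin (pullback_topology Mult mult_op weak_star_ops) {\<phi> \<in> Mult. \<rho> \<phi> \<in> U}"
    unfolding topspace_weak_star_Mult by (simp only: weak_star_Mult_def)
  then have "\<exists>V. openin weak_star_ops V \<and> {\<phi> \<in> Mult. \<rho> \<phi> \<in> U} = mult_op -` V \<inter> Mult"
    by (simp only: openin_pullback_topology)
  then obtain V where V: "openin weak_star_ops V" "{\<phi> \<in> Mult. \<rho> \<phi> \<in> U} = mult_op -` V \<inter> Mult"
    by (elim exE conjE) (rule that)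
  have "mult_op \<psi> \<in> V" using V(2) \<psi> U(2) by blast
  then have "\<forall>\<^sub>F n in sequentially. mult_op (\<phi> n) \<in> V"
    using ev V(1) unfolding ops openin_topology_generated_by_iff by blast
  then show "\<forall>\<^sub>F n in sequentially. \<rho> (\<phi> n) \<in> U"
    by (rule eventually_mono) (use V(2) mbound_Mult[OF \<phi>] in blast)
qed

section \<open>Characters and their distances\<close>

lemma char_add: "\<rho> \<in> characters \<Longrightarrow> \<phi> \<in> Mult \<Longrightarrow> \<psi> \<in> Mult \<Longrightarrow> \<rho> (\<lambda>x. \<phi> x + \<psi> x) = \<rho> \<phi> + \<rho> \<psi>"
  by (simp add: characters_def functional_on_def)

lemma char_scale: "\<rho> \<in> characters \<Longrightarrow> \<phi> \<in> Mult \<Longrightarrow> \<rho> (\<lambda>x. c * \<phi> x) = c * \<rho> \<phi>"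
  by (simp add: characters_def functional_on_def)

lemma char_times: "\<rho> \<in> characters \<Longrightarrow> \<phi> \<in> Mult \<Longrightarrow> \<psi> \<in> Mult \<Longrightarrow> \<rho> (\<lambda>x. \<phi> x * \<psi> x) = \<rho> \<phi> * \<rho> \<psi>"
  by (simp add: characters_def)

lemma char_diff:
  assumes "\<rho> \<in> characters" "\<phi> \<in> Mult" "\<psi> \<in> Mult" shows "\<rho> (\<lambda>x. \<phi> x - \<psi> x) = \<rho> \<phi> - \<rho> \<psi>"
  using char_add[OF assms(1,2) Mult_scale[OF assms(3), of "-1"]] char_scale[OF assms(1,3), of "-1"] by simp

lemma char_unit: assumes "\<rho> \<in> characters" shows "\<rho> unit = 1"
proof -
  obtain \<phi> where \<phi>: "\<phi> \<in> Mult" "\<rho> \<phi> \<noteq> 0" using assms by (auto simp: characters_def)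
  have "\<rho> (\<lambda>x. unit x * \<phi> x) = \<rho> unit * \<rho> \<phi>" by (rule char_times[OF assms unit_Mult \<phi>(1)])
  then show ?thesis using \<phi> unit_times[of \<phi>] Mult_vanishes[OF \<phi>(1)] by simp
qed

text \<open>
  If \<open>\<bar>\<rho> \<phi>\<bar> > 1\<close>, then \<open>1 - \<phi> / \<rho> \<phi>\<close> is invertible in \<open>Mult\<close> and annihilated by \<open>\<rho>\<close>.
\<close>

lemma char_contractive:
  assumes \<rho>: "\<rho> \<in> characters" and \<phi>: "mbound \<phi> 1" shows "cmod (\<rho> \<phi>) \<le> 1"
proof (rule ccontr)
  assume "\<not> cmod (\<rho> \<phi>) \<le> 1"
  then have gt: "1 < cmod (\<rho> \<phi>)" by simp
  define c where "c = 1 / \<rho> \<phi>"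
  have c1: "cmod c < 1" using gt by (simp add: c_def norm_divide divide_less_eq)
  define \<kappa> where "\<kappa> = (\<lambda>x. c * \<phi> x)"
  define \<eta> where "\<eta> = (\<lambda>x. if x \<in> X then 1 / (1 - \<kappa> x) else 0)"
  have mb: "mbound \<kappa> (cmod c)" using mbound_scale[OF \<phi>, of c] by (simp add: \<kappa>_def)
  have M: "\<kappa> \<in> Mult" "\<eta> \<in> Mult" "(\<lambda>x. unit x - \<kappa> x) \<in> Mult"
    using mbound_Mult[OF mb] mbound_Mult[OF mbound_inverse(1)[OF mb c1]] unit_Mult
    by (auto simp: \<eta>_def intro: Mult_diff)
  have "(\<lambda>x. \<eta> x * (unit x - \<kappa> x)) = unit"
    using mbound_inverse(2)[OF mb c1] by (auto simp: \<eta>_def unit_def fun_eq_iff)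
  then have "\<rho> unit = \<rho> \<eta> * (\<rho> unit - \<rho> \<kappa>)"
    using char_times[OF \<rho> M(2,3)] char_diff[OF \<rho> unit_Mult M(1)] by simp
  moreover have "\<rho> \<kappa> = 1"
    using char_scale[OF \<rho> mbound_Mult[OF \<phi>], of c] gt by (auto simp: \<kappa>_def c_def)
  ultimately show False using char_unit[OF \<rho>] by simp
qed

lemma char_bound:
  assumes \<rho>: "\<rho> \<in> characters" and \<phi>: "mbound \<phi> C" "0 \<le> C" shows "cmod (\<rho> \<phi>) \<le> C"
proof (rule dense_ge)
  fix s assume s: "C < s"
  then have s0: "0 < s" using \<phi>(2) by simp
  define c where "c = complex_of_real (1 / s)"
  have cn: "cmod c = 1 / s" using s0 by (simp add: c_def norm_divide)
  have "mbound (\<lambda>x. c * \<phi> x) (cmod c * C)" by (rule mbound_scale[OF \<phi>(1)])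
  then have "mbound (\<lambda>x. c * \<phi> x) 1" by (rule mbound_mono) (use s s0 cn in simp)
  then have "cmod (\<rho> (\<lambda>x. c * \<phi> x)) \<le> 1" by (rule char_contractive[OF \<rho>])
  then show "cmod (\<rho> \<phi>) \<le> s"
    using s0 by (simp add: char_scale[OF \<rho> mbound_Mult[OF \<phi>(1)]] norm_mult cn)
qed

lemma eval_char_mem: assumes "x \<in> X" shows "eval_char x \<in> characters"
proof -
  have "eval_char x unit \<noteq> 0" using assms unit_Mult by (simp add: eval_char_def unit_def)
  then show ?thesis
    using unit_Mult unfolding characters_def functional_on_def
    by (auto simp: eval_char_def Mult_add Mult_scale Mult_times)
qed

abbreviation char_dist :: "(('a \<Rightarrow> complex) \<Rightarrow> complex) \<Rightarrow> (('a \<Rightarrow> complex) \<Rightarrow> complex) \<Rightarrow> real" where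
  "char_dist \<rho> \<sigma> \<equiv> op_norm Mult mult_norm cmod (\<lambda>\<phi>. \<rho> \<phi> - \<sigma> \<phi>)"

lemma char_dist_eq: "char_dist \<rho> \<sigma> = (SUP \<phi>\<in>{\<phi>. mbound \<phi> 1}. cmod (\<rho> \<phi> - \<sigma> \<phi>))"
  unfolding op_norm_def mult_norm_le_1_iff ..

lemma char_dist_bdd:
  assumes "\<rho> \<in> characters" "\<sigma> \<in> characters"
  shows "bdd_above ((\<lambda>\<phi>. cmod (\<rho> \<phi> - \<sigma> \<phi>)) ` {\<phi>. mbound \<phi> 1})"
proof (rule bdd_aboveI2)
  fix \<phi> assume "\<phi> \<in> {\<phi>. mbound \<phi> 1}"
  then have "cmod (\<rho> \<phi>) \<le> 1" "cmod (\<sigma> \<phi>) \<le> 1" using char_contractive assms by auto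
  then show "cmod (\<rho> \<phi> - \<sigma> \<phi>) \<le> 2" using norm_triangle_ineq4[of "\<rho> \<phi>" "\<sigma> \<phi>"] by linarith
qed

lemma char_dist_ge:
  assumes "\<rho> \<in> characters" "\<sigma> \<in> characters" "mbound \<phi> 1"
  shows "cmod (\<rho> \<phi> - \<sigma> \<phi>) \<le> char_dist \<rho> \<sigma>"
  unfolding char_dist_eq using assms(3) by (intro cSUP_upper[OF _ char_dist_bdd[OF assms(1,2)]]) simp

lemma char_dist_self: "char_dist \<rho> \<rho> = 0"
proof -
  have "{\<phi>. mbound \<phi> 1} \<noteq> {}" using mbound_unit by auto
  then show ?thesis unfolding char_dist_eq by simp
qed

text \<open>
  The case of von Neumann's inequality for a Moebius transformation of the disc: for \<open>f = (1 - t \<psi>) p\<close>, the difference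
  \<open>\<parallel>(1 - t \<psi>) p\<parallel>\<^sup>2 - \<parallel>(\<psi> - t) p\<parallel>\<^sup>2\<close> equals \<open>(1 - t\<^sup>2) (\<parallel>p\<parallel>\<^sup>2 - \<parallel>\<psi> p\<parallel>\<^sup>2)\<close>.
\<close>

lemma moebius_contractive:
  assumes \<psi>: "mbound \<psi> 1" and t: "0 \<le> t" "t < 1"
  obtains \<eta> where "mbound \<eta> 1"
    "(\<lambda>x. \<eta> x * (unit x - complex_of_real t * \<psi> x)) = (\<lambda>x. \<psi> x - complex_of_real t * unit x)"
proof -
  define \<kappa> where "\<kappa> = (\<lambda>x. complex_of_real t * \<psi> x)"
  have mb: "mbound \<kappa> t" using mbound_scale[OF \<psi>, of "complex_of_real t"] t by (simp add: \<kappa>_def)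
  define \<iota> where "\<iota> = (\<lambda>x. if x \<in> X then 1 / (1 - \<kappa> x) else 0)"
  define \<eta> where "\<eta> = (\<lambda>x. (\<psi> x - complex_of_real t * unit x) * \<iota> x)"
  have M: "\<psi> \<in> Mult" "\<iota> \<in> Mult"
    using mbound_Mult[OF \<psi>] mbound_Mult[OF mbound_inverse(1)[OF mb t(2)]] by (auto simp: \<iota>_def)
  have van: "\<psi> x = 0" if "x \<notin> X" for x using Mult_vanishes[OF M(1) that] .
  have \<eta>M: "\<eta> \<in> Mult" unfolding \<eta>_def by (intro Mult_times Mult_diff Mult_scale M unit_Mult)
  have ne: "\<kappa> x \<noteq> 1" if "x \<in> X" for x using mbound_inverse(2)[OF mb t(2) that] .
  have id: "(\<lambda>x. \<eta> x * (unit x - complex_of_real t * \<psi> x)) = (\<lambda>x. \<psi> x - complex_of_real t * unit x)"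
    using ne van by (auto simp: \<eta>_def \<iota>_def \<kappa>_def unit_def fun_eq_iff)
  have "hnorm (\<lambda>x. \<eta> x * f x) \<le> 1 * hnorm f" if f: "f \<in> H" for f
  proof -
    define p where "p = (\<lambda>x. \<iota> x * f x)"
    define q where "q = (\<lambda>x. \<psi> x * p x)"
    have pH: "p \<in> H" unfolding p_def by (rule Mult_mem[OF M(2) f])
    have qH: "q \<in> H" unfolding q_def by (rule Mult_mem[OF M(1) pH])
    have "hnorm q \<le> hnorm p" using mbound_le[OF \<psi> pH] by (simp add: q_def)
    then have qp: "(hnorm q)\<^sup>2 \<le> (hnorm p)\<^sup>2" using qH by (intro power_mono) auto
    have e1: "(\<lambda>x. \<eta> x * f x) = (\<lambda>x. q x - complex_of_real t * p x)"
      by (auto simp: \<eta>_def q_def p_def unit_def \<iota>_def fun_eq_iff algebra_simps)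
    have e2: "f = (\<lambda>x. p x - complex_of_real t * q x)"
    proof
      fix x show "f x = p x - complex_of_real t * q x"
      proof (cases "x \<in> X")
        case True
        have "f x = (1 - \<kappa> x) * p x" using ne[OF True] True by (simp add: p_def \<iota>_def)
        then show ?thesis by (simp add: \<kappa>_def q_def algebra_simps)
      next
        case False
        then show ?thesis using vanishes[OF f False] by (simp add: p_def q_def \<iota>_def)
      qed
    qed
    have tp: "(\<lambda>x. complex_of_real t * p x) \<in> H" and tq: "(\<lambda>x. complex_of_real t * q x) \<in> H"
      by (intro scale_mem pH qH)+
    have n1: "(hnorm (\<lambda>x. q x - complex_of_real t * p x))\<^sup>2 = (hnorm q)\<^sup>2 + t\<^sup>2 * (hnorm p)\<^sup>2 - 2 * (t * Re (ip q p))"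
      unfolding hnorm_diff_sq[OF qH tp] hnorm_scale[OF pH] ip_scale_right[OF pH qH] by (simp add: power_mult_distrib)
    have n2: "(hnorm (\<lambda>x. p x - complex_of_real t * q x))\<^sup>2 = (hnorm p)\<^sup>2 + t\<^sup>2 * (hnorm q)\<^sup>2 - 2 * (t * Re (ip q p))"
      unfolding hnorm_diff_sq[OF pH tq] hnorm_scale[OF qH] ip_scale_right[OF qH pH] ip_cnj[OF qH pH]
      by (simp add: power_mult_distrib)
    have "t\<^sup>2 \<le> 1" using t by (simp add: power_le_one)
    then have "0 \<le> (1 - t\<^sup>2) * ((hnorm p)\<^sup>2 - (hnorm q)\<^sup>2)" using qp by simp
    then have "(hnorm (\<lambda>x. q x - complex_of_real t * p x))\<^sup>2 \<le> (hnorm (\<lambda>x. p x - complex_of_real t * q x))\<^sup>2"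
      unfolding n1 n2 by (simp add: algebra_simps)
    then have "(hnorm (\<lambda>x. \<eta> x * f x))\<^sup>2 \<le> (hnorm f)\<^sup>2"
      unfolding e1 e2[symmetric] .
    then show ?thesis using f by (auto intro: power2_le_imp_le)
  qed
  then have "mbound \<eta> 1" using \<eta>M by (simp add: mbound_def)
  then show thesis using that id by blast
qed

text \<open>
  Distance less than 2 from \<open>ev x\<close> implies pseudohyperbolic distance less than 1.  If \<open>\<psi> x = 0\<close> and
  \<open>\<alpha> = \<rho> \<psi> > 0\<close>, then the Moebius transform \<open>\<eta> = (\<psi> - t) / (1 - t \<psi>)\<close> satisfies
  \<open>\<rho> \<eta> - \<eta> x = \<alpha> (1 - t\<^sup>2) / (1 - t \<alpha>)\<close>, which tends to \<open>1 + t\<close> as \<open>\<alpha> \<rightarrow> 1\<close>.  With \<open>t\<close> half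
  the distance, \<open>1 + t\<close> exceeds the distance \<open>2 t\<close>, and so \<open>\<alpha>\<close> stays away from 1.
\<close>

lemma char_dist_schwarz:
  assumes \<rho>: "\<rho> \<in> characters" and x: "x \<in> X" and lt: "char_dist (eval_char x) \<rho> < 2"
  obtains \<delta> where "\<delta> < 1" "\<And>\<psi>. mbound \<psi> 1 \<Longrightarrow> \<psi> x = 0 \<Longrightarrow> cmod (\<rho> \<psi>) \<le> \<delta>"
proof -
  note ev = eval_char_mem[OF x]
  define t where "t = char_dist (eval_char x) \<rho> / 2"
  have t: "0 \<le> t" "t < 1"
    using lt char_dist_ge[OF ev \<rho> mbound_unit] norm_ge_zero[of "eval_char x unit - \<rho> unit"]
    unfolding t_def by linarith+
  have "2 * t < 1 + t\<^sup>2"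
  proof -
    have "0 < (1 - t)\<^sup>2" using t by simp
    then show ?thesis by (simp add: power2_diff)
  qed
  then have "2 * t / (1 + t\<^sup>2) < 1" by (simp add: divide_less_eq add_pos_nonneg)
  moreover have "cmod (\<rho> \<psi>) \<le> 2 * t / (1 + t\<^sup>2)" if \<psi>: "mbound \<psi> 1" "\<psi> x = 0" for \<psi>
  proof (cases "\<rho> \<psi> = 0")
    case True
    then show ?thesis using t by simp
  next
    case False
    define \<alpha> where "\<alpha> = cmod (\<rho> \<psi>)"
    have \<alpha>: "0 < \<alpha>" "\<alpha> \<le> 1" using False char_contractive[OF \<rho> \<psi>(1)] by (auto simp: \<alpha>_def)
    \<comment> \<open>Rotate \<open>\<psi>\<close> so that \<open>\<rho>\<close> takes the value \<open>\<alpha>\<close>.\<close>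
    define c where "c = cnj (\<rho> \<psi>) / complex_of_real \<alpha>"
    have c1: "cmod c = 1" using \<alpha> by (simp add: c_def norm_divide \<alpha>_def)
    define \<psi>' where "\<psi>' = (\<lambda>y. c * \<psi> y)"
    have mb: "mbound \<psi>' 1" using mbound_scale[OF \<psi>(1), of c] c1 by (simp add: \<psi>'_def)
    have "c * \<rho> \<psi> = complex_of_real \<alpha>"
      using \<alpha> complex_norm_square[of "\<rho> \<psi>"] by (simp add: c_def \<alpha>_def field_simps power2_eq_square)
    then have r\<psi>': "\<rho> \<psi>' = complex_of_real \<alpha>"
      using char_scale[OF \<rho> mbound_Mult[OF \<psi>(1)], of c] by (simp add: \<psi>'_def)
    obtain \<eta> where \<eta>: "mbound \<eta> 1"
      "(\<lambda>y. \<eta> y * (unit y - complex_of_real t * \<psi>' y)) = (\<lambda>y. \<psi>' y - complex_of_real t * unit y)"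
      using moebius_contractive[OF mb t] by blast
    have M: "\<eta> \<in> Mult" "\<psi>' \<in> Mult" using \<eta>(1) mb by (auto intro: mbound_Mult)
    have "\<eta> x = - complex_of_real t"
      using fun_cong[OF \<eta>(2), of x] x \<psi>(2) by (simp add: unit_def \<psi>'_def)
    then have ex: "eval_char x \<eta> = - complex_of_real t" using M by (simp add: eval_char_def)
    have "\<rho> \<eta> * (1 - complex_of_real t * complex_of_real \<alpha>) = complex_of_real \<alpha> - complex_of_real t"
    proof -
      have "\<rho> (\<lambda>y. \<eta> y * (unit y - complex_of_real t * \<psi>' y)) = \<rho> \<eta> * (\<rho> unit - complex_of_real t * \<rho> \<psi>')"
        using char_times[OF \<rho> M(1) Mult_diff[OF unit_Mult Mult_scale[OF M(2)]]]
          char_diff[OF \<rho> unit_Mult Mult_scale[OF M(2)]] char_scale[OF \<rho> M(2)] by simp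
      moreover have "\<rho> (\<lambda>y. \<psi>' y - complex_of_real t * unit y) = \<rho> \<psi>' - complex_of_real t * \<rho> unit"
        using char_diff[OF \<rho> M(2) Mult_scale[OF unit_Mult]] char_scale[OF \<rho> unit_Mult] by simp
      ultimately show ?thesis unfolding \<eta>(2) r\<psi>' char_unit[OF \<rho>] by simp
    qed
    moreover have ta: "t * \<alpha> < 1"
    proof -
      have "t * \<alpha> \<le> t * 1" using t \<alpha> by (intro mult_left_mono) auto
      then show ?thesis using t by simp
    qed
    ultimately have "\<rho> \<eta> = complex_of_real ((\<alpha> - t) / (1 - t * \<alpha>))"
    proof -
      have "complex_of_real (1 - t * \<alpha>) \<noteq> 0" using ta by (simp only: of_real_eq_0_iff)
      then show ?thesis
        using \<open>\<rho> \<eta> * (1 - complex_of_real t * complex_of_real \<alpha>) = complex_of_real \<alpha> - complex_of_real t\<close>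
        by (simp add: eq_divide_eq)
    qed
    then have "eval_char x \<eta> - \<rho> \<eta> = complex_of_real (- t - (\<alpha> - t) / (1 - t * \<alpha>))"
      using ex by simp
    then have "\<bar>- t - (\<alpha> - t) / (1 - t * \<alpha>)\<bar> \<le> 2 * t"
      using char_dist_ge[OF ev \<rho> \<eta>(1)] unfolding t_def by (simp only: norm_of_real)
    then have "t + (\<alpha> - t) / (1 - t * \<alpha>) \<le> 2 * t" by linarith
    then have "(\<alpha> - t) / (1 - t * \<alpha>) \<le> t" by simp
    then have "\<alpha> - t \<le> t * (1 - t * \<alpha>)" using ta by (simp add: divide_le_eq)
    then have "\<alpha> * (1 + t\<^sup>2) \<le> 2 * t" by (simp add: algebra_simps power2_eq_square)
    then have "\<alpha> \<le> 2 * t / (1 + t\<^sup>2)" by (simp add: le_divide_eq add_pos_nonneg)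
    then show ?thesis by (simp add: \<alpha>_def)
  qed
  ultimately show thesis using that by blast
qed

text \<open>
  \<open>riesz_graph\<close> represents conjugate-linear functionals, so it is applied to the conjugate of \<open>R\<close>.
\<close>

lemma riesz:
  assumes "functional_on H R" "\<forall>f\<in>H. cmod (R f) \<le> C * hnorm f"
  obtains g where "g \<in> H" "\<And>f. f \<in> H \<Longrightarrow> R f = ip f g"
proof -
  define P where "P = {(f, cnj (R f)) | f. f \<in> H}"
  have R: "R (\<lambda>x. f x + g x) = R f + R g" "R (\<lambda>x. c * f x) = c * R f" if "f \<in> H" "g \<in> H" for f g c
    using assms(1) that by (auto simp: functional_on_def)
  have R0: "R (\<lambda>x. 0) = 0" using R(2)[OF zero_mem zero_mem, of 0] by simp
  have P1: "f \<in> H" if "(f, a) \<in> P" for f a using that by (auto simp: P_def)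
  have P2: "((\<lambda>x. 0), 0) \<in> P" using zero_mem R0 by (auto simp: P_def intro!: exI[of _ "\<lambda>x. 0"])
  have P3: "((\<lambda>x. f x + g x), a + b) \<in> P" if "(f, a) \<in> P" "(g, b) \<in> P" for f a g b
    using that by (auto simp: P_def R add_mem)
  have P4: "((\<lambda>x. c * f x), cnj c * a) \<in> P" if "(f, a) \<in> P" for c f a
    using that by (auto simp: P_def R scale_mem)
  have P5: "cmod a \<le> C * hnorm f" if "(f, a) \<in> P" for f a
    using that assms(2) by (auto simp: P_def)
  obtain s g a where g: "hlim s g" "\<And>n. (s n, a n) \<in> P" "\<And>f a. (f, a) \<in> P \<Longrightarrow> ip g f = a" "hnorm g \<le> \<bar>C\<bar>"
    by (rule riesz_graph[of P C]; (erule P1 | rule P2 | erule (1) P3 | erule P4 | erule P5 | rule that; assumption))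
  have gH: "g \<in> H" using g(1) by (simp add: hlim_def)
  have "R f = ip f g" if f: "f \<in> H" for f
  proof -
    have "ip g f = cnj (R f)" using f by (intro g(3)) (auto simp: P_def)
    then show ?thesis using ip_cnj[OF gH f] by simp
  qed
  then show thesis using that gH by blast
qed

end

context normalized_pick_space
begin

section \<open>Weak-* continuity, Gleason parts and partially multiplicative functionals\<close>

lemma unit_eq_kernel: "unit = kf x0"
  using base_kernel vanishes[OF kernel_mem[OF base_mem]] by (auto simp: unit_def fun_eq_iff)

lemma unit_mem: "unit \<in> H"
  unfolding unit_eq_kernel by (rule kernel_mem[OF base_mem])

lemma times_unit: "(\<And>x. x \<notin> X \<Longrightarrow> \<phi> x = 0) \<Longrightarrow> (\<lambda>x. \<phi> x * unit x) = \<phi>"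
  by (auto simp: unit_def)

lemma Mult_subset: assumes "\<phi> \<in> Mult" shows "\<phi> \<in> H"
  using Mult_mem[OF assms unit_mem] times_unit[of \<phi>] Mult_vanishes[OF assms] by simp

text \<open>
  By rigidity, \<open>\<phi> n y - \<phi> n x \<rightarrow> 0\<close>; multiplying by \<open>cnj (\<phi> n x)\<close> removes the phase.
\<close>

lemma contractions_rigid_limit:
  assumes \<phi>: "\<And>n. mbound (\<phi> n) 1" and x: "x \<in> X" and y: "y \<in> X"
    and lim: "(\<lambda>n. cmod (\<phi> n x)) \<longlonglongrightarrow> 1"
  shows "(\<lambda>n. cnj (\<phi> n x) * \<phi> n y) \<longlonglongrightarrow> 1"
proof -
  define a where "a = (\<lambda>n. \<phi> n x)"
  have al: "(\<lambda>n. cmod (a n)) \<longlonglongrightarrow> 1" using lim by (simp only: a_def)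
  define K where "K = cmod (k y x)"
  have K: "K > 0" using kernel_nonzero[OF y x] by (simp add: K_def)
  define B where "B = (hnorm (kf x) * hnorm (kf y))\<^sup>2"
  define u where "u = (\<lambda>n. (cmod (\<phi> n y - a n) * K)\<^sup>2)"
  have u: "0 \<le> u n" "u n \<le> B * (1 - (cmod (a n))\<^sup>2)" for n
    using contraction_rigidity[OF \<phi>[of n] x y] by (simp_all add: u_def B_def a_def K_def)
  have lim0: "(\<lambda>n. B * (1 - (cmod (a n))\<^sup>2)) \<longlonglongrightarrow> B * (1 - 1\<^sup>2)"
    by (rule tendsto_mult[OF tendsto_const tendsto_diff[OF tendsto_const tendsto_power[OF al]]])
  have "u \<longlonglongrightarrow> 0"
    by (rule tendsto_sandwich[of "\<lambda>_. 0" u sequentially "\<lambda>n. B * (1 - (cmod (a n))\<^sup>2)"])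
      (use u lim0 in \<open>simp_all\<close>)
  then have "(\<lambda>n. sqrt (u n) / K) \<longlonglongrightarrow> sqrt 0 / K"
    using K by (intro tendsto_divide tendsto_real_sqrt tendsto_const) simp_all
  moreover have "sqrt (u n) / K = cmod (\<phi> n y - a n)" for n
    using K by (simp add: u_def)
  ultimately have d: "(\<lambda>n. cmod (\<phi> n y - a n)) \<longlonglongrightarrow> 0" by simp
  have "(\<lambda>n. cmod (a n) * cmod (\<phi> n y - a n)) \<longlonglongrightarrow> 1 * 0"
    by (rule tendsto_mult[OF al d])
  then have "(\<lambda>n. cmod (cnj (a n) * (\<phi> n y - a n))) \<longlonglongrightarrow> 0"
    by (simp add: norm_mult)
  then have t1: "(\<lambda>n. cnj (a n) * (\<phi> n y - a n)) \<longlonglongrightarrow> 0"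
    by (rule tendsto_norm_zero_cancel)
  have t2: "(\<lambda>n. complex_of_real ((cmod (a n))\<^sup>2)) \<longlonglongrightarrow> complex_of_real (1\<^sup>2)"
    by (rule tendsto_of_real[OF tendsto_power[OF al]])
  have "cnj (a n) * (\<phi> n y - a n) + complex_of_real ((cmod (a n))\<^sup>2) = cnj (\<phi> n x) * \<phi> n y" for n
    unfolding complex_norm_square by (simp add: a_def algebra_simps)
  then show ?thesis
    using tendsto_add[OF t1 t2] by simp
qed

text \<open>
  If the distance is 2, then some contractions \<open>\<phi> n\<close> satisfy \<open>\<bar>\<phi> n x - \<rho> (\<phi> n)\<bar> \<rightarrow> 2\<close>.  Multiplied by
  \<open>cnj (\<phi> n x)\<close>, they converge to 1 pointwise and therefore weak-*, so that both \<open>\<rho>\<close> and evaluation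
  at \<open>x\<close> have limit 1 along them.
\<close>

lemma weak_star_char_dist:
  assumes \<rho>: "\<rho> \<in> characters" and cont: "weak_star_continuous \<rho>" and x: "x \<in> X"
  shows "char_dist (eval_char x) \<rho> < 2"
proof (rule ccontr)
  assume "\<not> char_dist (eval_char x) \<rho> < 2"
  then have ge: "2 \<le> char_dist (eval_char x) \<rho>" by simp
  note ev = eval_char_mem[OF x]
  define \<epsilon> where "\<epsilon> = (\<lambda>n. inverse (real (Suc n)))"
  have \<epsilon>: "\<epsilon> \<longlonglongrightarrow> 0" "0 < \<epsilon> n" "\<epsilon> n \<le> 1" for n
    unfolding \<epsilon>_def using LIMSEQ_inverse_real_of_nat by (auto simp: inverse_le_1_iff)
  have ne: "{\<phi>. mbound \<phi> 1} \<noteq> {}" using mbound_unit by auto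
  have "\<exists>\<phi>. mbound \<phi> 1 \<and> 2 - \<epsilon> n < cmod (eval_char x \<phi> - \<rho> \<phi>)" for n
  proof -
    have "2 - \<epsilon> n < char_dist (eval_char x) \<rho>" using ge \<epsilon>(2)[of n] by linarith
    then have "\<exists>\<phi>\<in>{\<phi>. mbound \<phi> 1}. 2 - \<epsilon> n < cmod (eval_char x \<phi> - \<rho> \<phi>)"
      unfolding char_dist_eq by (rule less_cSUP_iff[OF ne char_dist_bdd[OF ev \<rho>], THEN iffD1])
    then show ?thesis by blast
  qed
  then obtain \<phi> where \<phi>: "\<And>n. mbound (\<phi> n) 1" "\<And>n. 2 - \<epsilon> n < cmod (eval_char x (\<phi> n) - \<rho> (\<phi> n))"
    by metis
  have \<phi>M: "\<phi> n \<in> Mult" for n using \<phi>(1) by (rule mbound_Mult)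
  define a where "a = (\<lambda>n. \<phi> n x)"
  have d: "2 - \<epsilon> n < cmod (a n - \<rho> (\<phi> n))" for n
    using \<phi>(2)[of n] \<phi>M by (simp add: eval_char_def a_def)
  have a1: "cmod (a n) \<le> 1" for n unfolding a_def by (rule mbound_pointwise[OF \<phi>(1) x])
  have a2: "1 - \<epsilon> n < cmod (a n)" for n
    using d[of n] norm_triangle_ineq4[of "a n" "\<rho> (\<phi> n)"] char_contractive[OF \<rho> \<phi>(1), of n] by linarith
  have "(\<lambda>n. 1 - \<epsilon> n) \<longlonglongrightarrow> 1 - 0" by (rule tendsto_diff[OF tendsto_const \<epsilon>(1)])
  then have low1: "(\<lambda>n. 1 - \<epsilon> n) \<longlonglongrightarrow> 1" by simp
  have al: "(\<lambda>n. cmod (a n)) \<longlonglongrightarrow> 1"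
    by (rule tendsto_sandwich[OF _ _ low1 tendsto_const]) (use a1 a2 in \<open>simp_all add: less_imp_le\<close>)
  define \<kappa> where "\<kappa> = (\<lambda>n y. cnj (a n) * \<phi> n y)"
  have \<kappa>b: "mbound (\<kappa> n) 1" for n
    using mbound_mono[OF mbound_scale[OF \<phi>(1)[of n], of "cnj (a n)"]] a1[of n] by (simp add: \<kappa>_def)
  have \<kappa>1: "(\<lambda>n. \<kappa> n y) \<longlonglongrightarrow> unit y" if y: "y \<in> X" for y
    using contractions_rigid_limit[OF \<phi>(1) x y] al y by (simp add: \<kappa>_def a_def unit_def)
  have "(\<lambda>n. \<rho> (\<kappa> n)) \<longlonglongrightarrow> \<rho> unit"
    by (rule weak_star_bounded_pointwise[OF \<kappa>b unit_Mult \<kappa>1 _ cont]) simp_all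
  then have "(\<lambda>n. \<rho> (\<kappa> n)) \<longlonglongrightarrow> 1" using char_unit[OF \<rho>] by simp
  moreover have "(\<lambda>n. \<kappa> n x) \<longlonglongrightarrow> 1"
    using \<kappa>1[OF x] x by (simp add: unit_def)
  ultimately have up: "(\<lambda>n. cmod (\<kappa> n x - \<rho> (\<kappa> n))) \<longlonglongrightarrow> cmod (1 - 1)"
    by (intro tendsto_norm tendsto_diff)
  have low: "(\<lambda>n. (1 - \<epsilon> n) * (2 - \<epsilon> n)) \<longlonglongrightarrow> (1 - 0) * (2 - 0)"
    by (rule tendsto_mult[OF tendsto_diff[OF tendsto_const \<epsilon>(1)] tendsto_diff[OF tendsto_const \<epsilon>(1)]])
  have le: "(1 - \<epsilon> n) * (2 - \<epsilon> n) \<le> cmod (\<kappa> n x - \<rho> (\<kappa> n))" for n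
  proof -
    have "\<rho> (\<kappa> n) = cnj (a n) * \<rho> (\<phi> n)"
      unfolding \<kappa>_def by (rule char_scale[OF \<rho> \<phi>M])
    then have "\<kappa> n x - \<rho> (\<kappa> n) = cnj (a n) * (a n - \<rho> (\<phi> n))"
      by (simp add: \<kappa>_def a_def algebra_simps)
    then have "cmod (\<kappa> n x - \<rho> (\<kappa> n)) = cmod (a n) * cmod (a n - \<rho> (\<phi> n))" by (simp add: norm_mult)
    moreover have "(1 - \<epsilon> n) * (2 - \<epsilon> n) \<le> cmod (a n) * cmod (a n - \<rho> (\<phi> n))"
      using a2[of n] d[of n] \<epsilon>(3)[of n] by (intro mult_mono) auto
    ultimately show ?thesis by simp
  qed
  have "(1 - 0) * (2 - 0) \<le> cmod (1 - 1 :: complex)"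
    by (rule LIMSEQ_le[OF low up]) (use le in blast)
  then show False by simp
qed

lemma partially_multiplicative_unit:
  assumes "partially_multiplicative R" shows "R unit = 1"
proof -
  obtain f where f: "f \<in> H" "R f \<noteq> 0" using assms by (auto simp: partially_multiplicative_def)
  have "(\<lambda>x. unit x * f x) = f" using vanishes[OF f(1)] by (rule unit_times)
  then have "R f = R unit * R f"
    using assms unit_mem f unfolding partially_multiplicative_def by metis
  then show ?thesis using f by simp
qed

text \<open>
  Multipliers are elements of \<open>H\<close> because \<open>H\<close> contains the constant function 1, and \<open>\<phi> = M\<^sub>\<phi> 1\<close> makes
  bounded functionals on \<open>H\<close> weak-* continuous on \<open>Mult\<close>.
\<close>

lemma partially_multiplicative_restrict:
  assumes R: "partially_multiplicative R"
  shows "restrict R Mult \<in> characters" "weak_star_continuous (restrict R Mult)"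
proof -
  have fR: "functional_on H R" and mR: "\<And>f g. f \<in> H \<Longrightarrow> g \<in> H \<Longrightarrow> (\<lambda>x. f x * g x) \<in> H \<Longrightarrow> R (\<lambda>x. f x * g x) = R f * R g"
    using R by (auto simp: partially_multiplicative_def)
  have "R unit \<noteq> 0" using partially_multiplicative_unit[OF R] by simp
  then show "restrict R Mult \<in> characters"
    using fR unit_Mult unfolding characters_def functional_on_def
    by (auto simp: Mult_add Mult_scale Mult_times Mult_subset intro!: mR)
  obtain C where C: "\<forall>f\<in>H. cmod (R f) \<le> C * hnorm f"
    using R by (auto simp: partially_multiplicative_def)
  obtain g where g: "g \<in> H" "\<And>f. f \<in> H \<Longrightarrow> R f = ip f g"
    using riesz[OF fR C] by blast
  have "restrict R Mult \<phi> = ip (\<lambda>x. \<phi> x * unit x) g" if "\<phi> \<in> Mult" for \<phi>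
    using g(2)[OF Mult_subset[OF that]] times_unit[of \<phi>] Mult_vanishes[OF that] that by simp
  then show "weak_star_continuous (restrict R Mult)"
    by (rule vector_functional_weak_star_continuous[OF unit_mem g(1)])
qed

lemma partially_multiplicative_eval: assumes "x \<in> X" shows "partially_multiplicative (\<lambda>f. f x)"
  unfolding partially_multiplicative_def functional_on_def
proof (intro conjI)
  show "\<exists>C. \<forall>f\<in>H. cmod (f x) \<le> C * hnorm f"
    using eval_le[OF _ assms] by (intro exI[of _ "hnorm (kf x)"]) (simp add: mult.commute)
  show "\<exists>f\<in>H. f x \<noteq> 0" using unit_mem assms by (intro bexI[of _ unit]) (simp_all add: unit_def)
qed auto

lemma eval_char_weak_star: assumes "x \<in> X" shows "weak_star_continuous (eval_char x)"
  using partially_multiplicative_restrict(2)[OF partially_multiplicative_eval[OF assms]]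
  by (simp add: eval_char_def)

text \<open>
  For each \<open>f\<close> in \<open>H\<close> the factorization provides a denominator \<open>D f\<close> with \<open>D f * f\<close> in \<open>Mult\<close> and with
  \<open>\<rho> (D f)\<close> bounded away from zero; the extension is \<open>R f = \<rho> (D f * f) / \<rho> (D f)\<close>.  It satisfies
  \<open>\<rho> (\<phi> f) = \<rho> \<phi> * R f\<close> whenever \<open>\<phi>\<close> and \<open>\<phi> f\<close> are multipliers, and this identity, with \<open>\<phi>\<close> a common
  denominator of the functions involved, yields linearity and multiplicativity.
\<close>

lemma gleason_extension:
  assumes \<rho>: "\<rho> \<in> characters" and lt: "char_dist (eval_char x0) \<rho> < 2"
  obtains R where "partially_multiplicative R" "\<And>\<phi>. \<phi> \<in> Mult \<Longrightarrow> R \<phi> = \<rho> \<phi>"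
proof -
  obtain \<delta> where \<delta>: "\<delta> < 1" "\<And>\<psi>. mbound \<psi> 1 \<Longrightarrow> \<psi> x0 = 0 \<Longrightarrow> cmod (\<rho> \<psi>) \<le> \<delta>"
    using char_dist_schwarz[OF \<rho> base_mem lt] by blast
  have "\<exists>D. D \<in> Mult \<and> 1 - \<delta> \<le> cmod (\<rho> D) \<and> mbound (\<lambda>x. D x * f x) (2 * hnorm f)" if f: "f \<in> H" for f
  proof -
    obtain \<psi> \<theta> where \<psi>: "mbound \<psi> 1" "\<psi> x0 = 0" "\<And>x. x \<in> X \<Longrightarrow> \<psi> x \<noteq> 1"
      "mbound \<theta> (2 * hnorm f)" "(\<lambda>x. (unit x - \<psi> x) * f x) = \<theta>"
      using smirnov_factorization[OF f] by blast
    have "\<rho> (\<lambda>x. unit x - \<psi> x) = 1 - \<rho> \<psi>"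
      using char_diff[OF \<rho> unit_Mult mbound_Mult[OF \<psi>(1)]] char_unit[OF \<rho>] by simp
    then have "1 - \<delta> \<le> cmod (\<rho> (\<lambda>x. unit x - \<psi> x))"
      using \<delta>(2)[OF \<psi>(1,2)] norm_triangle_ineq2[of 1 "\<rho> \<psi>"] by simp
    then show ?thesis
      using \<psi> Mult_diff[OF unit_Mult mbound_Mult[OF \<psi>(1)]] by auto
  qed
  then obtain D where D: "\<And>f. f \<in> H \<Longrightarrow> D f \<in> Mult" "\<And>f. f \<in> H \<Longrightarrow> 1 - \<delta> \<le> cmod (\<rho> (D f))"
    "\<And>f. f \<in> H \<Longrightarrow> mbound (\<lambda>x. D f x * f x) (2 * hnorm f)"
    by metis
  have D0: "\<rho> (D f) \<noteq> 0" if "f \<in> H" for f using D(2)[OF that] \<delta>(1) by auto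
  have DM: "(\<lambda>x. D f x * f x) \<in> Mult" if "f \<in> H" for f using D(3)[OF that] by (rule mbound_Mult)
  define R where "R = (\<lambda>f. \<rho> (\<lambda>x. D f x * f x) / \<rho> (D f))"
  have key: "\<rho> (\<lambda>x. \<phi> x * f x) = \<rho> \<phi> * R f"
    if f: "f \<in> H" and \<phi>: "\<phi> \<in> Mult" "(\<lambda>x. \<phi> x * f x) \<in> Mult" for f \<phi>
  proof -
    have "(\<lambda>x. D f x * (\<phi> x * f x)) = (\<lambda>x. \<phi> x * (D f x * f x))" by (simp add: algebra_simps)
    then have "\<rho> (D f) * \<rho> (\<lambda>x. \<phi> x * f x) = \<rho> \<phi> * \<rho> (\<lambda>x. D f x * f x)"
      using char_times[OF \<rho> D(1)[OF f] \<phi>(2)] char_times[OF \<rho> \<phi>(1) DM[OF f]] by simp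
    then show ?thesis using D0[OF f] by (simp add: R_def field_simps)
  qed
  have ext: "R \<phi> = \<rho> \<phi>" if \<phi>: "\<phi> \<in> Mult" for \<phi>
    using key[OF Mult_subset[OF \<phi>] unit_Mult] unit_times[of \<phi>] Mult_vanishes[OF \<phi>] \<phi> char_unit[OF \<rho>] by simp
  have add: "R (\<lambda>x. f x + g x) = R f + R g" if f: "f \<in> H" and g: "g \<in> H" for f g
  proof -
    define E where "E = (\<lambda>x. D f x * D g x)"
    have E: "E \<in> Mult" "\<rho> E \<noteq> 0"
      unfolding E_def using D(1) D0 f g by (simp_all add: Mult_times char_times[OF \<rho>])
    have "(\<lambda>x. E x * f x) = (\<lambda>x. D g x * (D f x * f x))" "(\<lambda>x. E x * g x) = (\<lambda>x. D f x * (D g x * g x))"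
      by (simp_all add: E_def algebra_simps)
    then have M: "(\<lambda>x. E x * f x) \<in> Mult" "(\<lambda>x. E x * g x) \<in> Mult"
      using Mult_times[OF D(1)[OF g] DM[OF f]] Mult_times[OF D(1)[OF f] DM[OF g]] by simp_all
    have s: "(\<lambda>x. E x * (f x + g x)) = (\<lambda>x. E x * f x + E x * g x)" by (simp add: algebra_simps)
    then have "(\<lambda>x. E x * (f x + g x)) \<in> Mult" using Mult_add[OF M] by simp
    then have "\<rho> E * R (\<lambda>x. f x + g x) = \<rho> (\<lambda>x. E x * f x + E x * g x)"
      using key[OF add_mem[OF f g] E(1)] s by simp
    also have "\<dots> = \<rho> E * R f + \<rho> E * R g"
      unfolding char_add[OF \<rho> M] key[OF f E(1) M(1)] key[OF g E(1) M(2)] ..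
    finally show ?thesis using E(2) by (simp flip: distrib_left)
  qed
  have scale: "R (\<lambda>x. c * f x) = c * R f" if f: "f \<in> H" for c f
  proof -
    have s: "(\<lambda>x. D f x * (c * f x)) = (\<lambda>x. c * (D f x * f x))" by (simp add: algebra_simps)
    have "(\<lambda>x. D f x * (c * f x)) \<in> Mult" unfolding s by (rule Mult_scale[OF DM[OF f]])
    from key[OF scale_mem[OF f] D(1)[OF f] this]
    have "\<rho> (D f) * R (\<lambda>x. c * f x) = \<rho> (\<lambda>x. c * (D f x * f x))"
      unfolding s by (rule sym)
    also have "\<dots> = c * (\<rho> (D f) * R f)"
      unfolding char_scale[OF \<rho> DM[OF f]] key[OF f D(1)[OF f] DM[OF f]] ..
    finally show ?thesis using D0[OF f] by simp
  qed
  have times: "R (\<lambda>x. f x * g x) = R f * R g"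
    if f: "f \<in> H" and g: "g \<in> H" and fg: "(\<lambda>x. f x * g x) \<in> H" for f g
  proof -
    define E where "E = (\<lambda>x. D f x * D g x)"
    have E: "E \<in> Mult" "\<rho> E = \<rho> (D f) * \<rho> (D g)"
      unfolding E_def using D(1) f g by (simp_all add: Mult_times char_times[OF \<rho>])
    have s: "(\<lambda>x. E x * (f x * g x)) = (\<lambda>x. (D f x * f x) * (D g x * g x))"
      by (simp add: E_def algebra_simps)
    then have "(\<lambda>x. E x * (f x * g x)) \<in> Mult" using Mult_times[OF DM[OF f] DM[OF g]] by simp
    then have "\<rho> E * R (\<lambda>x. f x * g x) = \<rho> (\<lambda>x. (D f x * f x) * (D g x * g x))"
      using key[OF fg E(1)] s by simp
    also have "\<dots> = (\<rho> (D f) * R f) * (\<rho> (D g) * R g)"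
      unfolding char_times[OF \<rho> DM[OF f] DM[OF g]] key[OF f D(1)[OF f] DM[OF f]] key[OF g D(1)[OF g] DM[OF g]] ..
    finally show ?thesis using D0[OF f] D0[OF g] E(2) by simp
  qed
  have bound: "cmod (R f) \<le> 2 / (1 - \<delta>) * hnorm f" if f: "f \<in> H" for f
  proof -
    have "cmod (\<rho> (\<lambda>x. D f x * f x)) \<le> 2 * hnorm f"
      using f by (intro char_bound[OF \<rho> D(3)]) auto
    then have "cmod (\<rho> (\<lambda>x. D f x * f x)) / cmod (\<rho> (D f)) \<le> 2 * hnorm f / (1 - \<delta>)"
      using D(2)[OF f] \<delta>(1) f by (intro frac_le) auto
    then show ?thesis by (simp add: R_def norm_divide)
  qed
  have "partially_multiplicative R"
    unfolding partially_multiplicative_def functional_on_def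
  proof (intro conjI)
    show "\<exists>C. \<forall>f\<in>H. cmod (R f) \<le> C * hnorm f" using bound by blast
    show "\<exists>f\<in>H. R f \<noteq> 0" using ext[OF unit_Mult] char_unit[OF \<rho>] unit_mem by (intro bexI[of _ unit]) auto
  qed (use add scale times in auto)
  then show thesis using that ext by blast
qed

lemma char_eqI:
  assumes "\<rho> \<in> characters" "\<And>\<phi>. \<phi> \<in> Mult \<Longrightarrow> \<rho> \<phi> = \<phi> x"
  shows "\<rho> = eval_char x"
proof
  fix \<phi>
  show "\<rho> \<phi> = eval_char x \<phi>"
  proof (cases "\<phi> \<in> Mult")
    case False
    have "\<rho> \<in> extensional Mult" using assms(1) by (simp add: characters_def)
    then have "\<rho> \<phi> = undefined" using False by (rule extensional_arb)
    then show ?thesis using False by (simp add: eval_char_def)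
  qed (simp add: assms(2) eval_char_def)
qed

text \<open>
  Weak-* continuous characters and partially multiplicative functionals correspond to each other by
  extension and restriction.  For the converse implication, the value of \<open>R\<close> at \<open>f\<close> is recovered from
  the values on multipliers through \<open>R (D * f) = R D * R f\<close> with a denominator \<open>D\<close> of \<open>f\<close>.
\<close>

lemma maximal_domain_iff:
  "maximal_domain \<longleftrightarrow> (\<forall>\<rho>\<in>characters. weak_star_continuous \<rho> \<longrightarrow> (\<exists>x\<in>X. \<rho> = eval_char x))"
proof (intro iffI ballI impI)
  fix \<rho> assume "maximal_domain" and \<rho>: "\<rho> \<in> characters" "weak_star_continuous \<rho>"
  obtain R where R: "partially_multiplicative R" "\<And>\<phi>. \<phi> \<in> Mult \<Longrightarrow> R \<phi> = \<rho> \<phi>"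
    using gleason_extension[OF \<rho>(1) weak_star_char_dist[OF \<rho> base_mem]] by blast
  obtain x where x: "x \<in> X" "\<And>f. f \<in> H \<Longrightarrow> R f = f x"
    using R(1) \<open>maximal_domain\<close> unfolding maximal_domain_def by blast
  have "\<rho> = eval_char x"
    using x(2) R(2) Mult_subset by (intro char_eqI[OF \<rho>(1)]) simp
  then show "\<exists>x\<in>X. \<rho> = eval_char x" using x(1) by blast
next
  assume ii: "\<forall>\<rho>\<in>characters. weak_star_continuous \<rho> \<longrightarrow> (\<exists>x\<in>X. \<rho> = eval_char x)"
  show maximal_domain
    unfolding maximal_domain_def
  proof (intro allI impI)
    fix R assume R: "partially_multiplicative R"
    obtain x where x: "x \<in> X" "restrict R Mult = eval_char x"
      using ii partially_multiplicative_restrict[OF R] by blast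
    have RM: "R \<phi> = \<phi> x" if "\<phi> \<in> Mult" for \<phi>
      using fun_cong[OF x(2), of \<phi>] that by (simp add: eval_char_def)
    have "R f = f x" if f: "f \<in> H" for f
    proof -
      obtain \<psi> \<theta> where \<psi>: "mbound \<psi> 1" "\<psi> x0 = 0" "\<And>x. x \<in> X \<Longrightarrow> \<psi> x \<noteq> 1"
        "mbound \<theta> (2 * hnorm f)" "(\<lambda>x. (unit x - \<psi> x) * f x) = \<theta>"
        using smirnov_factorization[OF f] by blast
      define D where "D = (\<lambda>x. unit x - \<psi> x)"
      have DM: "D \<in> Mult" unfolding D_def by (intro Mult_diff unit_Mult mbound_Mult[OF \<psi>(1)])
      have th: "(\<lambda>x. D x * f x) = \<theta>" using \<psi>(5) by (simp add: D_def)
      have "\<theta> \<in> Mult" using \<psi>(4) by (rule mbound_Mult)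
      then have "R (\<lambda>x. D x * f x) = D x * f x" using RM th by auto
      moreover have "R (\<lambda>x. D x * f x) = R D * R f"
        using R Mult_subset[OF DM] f Mult_mem[OF DM f] unfolding partially_multiplicative_def by blast
      ultimately have "D x * R f = D x * f x" using RM[OF DM] by simp
      moreover have "D x \<noteq> 0" using \<psi>(3)[OF x(1)] x(1) by (auto simp: D_def unit_def)
      ultimately show ?thesis by simp
    qed
    then show "\<exists>x\<in>X. \<forall>f\<in>H. R f = f x" using x(1) by blast
  qed
qed

text \<open>
  The characters at distance less than 2 from a point evaluation include all weak-* continuous ones,
  and for the base point there are no others.  A Gleason part that consists of the point evaluations
  is the class of one of them, as every character is equivalent to itself.
\<close>

lemma gleason_part_iff:
  "(\<forall>\<rho>\<in>characters. weak_star_continuous \<rho> \<longrightarrow> (\<exists>x\<in>X. \<rho> = eval_char x))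
    \<longleftrightarrow> eval_char ` X \<in> gleason_parts"
proof (intro iffI)
  assume ii: "\<forall>\<rho>\<in>characters. weak_star_continuous \<rho> \<longrightarrow> (\<exists>x\<in>X. \<rho> = eval_char x)"
  have "gleason_rel `` {eval_char x0} = eval_char ` X"
  proof (rule equalityI; rule subsetI)
    fix \<rho> assume "\<rho> \<in> gleason_rel `` {eval_char x0}"
    then have \<rho>: "\<rho> \<in> characters" "char_dist (eval_char x0) \<rho> < 2" by (auto simp: gleason_rel_def)
    obtain R where R: "partially_multiplicative R" "\<And>\<phi>. \<phi> \<in> Mult \<Longrightarrow> R \<phi> = \<rho> \<phi>"
      using gleason_extension[OF \<rho>] by blast
    have "weak_star_continuous \<rho>"
      by (rule continuous_map_eq[OF partially_multiplicative_restrict(2)[OF R(1)]])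
        (simp add: topspace_weak_star_Mult R(2))
    then show "\<rho> \<in> eval_char ` X" using ii \<rho>(1) by blast
  next
    fix \<rho> assume "\<rho> \<in> eval_char ` X"
    then obtain x where x: "x \<in> X" "\<rho> = eval_char x" by blast
    have "char_dist (eval_char x0) \<rho> < 2"
      unfolding x(2) by (intro weak_star_char_dist eval_char_mem eval_char_weak_star x(1) base_mem)
    then show "\<rho> \<in> gleason_rel `` {eval_char x0}"
      using x eval_char_mem base_mem by (auto simp: gleason_rel_def)
  qed
  then show "eval_char ` X \<in> gleason_parts"
    unfolding gleason_parts_def using quotientI[OF eval_char_mem[OF base_mem], of gleason_rel] by simp
next
  assume "eval_char ` X \<in> gleason_parts"
  then obtain \<sigma> where \<sigma>: "\<sigma> \<in> characters" "eval_char ` X = gleason_rel `` {\<sigma>}"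
    unfolding gleason_parts_def by (auto elim: quotientE)
  have "\<sigma> \<in> gleason_rel `` {\<sigma>}" using \<sigma>(1) char_dist_self[of \<sigma>] by (auto simp: gleason_rel_def)
  then obtain y where y: "y \<in> X" "\<sigma> = eval_char y" using \<sigma>(2) by blast
  show "\<forall>\<rho>\<in>characters. weak_star_continuous \<rho> \<longrightarrow> (\<exists>x\<in>X. \<rho> = eval_char x)"
  proof (intro ballI impI)
    fix \<rho> assume \<rho>: "\<rho> \<in> characters" "weak_star_continuous \<rho>"
    have "char_dist \<sigma> \<rho> < 2" unfolding y(2) by (rule weak_star_char_dist[OF \<rho> y(1)])
    then have "\<rho> \<in> gleason_rel `` {\<sigma>}" using \<rho>(1) \<sigma>(1) by (simp add: gleason_rel_def)
    then show "\<exists>x\<in>X. \<rho> = eval_char x" using \<sigma>(2) by blast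
  qed
qed

end

theorem proposition1p4:
  fixes X :: "'a set"
    and H :: "('a \<Rightarrow> complex) set"
    and ip :: "('a \<Rightarrow> complex) \<Rightarrow> ('a \<Rightarrow> complex) \<Rightarrow> complex"
    and k :: "'a \<Rightarrow> 'a \<Rightarrow> complex"
  assumes "rkhs X H ip k"
    and "rkhs.normalized X k"
    and "rkhs.complete_pick X H ip k"
  shows "(rkhs.maximal_domain X H ip \<longleftrightarrow>
            (\<forall>\<rho>\<in>rkhs.characters X H.
               continuous_map (rkhs.weak_star_Mult X H ip) euclidean \<rho> \<longrightarrow>
               (\<exists>x\<in>X. \<rho> = rkhs.eval_char X H x)))
       \<and> ((\<forall>\<rho>\<in>rkhs.characters X H.
               continuous_map (rkhs.weak_star_Mult X H ip) euclidean \<rho> \<longrightarrow>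
               (\<exists>x\<in>X. \<rho> = rkhs.eval_char X H x)) \<longleftrightarrow>
            rkhs.eval_char X H ` X \<in> rkhs.gleason_parts X H ip)"
proof -
  obtain x0 where "x0 \<in> X" "\<forall>x\<in>X. k x x0 = 1"
    using assms(2) unfolding rkhs.normalized_def[OF assms(1)] by blast
  then interpret normalized_pick_space X H ip k x0
    using assms(1,3) by (simp add: normalized_pick_space_def normalized_pick_space_axioms_def)
  show ?thesis
    using maximal_domain_iff gleason_part_iff by (rule conjI)
qed

end
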